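(* There exists a constant $C>0$, independent of the dimension (and of the parameters below), such that the following holds for every integer $d\ge 2$ and all $p_1,\dots,p_d\in[0,1)$. Consider inhomogeneous non-oriented Bernoulli bond percolation on $\mathbb{Z}^d$ with parameters $p_1,\dots,p_d$, and set $\delta=\delta(p_1,\dots,p_d):=p_1+\cdots+p_d-\tfrac12$. If $\delta>0$ and $\max_{1\le i\le d}p_i\le C\delta^2$, then $\theta_d(p_1,\dots,p_d)>0$.
   Context: Inhomogeneous non-oriented Bernoulli bond percolation on $\mathbb{Z}^d$ with parameters $p_1,\dots,p_d\in[0,1]$: let $e_1,\dots,e_d$ be the canonical vectors of $\mathbb{Z}^d$. For each $i=1,\dots,d$ let $E_i=\{\langle x,x\pm e_i\rangle: x\in\mathbb{Z}^d\}$ be the set of (undirected) nearest-neighbour edges parallel to $e_i$, and let $E(\mathbb{Z}^d)=\bigcup_{i}E_i$. Let $\{X_e\}_{e\in E(\mathbb{Z}^d)}$ be independent random variables such that $X_e$ has Bernoulli($p_i$) distribution whenever $e\in E_i$, and let $\mathbb{P}$ be the resulting product measure. An edge $e$ is open if $X_e=1$ and closed otherwise. For $x,y\in\mathbb{Z}^d$, write $x\leftrightarrow y$ if there are $x_0=x,x_1,\dots,x_n=y$ (with $n\ge 0$) such that each $\langle x_{j-1},x_j\rangle$ belongs to $E(\mathbb{Z}^d)$ and is open, $j=1,\dots,n$. The open cluster of the origin is $\mathcal{C}^d_0=\{x\in\mathbb{Z}^d: 0\leftrightarrow x\}$, with size $|\mathcal{C}^d_0|$, and $\theta_d(p_1,\dots,p_d):=\mathbb{P}(|\mathcal{C}^d_0|=\infty)$.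 *)

theory Defs
  imports "HOL-Probability.Probability"
begin

text \<open>Since the dimension is quantified inside the theorem, the lattice of dimension \<open>d\<close> is
  a carrier set: a point is an integer sequence vanishing outside the coordinates
  \<open>1, \<dots>, d\<close>, so that distinct points of the lattice are distinct functions.\<close>

definition lattice :: "nat \<Rightarrow> (nat \<Rightarrow> int) set" where
  "lattice d = {x. \<forall>i. i \<notin> {1..d} \<longrightarrow> x i = 0}"

definition canonical_vec :: "nat \<Rightarrow> nat \<Rightarrow> int" where
  "canonical_vec i = (\<lambda>j. if j = i then 1 else 0)"

text \<open>An undirected edge is the two-element set of its endpoints.\<close>

definition axis_edges :: "nat \<Rightarrow> nat \<Rightarrow> (nat \<Rightarrow> int) set set" where
  "axis_edges d i =
     {{x, y} | x y. x \<in> lattice d \<and>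
        (y = (\<lambda>j. x j + canonical_vec i j) \<or> y = (\<lambda>j. x j - canonical_vec i j))}"

definition lattice_edges :: "nat \<Rightarrow> (nat \<Rightarrow> int) set set" where
  "lattice_edges d = (\<Union>i\<in>{1..d}. axis_edges d i)"

text \<open>The description below is unique for edges of the lattice, see \<open>edge_param_eq\<close>.\<close>

definition edge_param :: "nat \<Rightarrow> (nat \<Rightarrow> real) \<Rightarrow> (nat \<Rightarrow> int) set \<Rightarrow> real" where
  "edge_param d p e = p (THE i. i \<in> {1..d} \<and> e \<in> axis_edges d i)"

lemma axis_edges_unique:
  assumes "e \<in> axis_edges d i" "e \<in> axis_edges d j"
  shows "i = j"
proof -
  have differ: "a k \<noteq> b k \<longleftrightarrow> k = l"
    if "e \<in> axis_edges d l" "e = {a, b}" for a b k l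
  proof -
    from that(1) obtain x y where xy: "e = {x, y}"
        "y = (\<lambda>j. x j + canonical_vec l j) \<or> y = (\<lambda>j. x j - canonical_vec l j)"
      unfolding axis_edges_def by blast
    from xy(2) have "x k \<noteq> y k \<longleftrightarrow> k = l"
      by (elim disjE) (simp_all add: canonical_vec_def)
    moreover from xy(1) that(2) have "a = x \<and> b = y \<or> a = y \<and> b = x"
      by (simp add: doubleton_eq_iff)
    ultimately show ?thesis
      by (elim disjE conjE) (simp_all add: eq_commute)
  qed
  from assms(1) obtain a b where e: "e = {a, b}"
    unfolding axis_edges_def by blast
  have "a i \<noteq> b i"
    using differ[OF assms(1) e, of i] by simp
  then show ?thesis
    using differ[OF assms(2) e, of i] by simp
qed

lemma edge_param_eq:
  assumes "i \<in> {1..d}" "e \<in> axis_edges d i"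
  shows "edge_param d p e = p i"
proof -
  have "(THE i. i \<in> {1..d} \<and> e \<in> axis_edges d i) = i"
    using assms axis_edges_unique by (intro the_equality) auto
  then show ?thesis
    by (simp add: edge_param_def)
qed

text \<open>A configuration \<open>\<omega>\<close> maps each edge to \<open>True\<close> (open) or \<open>False\<close> (closed).\<close>

definition percolation ::
    "nat \<Rightarrow> (nat \<Rightarrow> real) \<Rightarrow> ((nat \<Rightarrow> int) set \<Rightarrow> bool) measure" where
  "percolation d p =
     (\<Pi>\<^sub>M e\<in>lattice_edges d. measure_pmf (bernoulli_pmf (edge_param d p e)))"

definition connected_by ::
    "nat \<Rightarrow> ((nat \<Rightarrow> int) set \<Rightarrow> bool) \<Rightarrow> (nat \<Rightarrow> int) \<Rightarrow> (nat \<Rightarrow> int) \<Rightarrow> bool" where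
  "connected_by d \<omega> x y \<longleftrightarrow>
     (\<exists>n. \<exists>v :: nat \<Rightarrow> nat \<Rightarrow> int. v 0 = x \<and> v n = y \<and>
        (\<forall>j\<in>{1..n}. {v (j - 1), v j} \<in> lattice_edges d \<and> \<omega> {v (j - 1), v j}))"

definition origin_cluster ::
    "nat \<Rightarrow> ((nat \<Rightarrow> int) set \<Rightarrow> bool) \<Rightarrow> (nat \<Rightarrow> int) set" where
  "origin_cluster d \<omega> = {x \<in> lattice d. connected_by d \<omega> (\<lambda>_. 0) x}"

definition theta :: "nat \<Rightarrow> (nat \<Rightarrow> real) \<Rightarrow> real" where
  "theta d p =
     measure (percolation d p) {\<omega> \<in> space (percolation d p). infinite (origin_cluster d \<omega>)}"

definition delta :: "nat \<Rightarrow> (nat \<Rightarrow> real) \<Rightarrow> real" where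
  "delta d p = (\<Sum>i=1..d. p i) - 1 / 2"

lemma prob_space_percolation: "prob_space (percolation d p)"
  unfolding percolation_def by (intro prob_space_PiM prob_space_measure_pmf)

lemma countable_lattice: "countable (lattice d)"
proof -
  let ?f = "\<lambda>g i. if i \<in> {1..d} then g i else (0::int)"
  have "countable (PiE {1..d} (\<lambda>_. UNIV :: int set))"
    by (intro countable_PiE) auto
  then have "countable (?f ` PiE {1..d} (\<lambda>_. UNIV))"
    by (rule countable_image)
  moreover have "lattice d \<subseteq> ?f ` PiE {1..d} (\<lambda>_. UNIV)"
  proof
    fix x assume "x \<in> lattice d"
    then have "x = ?f (restrict x {1..d})"
      unfolding lattice_def by (intro ext) simp
    then show "x \<in> ?f ` PiE {1..d} (\<lambda>_. UNIV)"
      by (rule image_eqI[of x ?f "restrict x {1..d}"]) (simp add: restrict_PiE_iff)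
  qed
  ultimately show ?thesis
    by (rule countable_subset[rotated])
qed

lemma lattice_edges_subset:
  assumes "e \<in> lattice_edges d"
  shows "e \<subseteq> lattice d"
proof -
  from assms obtain i x y where "i \<in> {1..d}" "e = {x, y}" "x \<in> lattice d"
      "y = (\<lambda>j. x j + canonical_vec i j) \<or> y = (\<lambda>j. x j - canonical_vec i j)"
    unfolding lattice_edges_def axis_edges_def by blast
  then show ?thesis
    unfolding lattice_def canonical_vec_def by (elim disjE) auto
qed

lemma measurable_connected_by:
  "{\<omega> \<in> space (percolation d p). connected_by d \<omega> x y} \<in> sets (percolation d p)"
proof -
  let ?M = "percolation d p"
  define step where
    "step \<omega> z y \<longleftrightarrow> {z, y} \<in> lattice_edges d \<and> \<omega> {z, y}" for \<omega> z y
  define walk where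
    "walk n \<omega> y \<longleftrightarrow> (\<exists>v. v 0 = x \<and> v n = y \<and> (\<forall>j\<in>{1..n}. step \<omega> (v (j - 1)) (v j)))"
    for n :: nat and \<omega> y
  have step: "{\<omega> \<in> space ?M. step \<omega> z y} \<in> sets ?M" for z y
  proof (cases "{z, y} \<in> lattice_edges d")
    case True
    have "(\<lambda>\<omega>. \<omega> {z, y}) \<in>
        measurable ?M (measure_pmf (bernoulli_pmf (edge_param d p {z, y})))"
      unfolding percolation_def using True by (rule measurable_component_singleton)
    from measurable_sets[OF this, of "{True}"] show ?thesis
      using True by (simp add: step_def vimage_def Int_def conj_commute)
  qed (simp add: step_def)
  have walk_0: "walk 0 \<omega> y \<longleftrightarrow> x = y" for \<omega> y
    by (auto simp: walk_def)
  have walk_Suc: "walk (Suc n) \<omega> y \<longleftrightarrow> (\<exists>z\<in>lattice d. walk n \<omega> z \<and> step \<omega> z y)" for n \<omega> y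
  proof
    assume "walk (Suc n) \<omega> y"
    then obtain v where v: "v 0 = x" "v (Suc n) = y"
        "\<forall>j\<in>{1..Suc n}. step \<omega> (v (j - 1)) (v j)"
      by (auto simp: walk_def)
    from v(3) have "step \<omega> (v (Suc n - 1)) (v (Suc n))"
      by (rule bspec) simp
    with v(2) have last: "step \<omega> (v n) y"
      by simp
    moreover from last have "v n \<in> lattice d"
      using lattice_edges_subset by (auto simp: step_def)
    moreover have "walk n \<omega> (v n)"
      unfolding walk_def using v by (intro exI[of _ v]) auto
    ultimately show "\<exists>z\<in>lattice d. walk n \<omega> z \<and> step \<omega> z y"
      by blast
  next
    assume "\<exists>z\<in>lattice d. walk n \<omega> z \<and> step \<omega> z y"
    then obtain v where "v 0 = x" "\<forall>j\<in>{1..n}. step \<omega> (v (j - 1)) (v j)" "step \<omega> (v n) y"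
      by (auto simp: walk_def)
    then show "walk (Suc n) \<omega> y"
      unfolding walk_def
      by (intro exI[of _ "v(Suc n := y)"]) (auto simp: le_Suc_eq)
  qed
  have "{\<omega> \<in> space ?M. walk n \<omega> y} \<in> sets ?M" for n y
  proof (induction n arbitrary: y)
    case 0
    then show ?case by (simp add: walk_0)
  next
    case (Suc n)
    have "{\<omega> \<in> space ?M. walk n \<omega> z \<and> step \<omega> z y} \<in> sets ?M" for z
      by (intro sets.sets_Collect_conj Suc step)
    then show ?case
      unfolding walk_Suc using countable_lattice
      by (intro sets.sets_Collect_countable_Ex')
  qed
  moreover have "connected_by d \<omega> x y \<longleftrightarrow> (\<exists>n. walk n \<omega> y)" for \<omega>
    by (simp add: connected_by_def walk_def step_def)
  ultimately show ?thesis
    by (simp add: sets.sets_Collect_countable_Ex)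
qed

lemma measurable_infinite_cluster:
  "{\<omega> \<in> space (percolation d p). infinite (origin_cluster d \<omega>)} \<in> sets (percolation d p)"
proof -
  let ?M = "percolation d p"
  let ?F = "{F. finite F \<and> F \<subseteq> lattice d}"
  have iff: "infinite (origin_cluster d \<omega>) \<longleftrightarrow>
      (\<forall>F\<in>?F. \<exists>y\<in>lattice d - F. connected_by d \<omega> (\<lambda>_. 0) y)" for \<omega>
  proof
    assume inf: "infinite (origin_cluster d \<omega>)"
    show "\<forall>F\<in>?F. \<exists>y\<in>lattice d - F. connected_by d \<omega> (\<lambda>_. 0) y"
    proof
      fix F assume "F \<in> ?F"
      with inf have "\<not> origin_cluster d \<omega> \<subseteq> F"
        using finite_subset by blast
      then show "\<exists>y\<in>lattice d - F. connected_by d \<omega> (\<lambda>_. 0) y"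
        by (auto simp: origin_cluster_def)
    qed
  next
    assume *: "\<forall>F\<in>?F. \<exists>y\<in>lattice d - F. connected_by d \<omega> (\<lambda>_. 0) y"
    show "infinite (origin_cluster d \<omega>)"
    proof
      assume "finite (origin_cluster d \<omega>)"
      then have "origin_cluster d \<omega> \<in> ?F"
        by (auto simp: origin_cluster_def)
      with * obtain y where "y \<in> lattice d - origin_cluster d \<omega>" "connected_by d \<omega> (\<lambda>_. 0) y"
        by blast
      then show False
        by (simp add: origin_cluster_def)
    qed
  qed
  have "countable ?F"
    using countable_lattice by (rule countable_Collect_finite_subset)
  moreover have "countable (lattice d - F)" for F
    using countable_lattice by (rule countable_Diff)
  ultimately show ?thesis
    unfolding iff
    by (intro sets.sets_Collect_countable_All' sets.sets_Collect_countable_Ex'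
          measurable_connected_by)
qed

end

theory Submission
  imports Defs
begin

text \<open>
  The proof is a second moment argument. Sixteen disjoint groups of coordinates, each of total
  parameter of order \<open>\<delta>\<close>, are only used in the positive direction (\<open>D\<close>-steps); the remaining
  coordinates \<open>J\<close> are used in both directions and still satisfy \<open>2 \<Sum>\<^sub>J p \<ge> 1\<close>. A random path consists of
  layers: a self-avoiding \<open>J\<close>-walk whose length is spread over \<open>L \<approx> 1 / \<delta>\<close> values, followed by one
  \<open>D\<close>-step. If \<open>\<mu>\<close> is the law of this path, then reaching level \<open>n\<close> has probability at least \<open>1 / K\<close>
  as soon as, for every \<open>\<gamma>\<close>, the sum over \<open>\<gamma>'\<close> of \<open>\<mu>(\<gamma>') \<Prod> (1 / p\<^sub>e)\<close> is at most \<open>K\<close>, the product being over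
  the edges \<open>e\<close> shared by \<open>\<gamma>\<close> and \<open>\<gamma>'\<close>.

  Following \<open>\<gamma>\<close> inside a layer costs a factor at most \<open>1\<close> per edge, and leaving the layer at the same place
  as \<open>\<gamma>\<close> costs \<open>1 / (L \<rho>) < 1\<close> in total, because the length is spread out. Once separated, two paths
  meet again only with small probability: within a layer because the walk hits a given point at a given time
  \<open>\<ge> 3\<close> with probability \<open>O(\<eta>\<^sup>2)\<close> where \<open>\<eta> = O(max p)\<close> and \<open>L\<^sup>2 \<eta>\<close> is small, and in later
  layers because in addition the \<open>D\<close>-parts must agree, which after \<open>g\<close> layers has probability at
  most \<open>1 / (g + 1)\<^sup>2\<close>.
\<close>

section \<open>Preliminaries\<close>

text \<open>The order \<delta>^2 in the hypothesis comes from a balance inside one layer. A shared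
  \<open>D\<close>-step contributes up to \<open>1 / (16 * \<rho>)\<close>, which only the division
  by the number of possible walk lengths can offset, so \<open>L\<close> has to be of order
  1/\<delta>. But two sections of length \<open>L\<close> have about L^2 chances to meet, each of
  order \<open>\<eta>\<close>, so \<open>L\<^sup>2 * \<eta>\<close> has to be small. The obstacle is
  that \<open>J\<close> has hardly any surplus over the threshold: a walk that has joined the fixed
  path follows it almost without loss, and the only bound on the energy that is uniform in the two
  starting points is of order \<open>L\<close>. Such factors must not multiply over the layers. So
  two bounds are proved in one induction: the crude one, which reproduces itself because staying
  together multiplies it by a constant below 1, and a sharp one, 1 plus a multiple of the expected
  number of contacts, which is at most 2 once the \<open>D\<close>-coordinates differ. The groups
  serve to keep the estimates free of the dimension: the individual parameters in \<open>D\<close>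
  are arbitrary, but equally likely groups project the \<open>D\<close>-steps onto fair
  bits.\<close>

lemma (in prob_space) second_moment_union:
  fixes B :: "'b \<Rightarrow> 'a set" and c :: "'b \<Rightarrow> real"
  assumes I: "finite I" and B: "\<And>i. i \<in> I \<Longrightarrow> B i \<in> events"
    and first: "(\<Sum>i\<in>I. c i * prob (B i)) = 1"
    and second: "(\<Sum>i\<in>I. \<Sum>j\<in>I. c i * c j * prob (B i \<inter> B j)) \<le> K" and K: "K > 0"
  shows "prob (\<Union>i\<in>I. B i) \<ge> 1 / K"
proof -
  let ?U = "\<Union>i\<in>I. B i"
  have U: "?U \<in> events" using I B by auto
  \<comment> \<open>This is the expansion of the square of \<open>X - K * indicator ?U\<close>,
    where \<open>X\<close> is the weighted sum of the indicators, which vanishes off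
    \<open>?U\<close>. That its expectation is nonnegative already yields the claim.\<close>
  let ?f = "\<lambda>\<omega>. (\<Sum>i\<in>I. \<Sum>j\<in>I. c i * c j * indicator (B i \<inter> B j) \<omega>)
      - 2 * K * (\<Sum>i\<in>I. c i * indicator (B i) \<omega>) + K\<^sup>2 * indicator ?U \<omega> :: real"
  have int: "integrable M (indicator A :: _ \<Rightarrow> real)" if "A \<in> events" for A
    using that by (intro integrable_real_indicator) (auto simp: less_top[symmetric])
  have "?f \<omega> = ((\<Sum>i\<in>I. c i * indicator (B i) \<omega>) - K * indicator ?U \<omega>)\<^sup>2" for \<omega>
  proof -
    have a: "c i * indicator (B i) \<omega> * indicator ?U \<omega> = (c i * indicator (B i) \<omega> :: real)"
      if "i \<in> I" for i
      using that by (auto simp: indicator_def)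
    have "(\<Sum>i\<in>I. c i * indicator (B i) \<omega>) * indicator ?U \<omega>
        = (\<Sum>i\<in>I. c i * indicator (B i) \<omega> :: real)"
      unfolding sum_distrib_right by (rule sum.cong[OF refl a])
    moreover have "(\<Sum>i\<in>I. \<Sum>j\<in>I. c i * c j * indicator (B i \<inter> B j) \<omega>)
        = (\<Sum>i\<in>I. c i * indicator (B i) \<omega> :: real)\<^sup>2"
      unfolding power2_eq_square sum_product
      by (intro sum.cong refl) (simp add: indicator_inter_arith ac_simps)
    moreover have "(indicator ?U \<omega> :: real)\<^sup>2 = indicator ?U \<omega>"
      by (simp add: indicator_def)
    ultimately show ?thesis
      by (simp add: power2_diff power_mult_distrib algebra_simps)
  qed
  then have "0 \<le> (\<integral>\<omega>. ?f \<omega> \<partial>M)"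
    by (intro integral_nonneg_AE) auto
  also have "\<dots> = (\<Sum>i\<in>I. \<Sum>j\<in>I. c i * c j * prob (B i \<inter> B j))
      - 2 * K * (\<Sum>i\<in>I. c i * prob (B i)) + K\<^sup>2 * prob ?U"
    using B U sets.Int[of _ M] by (simp add: Bochner_Integration.integral_sum int)
  also have "\<dots> \<le> K - 2 * K + K\<^sup>2 * prob ?U"
    using first second by simp
  finally have "K \<le> K * (K * prob ?U)" by (simp add: power2_eq_square)
  then have "1 \<le> K * prob ?U" using K by simp
  then show ?thesis using K by (simp add: field_simps)
qed

text \<open>An explicit form of the decay of the central binomial probability like the inverse
  square root. The factor \<open>2 * m + 1\<close> passes through the induction because
  \<open>(2 * m + 1) * (2 * m + 3) \<le> (2 * m + 2)\<^sup>2\<close>.\<close>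

lemma central_binomial_sq_le: "real ((2 * m) choose m) ^ 2 * (2 * m + 1) \<le> 16 ^ m"
proof (induction m)
  case (Suc m)
  have eq: "(m + 1) * (2 * Suc m choose Suc m) = 2 * (2 * m + 1) * (2 * m choose m)"
  proof -
    have a: "Suc m * (Suc (Suc (2 * m)) choose Suc m) = Suc (Suc (2 * m)) * (Suc (2 * m) choose m)"
      by (rule Suc_times_binomial)
    have b: "Suc m * (Suc (2 * m) choose m) = Suc (2 * m) * (2 * m choose m)"
      using Suc_times_binomial[of m "2 * m"] binomial_symmetric[of m "Suc (2 * m)"] by simp
    have "Suc m * (Suc m * (2 * Suc m choose Suc m)) = Suc m * (2 * (2 * m + 1) * (2 * m choose m))"
      using a b by (simp add: algebra_simps)
    then show ?thesis by (simp del: mult_Suc mult_Suc_right)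
  qed
  let ?a = "real (2 * m choose m)" and ?b = "real (2 * Suc m choose Suc m)"
  let ?m = "real m"
  have eq': "(?m + 1) * ?b = 2 * (2 * ?m + 1) * ?a"
    using arg_cong[OF eq, of real] by (simp add: algebra_simps)
  have "(?m + 1)\<^sup>2 * (?b\<^sup>2 * (2 * ?m + 3)) = ((?m + 1) * ?b)\<^sup>2 * (2 * ?m + 3)"
    by (simp only: power_mult_distrib mult.assoc)
  also have "\<dots> = (?a\<^sup>2 * (2 * ?m + 1)) * (4 * ((2 * ?m + 1) * (2 * ?m + 3)))"
    unfolding eq' by (simp add: power2_eq_square algebra_simps)
  also have "\<dots> \<le> 16 ^ m * (4 * (4 * (?m + 1)\<^sup>2))"
  proof (rule mult_mono)
    show "?a\<^sup>2 * (2 * ?m + 1) \<le> 16 ^ m" using Suc.IH by (simp add: add.commute)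
    show "4 * ((2 * real m + 1) * (2 * real m + 3)) \<le> 4 * (4 * (real m + 1)\<^sup>2)"
      by (simp add: power2_eq_square algebra_simps)
  qed auto
  finally have "(real m + 1)\<^sup>2 * (?b\<^sup>2 * (2 * ?m + 3)) \<le> (real m + 1)\<^sup>2 * 16 ^ Suc m"
    by (simp add: mult_ac)
  then have "?b\<^sup>2 * (2 * ?m + 3) \<le> 16 ^ Suc m"
    by (subst (asm) mult_le_cancel_left_pos) auto
  then show ?case by (simp add: add.commute del: mult_Suc_right binomial_Suc_Suc)
qed simp

lemma binomial_sq_le: "(real (n choose k) / 2 ^ n) ^ 2 \<le> 1 / (n + 1)"
proof -
  have "real (n choose k) ^ 2 * (n + 1) \<le> 4 ^ n"
  proof (cases "even n")
    case True
    then obtain m where m: "n = 2 * m" by auto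
    have "real (n choose k) ^ 2 * (n + 1) \<le> real (2 * m choose m) ^ 2 * (2 * m + 1)"
      unfolding m using binomial_maximum'[of m k] by (intro mult_mono power_mono) auto
    also have "\<dots> \<le> 16 ^ m" by (rule central_binomial_sq_le)
    finally show ?thesis by (simp add: m power_mult)
  next
    case False
    then obtain m where m: "n = Suc (2 * m)" by (auto elim: oddE)
    \<comment> \<open>An odd row is reduced to the next even one: its two middle entries are equal
      and add up to the central entry below them.\<close>
    have "2 * (n choose k) \<le> 2 * Suc m choose Suc m"
    proof -
      have "n choose k \<le> n choose m"
        using binomial_maximum[of n k] by (simp add: m)
      moreover have "2 * Suc m choose Suc m = 2 * (n choose m)"
        using binomial_symmetric[of m n] by (simp add: m)
      ultimately show ?thesis by simp
    qed
    then have "2 * real (n choose k) \<le> real (2 * Suc m choose Suc m)"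
      by (metis of_nat_le_iff of_nat_mult of_nat_numeral)
    then have "(2 * real (n choose k)) ^ 2 * (n + 1) \<le> real (2 * Suc m choose Suc m) ^ 2 * (2 * Suc m + 1)"
      by (intro mult_mono power_mono) (auto simp: m)
    also have "\<dots> \<le> 16 ^ Suc m" by (rule central_binomial_sq_le)
    finally have "real (n choose k) ^ 2 * (2 + 2 * real m) \<le> 4 * 16 ^ m"
      by (simp add: m mult.commute)
    then show ?thesis by (simp add: m power_mult)
  qed
  then have "real (n choose k) ^ 2 * (n + 1) \<le> (2 ^ n) ^ 2"
    by (simp add: power_mult[symmetric] mult.commute[of n]) (simp add: power_mult)
  then show ?thesis by (simp add: field_simps)
qed

text \<open>Greedy choice: elements are added until the sum first reaches \<open>\<rho>\<close>, so
  the excess is at most one element.\<close>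

lemma ex_subset_sum_between:
  fixes p :: "'a \<Rightarrow> real" and \<rho> M :: real
  assumes "finite I" "\<And>i. i \<in> I \<Longrightarrow> 0 \<le> p i \<and> p i \<le> M" "\<rho> \<le> sum p I" "0 \<le> \<rho>" "0 \<le> M"
  shows "\<exists>A\<subseteq>I. \<rho> \<le> sum p A \<and> sum p A \<le> \<rho> + M"
  using assms
proof (induction I rule: finite_induct)
  case (insert i I)
  show ?case
  proof (cases "\<rho> \<le> sum p I")
    case True
    with insert show ?thesis by (meson insertI2 subset_insertI2)
  next
    case False
    with insert have "sum p (insert i I) \<le> \<rho> + M" by fastforce
    with insert.prems show ?thesis by blast
  qed
qed auto

text \<open>Groups are taken out one after the other. Each removes at most
  \<open>\<rho> + M\<close>, so the hypothesis on \<open>sum p I\<close> leaves at least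
  \<open>\<rho>\<close> for the next one.\<close>

lemma ex_disjoint_family_sum_between:
  fixes p :: "'a \<Rightarrow> real" and \<rho> M :: real
  assumes "finite C" "finite I" "\<And>i. i \<in> I \<Longrightarrow> 0 \<le> p i \<and> p i \<le> M"
    "real (card C) * (\<rho> + M) \<le> sum p I" "0 \<le> \<rho>" "0 \<le> M"
  shows "\<exists>A. (\<forall>c\<in>C. A c \<subseteq> I \<and> \<rho> \<le> sum p (A c) \<and> sum p (A c) \<le> \<rho> + M) \<and>
    disjoint_family_on A C"
  using assms
proof (induction C rule: finite_induct)
  case empty
  then show ?case by (simp add: disjoint_family_on_def)
next
  case (insert c C)
  from insert have le: "real (card C) * (\<rho> + M) + (\<rho> + M) \<le> sum p I"
    by (simp add: algebra_simps)
  with insert.prems have le': "real (card C) * (\<rho> + M) \<le> sum p I" by linarith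
  obtain A where A: "\<forall>c\<in>C. A c \<subseteq> I \<and> \<rho> \<le> sum p (A c) \<and> sum p (A c) \<le> \<rho> + M"
    "disjoint_family_on A C"
    using insert.IH[OF insert.prems(1,2) le' insert.prems(4,5)] by auto
  let ?I = "I - (\<Union>c\<in>C. A c)"
  have "sum p (\<Union>c\<in>C. A c) = (\<Sum>c\<in>C. sum p (A c))"
    using insert.hyps(1) A finite_subset[OF _ insert.prems(1)]
    by (intro sum.UNION_disjoint) (simp_all add: disjoint_family_on_def)
  also have "\<dots> \<le> real (card C) * (\<rho> + M)"
    using A by (intro sum_bounded_above) auto
  finally have "\<rho> \<le> sum p ?I"
    using A(1) le insert.prems(1,5) by (subst sum_diff) auto
  with ex_subset_sum_between[of ?I p M \<rho>] insert.prems obtain B where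
    B: "B \<subseteq> ?I" "\<rho> \<le> sum p B" "sum p B \<le> \<rho> + M" by auto
  have "\<forall>c'\<in>insert c C. (A(c := B)) c' \<subseteq> I \<and> \<rho> \<le> sum p ((A(c := B)) c') \<and> sum p ((A(c := B)) c') \<le> \<rho> + M"
    using A B by auto
  moreover have "disjoint_family_on (A(c := B)) (insert c C)"
    using A(2) B(1) insert.hyps by (fastforce simp: disjoint_family_on_def)
  ultimately show ?case by blast
qed

lemma measure_percolation_open:
  assumes F: "finite F" "F \<subseteq> lattice_edges d"
    and p: "\<And>e. e \<in> F \<Longrightarrow> 0 \<le> edge_param d p e \<and> edge_param d p e \<le> 1"
  shows "{\<omega> \<in> space (percolation d p). \<forall>e\<in>F. \<omega> e} \<in> sets (percolation d p)"
    and "measure (percolation d p) {\<omega> \<in> space (percolation d p). \<forall>e\<in>F. \<omega> e}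
      = (\<Prod>e\<in>F. edge_param d p e)"
proof -
  interpret product_prob_space "\<lambda>e. measure_pmf (bernoulli_pmf (edge_param d p e))" "lattice_edges d"
    by unfold_locales
  have eq: "{\<omega> \<in> space (percolation d p). \<forall>e\<in>F. \<omega> e}
      = {\<omega> \<in> space (percolation d p). \<forall>e\<in>F. \<omega> e \<in> {True}}" by auto
  show "{\<omega> \<in> space (percolation d p). \<forall>e\<in>F. \<omega> e} \<in> sets (percolation d p)"
  proof (rule sets.sets_Collect_finite_All[OF _ F(1)])
    fix e assume "e \<in> F"
    with F have e: "e \<in> lattice_edges d" by auto
    have "(\<lambda>\<omega>. \<omega> e) \<in> measurable (percolation d p) (measure_pmf (bernoulli_pmf (edge_param d p e)))"
      unfolding percolation_def using e by (rule measurable_component_singleton)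
    from measurable_sets[OF this, of "{True}"]
    show "{\<omega> \<in> space (percolation d p). \<omega> e} \<in> sets (percolation d p)"
      by (simp only: vimage_def Int_def conj_commute mem_Collect_eq singleton_iff sets_measure_pmf) simp
  qed
  have "emeasure (percolation d p) {\<omega> \<in> space (percolation d p). \<forall>e\<in>F. \<omega> e \<in> {True}}
     = (\<Prod>e\<in>F. emeasure (measure_pmf (bernoulli_pmf (edge_param d p e))) {True})"
    unfolding percolation_def using F by (intro emeasure_PiM_Collect) auto
  also have "\<dots> = (\<Prod>e\<in>F. ennreal (edge_param d p e))"
    using p by (intro prod.cong) (auto simp: emeasure_pmf_single)
  also have "\<dots> = ennreal (\<Prod>e\<in>F. edge_param d p e)"
    using p by (intro prod_ennreal) auto
  finally show "measure (percolation d p) {\<omega> \<in> space (percolation d p). \<forall>e\<in>F. \<omega> e}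
      = (\<Prod>e\<in>F. edge_param d p e)"
    unfolding measure_def eq using p by (simp add: prod_nonneg del: singleton_iff)
qed

section \<open>The signed coordinate walk\<close>

type_synonym pos = "nat \<Rightarrow> int"
type_synonym step = "nat \<times> int"

definition move :: "pos \<Rightarrow> step \<Rightarrow> pos" where
  "move x s = x(fst s := x (fst s) + snd s)"

definition point_mass :: "pos \<Rightarrow> pos \<Rightarrow> real" where
  "point_mass y z = (if z = y then 1 else 0)"

definition path_param :: "nat \<Rightarrow> (nat \<Rightarrow> pos) \<Rightarrow> pos set set \<Rightarrow> bool" where
  "path_param T v E \<longleftrightarrow> inj_on v {..T} \<and> E = {{v i, v (Suc i)} | i. i < T}"

lemma move_inj:
  assumes "snd s \<noteq> 0" "move x s = move x t"
  shows "s = t"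
proof -
  have *: "move x s (fst s) = move x t (fst s)" using assms(2) by simp
  have "fst t = fst s"
    using * assms(1) by (simp add: move_def split: if_splits)
  with * have "snd s = snd t" by (simp add: move_def)
  with \<open>fst t = fst s\<close> show ?thesis by (simp add: prod_eq_iff)
qed

lemma path_param_reverse:
  assumes "path_param T v E"
  shows "path_param T (\<lambda>i. v (T - i)) E" "(\<lambda>i. v (T - i)) ` {..T} = v ` {..T}"
proof -
  have inj: "inj_on v {..T}" and E: "E = {{v i, v (Suc i)} | i. i < T}"
    using assms by (auto simp: path_param_def)
  have "inj_on (\<lambda>i. v (T - i)) {..T}"
    using inj by (fastforce simp: inj_on_def)
  moreover have "E = {{v (T - i), v (T - Suc i)} | i. i < T}"
  proof (intro equalityI subsetI)
    fix e assume "e \<in> E"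
    then obtain i where "i < T" "e = {v i, v (Suc i)}" using E by auto
    then show "e \<in> {{v (T - i), v (T - Suc i)} | i. i < T}"
      by (intro CollectI exI[of _ "T - Suc i"]) (auto simp: Suc_diff_Suc)
  next
    fix e assume "e \<in> {{v (T - i), v (T - Suc i)} | i. i < T}"
    then obtain i where "i < T" "e = {v (T - i), v (T - Suc i)}" by auto
    then show "e \<in> E" unfolding E
      by (intro CollectI exI[of _ "T - Suc i"]) (auto simp: Suc_diff_Suc)
  qed
  ultimately show "path_param T (\<lambda>i. v (T - i)) E" by (simp add: path_param_def)
  show "(\<lambda>i. v (T - i)) ` {..T} = v ` {..T}"
  proof (intro equalityI subsetI)
    fix y assume "y \<in> v ` {..T}"
    then obtain i where "i \<le> T" "y = v i" by auto
    then show "y \<in> (\<lambda>i. v (T - i)) ` {..T}" by (intro image_eqI[of _ _ "T - i"]) auto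
  qed auto
qed

text \<open>The parametrisation is reversed if necessary. Later arguments thus only treat a walk
  that crosses an edge of \<open>E\<close> in the direction of increasing index.\<close>

lemma path_param_orient:
  assumes "path_param T v E" "{x, y} \<in> E"
  obtains v' i where "path_param T v' E" "v' ` {..T} = v ` {..T}" "i < T" "x = v' i" "y = v' (Suc i)"
proof -
  from assms obtain i where i: "i < T" "{x, y} = {v i, v (Suc i)}"
    by (auto simp: path_param_def)
  then consider "x = v i" "y = v (Suc i)" | "x = v (Suc i)" "y = v i"
    by (auto simp: doubleton_eq_iff)
  then show thesis
  proof cases
    case 1
    with assms(1) i that[of v i] show thesis by auto
  next
    case 2
    with i that[of "\<lambda>i. v (T - i)" "T - Suc i"] path_param_reverse[OF assms(1)] show thesis
      by (auto simp: Suc_diff_Suc)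
  qed
qed

lemma path_param_neighbours:
  assumes "path_param T v E" "i \<le> T" "{v i, y} \<in> E"
  shows "i < T \<and> y = v (Suc i) \<or> 0 < i \<and> y = v (i - 1)"
proof -
  from assms obtain j where j: "j < T" "{v i, y} = {v j, v (Suc j)}"
    by (auto simp: path_param_def)
  have inj: "inj_on v {..T}" using assms by (simp add: path_param_def)
  from j(2) consider "v i = v j" "y = v (Suc j)" | "v i = v (Suc j)" "y = v j"
    by (auto simp: doubleton_eq_iff)
  then show ?thesis
  proof cases
    case 1
    then have "i = j" using inj_onD[OF inj, of i j] j assms(2) by auto
    with 1 j show ?thesis by auto
  next
    case 2
    then have "i = Suc j" using inj_onD[OF inj, of i "Suc j"] j assms(2) by auto
    with 2 j show ?thesis by auto
  qed
qed

text \<open>Either signed step along axis \<open>i\<close> has probability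
  \<open>p i / (2 * sum p J)\<close>. By \<open>mass_ge\<close> this is at most \<open>p i\<close>,
  so dividing it by the parameter of the crossed edge gives at most 1.\<close>

locale step_law =
  fixes p :: "nat \<Rightarrow> real" and J :: "nat set" and \<eta> :: real
  assumes finite_J: "finite J" and p_pos: "\<And>i. i \<in> J \<Longrightarrow> 0 < p i"
    and mass_ge: "1 \<le> 2 * sum p J" and le_eta: "\<And>i. i \<in> J \<Longrightarrow> p i / (2 * sum p J) \<le> \<eta>"
begin

definition steps :: "step set" where "steps = J \<times> {1, -1}"

definition \<pi> :: "step \<Rightarrow> real" where "\<pi> s = p (fst s) / (2 * sum p J)"

text \<open>The Markov operator of the walk: \<open>(avg ^^ t) f x\<close> is the expectation of
  \<open>f\<close> after \<open>t\<close> free steps from \<open>x\<close>.\<close>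

definition avg :: "(pos \<Rightarrow> real) \<Rightarrow> pos \<Rightarrow> real" where
  "avg f x = (\<Sum>s\<in>steps. \<pi> s * f (move x s))"

lemma finite_steps: "finite steps"
  by (simp add: steps_def finite_J)

lemma snd_step: "s \<in> steps \<Longrightarrow> snd s = 1 \<or> snd s = -1"
  by (auto simp: steps_def)

lemma snd_step_neq: "s \<in> steps \<Longrightarrow> snd s \<noteq> 0"
  by (auto simp: steps_def)

lemma pi_pos: "s \<in> steps \<Longrightarrow> 0 < \<pi> s"
  using mass_ge by (auto simp: steps_def \<pi>_def p_pos)

lemma pi_le: "s \<in> steps \<Longrightarrow> \<pi> s \<le> \<eta>"
  by (auto simp: steps_def \<pi>_def le_eta)

lemma sum_pi: "(\<Sum>s\<in>steps. \<pi> s) = 1"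
proof -
  have "(\<Sum>s\<in>steps. \<pi> s) = (\<Sum>i\<in>J. \<Sum>\<sigma>\<in>{1, -1::int}. p i / (2 * sum p J))"
    unfolding steps_def \<pi>_def sum.cartesian_product' by simp
  also have "\<dots> = (\<Sum>i\<in>J. p i / sum p J)" by (simp add: field_simps)
  also have "\<dots> = 1" using mass_ge by (simp add: sum_divide_distrib[symmetric])
  finally show ?thesis .
qed

lemma eta_pos: "0 < \<eta>"
proof -
  have "steps \<noteq> {}" using sum_pi by auto
  then obtain s where "s \<in> steps" by auto
  then show ?thesis using pi_pos[of s] pi_le[of s] by simp
qed

lemma avg_mono: "(\<And>y. f y \<le> g y) \<Longrightarrow> avg f x \<le> avg g x"
  unfolding avg_def by (intro sum_mono mult_left_mono) (auto simp: pi_pos less_imp_le)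

lemma avg_const: "avg (\<lambda>_. c) x = c"
  by (simp add: avg_def sum_distrib_right[symmetric] sum_pi)

lemma avg_add: "avg (\<lambda>y. f y + g y) x = avg f x + avg g x"
  by (simp add: avg_def distrib_left sum.distrib)

lemma avg_cmult: "avg (\<lambda>y. c * f y) x = c * avg f x"
  by (simp add: avg_def sum_distrib_left mult_ac)

lemma avg_sum: "avg (\<lambda>y. \<Sum>i\<in>I. f i y) x = (\<Sum>i\<in>I. avg (f i) x)"
  unfolding avg_def sum_distrib_left by (rule sum.swap)

lemma avgn_mono: "(\<And>y. f y \<le> g y) \<Longrightarrow> (avg ^^ t) f x \<le> (avg ^^ t) g x"
  by (induction t arbitrary: x) (auto intro: avg_mono)

lemma avgn_const: "(avg ^^ t) (\<lambda>_. c) x = c"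
  by (induction t arbitrary: x) (simp_all add: avg_const avg_def sum_distrib_right[symmetric] sum_pi)

lemma avgn_nonneg: "(\<And>y. 0 \<le> f y) \<Longrightarrow> 0 \<le> (avg ^^ t) f x"
  using avgn_mono[of "\<lambda>_. 0" f t x] by (simp add: avgn_const)

lemma avgn_le_const: "(\<And>y. f y \<le> c) \<Longrightarrow> (avg ^^ t) f x \<le> c"
  using avgn_mono[of f "\<lambda>_. c" t x] by (simp add: avgn_const)

lemma avgn_add: "(avg ^^ t) (\<lambda>y. f y + g y) x = (avg ^^ t) f x + (avg ^^ t) g x"
proof (induction t arbitrary: x)
  case (Suc t)
  then have "(avg ^^ t) (\<lambda>y. f y + g y) = (\<lambda>x. (avg ^^ t) f x + (avg ^^ t) g x)" by auto
  then show ?case by (simp add: avg_add)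
qed simp

lemma avgn_cmult: "(avg ^^ t) (\<lambda>y. c * f y) x = c * (avg ^^ t) f x"
proof (induction t arbitrary: x)
  case (Suc t)
  then have "(avg ^^ t) (\<lambda>y. c * f y) = (\<lambda>x. c * (avg ^^ t) f x)" by auto
  then show ?case by (simp add: avg_cmult)
qed simp

lemma avgn_sum: "finite I \<Longrightarrow> (avg ^^ t) (\<lambda>y. \<Sum>i\<in>I. f i y) x = (\<Sum>i\<in>I. (avg ^^ t) (f i) x)"
  by (induction I rule: finite_induct) (simp_all add: avgn_const avgn_add)

lemma avg_point_mass: "avg (point_mass y) x \<le> \<eta>"
proof (cases "\<exists>s\<in>steps. move x s = y")
  case True
  then obtain s where s: "s \<in> steps" "move x s = y" by (rule bexE)
  have 1: "move x t \<noteq> y" if "t \<in> steps" "t \<noteq> s" for t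
    using move_inj[OF snd_step_neq[OF that(1)], of x s] that(2) s(2) by metis
  have 2: "\<pi> t * point_mass y (move x t) = (if t = s then \<pi> s else 0)" if "t \<in> steps" for t
  proof (cases "t = s")
    case True
    have "point_mass y (move x s) = 1" unfolding point_mass_def s(2) by simp
    then show ?thesis using True by simp
  next
    case False
    have "point_mass y (move x t) = 0" using 1[OF that False] unfolding point_mass_def by simp
    then show ?thesis using False by simp
  qed
  have 3: "avg (point_mass y) x = (\<Sum>t\<in>steps. if t = s then \<pi> s else 0)"
    unfolding avg_def by (rule sum.cong[OF refl 2])
  show ?thesis unfolding 3 using s finite_steps by (simp add: pi_le)
next
  case False
  have 4: "avg (point_mass y) x = 0" 
    unfolding avg_def by (rule sum.neutral) (use False in \<open>simp add: point_mass_def\<close>)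
  then show ?thesis using eta_pos by simp
qed

text \<open>Two unit steps on one axis must have the same sign, since otherwise they cancel; on
  different axes neither undoes the other. Either way the first step already points towards
  \<open>y\<close>.\<close>

lemma first_step_determined:
  assumes "s \<in> steps" "t \<in> steps" "move (move x s) t = y" "x \<noteq> y"
  shows "y (fst s) \<noteq> x (fst s) \<and> snd s = sgn (y (fst s) - x (fst s))"
proof (cases "fst t = fst s")
  case True
  then have "y = x(fst s := x (fst s) + (snd s + snd t))"
    using assms(3) by (simp add: move_def algebra_simps)
  moreover have "snd s + snd t \<noteq> 0"
    using calculation assms(4) by auto
  ultimately show ?thesis
    using snd_step[OF assms(1)] snd_step[OF assms(2)] by auto
next
  case False
  then have "y (fst s) = x (fst s) + snd s" using assms(3) by (auto simp: move_def)
  then show ?thesis using snd_step[OF assms(1)] by auto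
qed

text \<open>Two steps change at most two coordinates, and in each of them the sign of a first step
  is prescribed. So at most two first steps are possible, and \<open>avg_point_mass\<close> bounds
  the second.\<close>

lemma avg2_point_mass:
  assumes "x \<noteq> y"
  shows "avg (avg (point_mass y)) x \<le> 2 * \<eta>\<^sup>2"
proof -
  define S where "S = {s \<in> steps. \<exists>t\<in>steps. move (move x s) t = y}"
  have card: "card S \<le> 2"
  proof (cases "S = {}")
    case False
    then obtain s t where st: "s \<in> steps" "t \<in> steps" "move (move x s) t = y"
      unfolding S_def by blast
    have "S \<subseteq> (\<lambda>i. (i, sgn (y i - x i))) ` {fst s, fst t}"
    proof
      fix r assume r: "r \<in> S"
      then have r': "y (fst r) \<noteq> x (fst r)" "snd r = sgn (y (fst r) - x (fst r))"
        using first_step_determined[of r _ x y] assms unfolding S_def by blast+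
      have "fst r \<in> {fst s, fst t}"
        using r'(1) st(3) by (auto simp: move_def split: if_splits)
      then show "r \<in> (\<lambda>i. (i, sgn (y i - x i))) ` {fst s, fst t}"
        using r'(2) by (intro image_eqI[of _ _ "fst r"]) (auto simp: prod_eq_iff)
    qed
    then have "card S \<le> card ((\<lambda>i. (i, sgn (y i - x i))) ` {fst s, fst t})"
      by (intro card_mono) auto
    also have "\<dots> \<le> card {fst s, fst t}" by (rule card_image_le) simp
    also have "\<dots> \<le> 2" by (simp add: card_insert_if)
    finally show ?thesis .
  next
    case True
    then show ?thesis by (metis card.empty zero_le)
  qed
  have "avg (avg (point_mass y)) x = (\<Sum>s\<in>S. \<pi> s * avg (point_mass y) (move x s))"
    unfolding avg_def[of "avg (point_mass y)"]
  proof (rule sum.mono_neutral_right[OF finite_steps])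
    show "\<forall>i\<in>steps - S. \<pi> i * avg (point_mass y) (move x i) = 0"
    proof
      fix s assume s: "s \<in> steps - S"
      have "avg (point_mass y) (move x s) = 0"
        unfolding avg_def using s by (intro sum.neutral) (auto simp: point_mass_def S_def)
      then show "\<pi> s * avg (point_mass y) (move x s) = 0" by simp
    qed
  qed (simp add: S_def)
  also have "\<dots> \<le> (\<Sum>s\<in>S. \<eta> * \<eta>)"
  proof (intro sum_mono mult_mono)
    fix s assume s: "s \<in> S"
    show "\<pi> s \<le> \<eta>" using s pi_le unfolding S_def by blast
    show "avg (point_mass y) (move x s) \<le> \<eta>" by (rule avg_point_mass)
    show "0 \<le> \<eta>" using eta_pos by simp
    show "0 \<le> avg (point_mass y) (move x s)"
      using avgn_nonneg[of "point_mass y" 1] by (simp add: point_mass_def)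
  qed
  also have "\<dots> = real (card S) * (\<eta> * \<eta>)" by (rule sum_constant)
  also have "\<dots> \<le> 2 * (\<eta> * \<eta>)"
  proof (rule mult_right_mono)
    show "real (card S) \<le> 2" using card by simp
  qed simp
  finally show ?thesis by (simp only: power2_eq_square)
qed

lemma avg3_point_mass: "avg (avg (avg (point_mass y))) x \<le> 3 * \<eta>\<^sup>2"
proof -
  have "avg (avg (point_mass y)) z \<le> 2 * \<eta>\<^sup>2 + \<eta> * point_mass y z" for z
  proof (cases "z = y")
    case True
    have "avg (avg (point_mass y)) z \<le> \<eta>"
      using avgn_le_const[of "avg (point_mass y)" \<eta> 1 z] by (simp add: avg_point_mass)
    then have "avg (avg (point_mass y)) z \<le> 2 * \<eta>\<^sup>2 + \<eta>"
      using zero_le_power2[of \<eta>] by linarith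
    then show ?thesis using True by (simp add: point_mass_def)
  qed (use avg2_point_mass[of z y] in \<open>simp add: point_mass_def\<close>)
  then have "avg (avg (avg (point_mass y))) x \<le> avg (\<lambda>z. 2 * \<eta>\<^sup>2 + \<eta> * point_mass y z) x"
    by (rule avg_mono)
  also have "\<dots> = 2 * \<eta>\<^sup>2 + \<eta> * avg (point_mass y) x"
    by (simp add: avg_add avg_const avg_cmult)
  also have "\<eta> * avg (point_mass y) x \<le> \<eta> * \<eta>"
    using eta_pos by (intro mult_left_mono avg_point_mass) auto
  finally show ?thesis by (simp add: power2_eq_square)
qed

lemma avgn_point_mass_eta:
  assumes "1 \<le> t"
  shows "(avg ^^ t) (point_mass y) x \<le> \<eta>"
proof -
  have "t = (t - 1) + 1" using assms by simp
  then have "(avg ^^ t) (point_mass y) x = (avg ^^ (t - 1)) ((avg ^^ 1) (point_mass y)) x"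
    by (metis funpow_add comp_apply)
  then show ?thesis
    using avgn_le_const[of "(avg ^^ 1) (point_mass y)" \<eta> "t - 1" x] avg_point_mass by simp
qed

lemma avgn_point_mass_eta_sq:
  assumes "3 \<le> t"
  shows "(avg ^^ t) (point_mass y) x \<le> 3 * \<eta>\<^sup>2"
proof -
  have "t = (t - 3) + 3" using assms by simp
  then have "(avg ^^ t) (point_mass y) x = (avg ^^ (t - 3)) ((avg ^^ 3) (point_mass y)) x"
    by (metis funpow_add comp_apply)
  moreover have "(avg ^^ 3) (point_mass y) = avg (avg (avg (point_mass y)))"
    by (simp add: eval_nat_numeral)
  ultimately show ?thesis
    using avgn_le_const[of "(avg ^^ 3) (point_mass y)" "3 * \<eta>\<^sup>2" "t - 3" x] avg3_point_mass
    by simp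
qed

lemma sum_avgn_point_mass: "(\<Sum>t = 1..n. (avg ^^ t) (point_mass y) x) \<le> 2 * \<eta> + 3 * n * \<eta>\<^sup>2"
proof -
  have "(\<Sum>t = 1..n. (avg ^^ t) (point_mass y) x) \<le> (\<Sum>t = 1..n. (if t \<le> 2 then \<eta> else 0) + 3 * \<eta>\<^sup>2)"
  proof (rule sum_mono)
    fix t assume "t \<in> {1..n}"
    then show "(avg ^^ t) (point_mass y) x \<le> (if t \<le> 2 then \<eta> else 0) + 3 * \<eta>\<^sup>2"
      using avgn_point_mass_eta[of t y x] avgn_point_mass_eta_sq[of t y x] eta_pos
      by (cases "t \<le> 2") (auto intro: order_trans)
  qed
  also have "\<dots> = card {t \<in> {1..n}. t \<le> 2} * \<eta> + 3 * n * \<eta>\<^sup>2"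
    by (simp add: sum.distrib sum.If_cases Int_def)
  also have "\<dots> \<le> 2 * \<eta> + 3 * n * \<eta>\<^sup>2"
  proof -
    have "card {t \<in> {1..n}. t \<le> 2} \<le> card {1..2::nat}"
      by (intro card_mono) auto
    then show ?thesis using eta_pos by (auto intro!: mult_right_mono)
  qed
  finally show ?thesis by simp
qed

end

section \<open>Sums over self-avoiding words\<close>

context step_law begin

text \<open>Weighted count of the walks from \<open>x\<close> that avoid \<open>V\<close> and themselves. Edges of \<open>E\<close> (those of the
  fixed path) get weight \<open>1\<close>, an upper bound for the step probability divided by the edge parameter;
  the first argument of \<open>F\<close> is the number of unused steps.\<close>

primrec wsum :: "pos set set \<Rightarrow> (nat \<Rightarrow> pos \<Rightarrow> real) \<Rightarrow> nat \<Rightarrow> pos set \<Rightarrow> pos \<Rightarrow> real" where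
  "wsum E F 0 V x = F 0 x"
| "wsum E F (Suc N) V x = F (Suc N) x + (\<Sum>s\<in>steps. if move x s \<in> insert x V then 0
     else (if {x, move x s} \<in> E then 1 else \<pi> s) * wsum E F N (insert x V) (move x s))"

lemma wsum_nonneg: "(\<And>r y. 0 \<le> F r y) \<Longrightarrow> 0 \<le> wsum E F N V x"
  by (induction N arbitrary: V x) (auto intro!: add_nonneg_nonneg sum_nonneg mult_nonneg_nonneg less_imp_le[OF pi_pos])

text \<open>Forgetting self-avoidance turns the sum into expectations of the free walk, which has
  \<open>N - t\<close> steps left at time \<open>t\<close>.\<close>

lemma wsum_empty_le_budget:
  assumes "\<And>r y. 0 \<le> F r y"
  shows "wsum {} F N V x \<le> (\<Sum>t\<le>N. (avg ^^ t) (F (N - t)) x)"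
proof (induction N arbitrary: V x)
  case (Suc N)
  let ?B = "\<lambda>y. \<Sum>t\<le>N. (avg ^^ t) (F (N - t)) y"
  have "wsum {} F (Suc N) V x \<le> F (Suc N) x + (\<Sum>s\<in>steps. \<pi> s * ?B (move x s))"
    unfolding wsum.simps
  proof (intro add_left_mono sum_mono)
    fix s assume s: "s \<in> steps"
    have "0 \<le> ?B (move x s)"
      by (rule order_trans[OF wsum_nonneg[of F "{}" N V "move x s", OF assms(1)] Suc.IH])
    then have "0 \<le> \<pi> s * ?B (move x s)" using pi_pos[OF s] by simp
    moreover have "\<pi> s * wsum {} F N (insert x V) (move x s) \<le> \<pi> s * ?B (move x s)"
      using pi_pos[OF s] by (intro mult_left_mono Suc.IH) simp
    ultimately show "(if move x s \<in> insert x V then 0 else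
      (if {x, move x s} \<in> {} then 1 else \<pi> s) * wsum {} F N (insert x V) (move x s))
      \<le> \<pi> s * ?B (move x s)" by simp
  qed
  also have "\<dots> = F (Suc N) x + avg ?B x"
    by (simp only: avg_def)
  also have "\<dots> = (\<Sum>t\<le>Suc N. (avg ^^ t) (F (Suc N - t)) x)"
    unfolding avg_sum
    by (simp only: sum.atMost_Suc_shift funpow.simps comp_apply id_apply diff_Suc_Suc diff_zero)
  finally show ?case .
qed simp

lemma wsum_empty_le:
  assumes "\<And>r y. 0 \<le> F r y" "\<And>r y. F r y \<le> f y"
  shows "wsum {} F N V x \<le> (\<Sum>t\<le>N. (avg ^^ t) f x)"
  by (rule order_trans[OF wsum_empty_le_budget[OF assms(1)]]) (intro sum_mono avgn_mono assms(2))

lemma inj_on_move: "inj_on (move x) steps"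
  by (rule inj_onI) (metis move_inj snd_step_neq)

lemma card_path_steps:
  assumes "path_param T v E"
  shows "real (card {s \<in> steps. {x, move x s} \<in> E}) \<le> 2 * indicat_real (v ` {..T}) x"
proof (cases "x \<in> v ` {..T}")
  case True
  then obtain i where i: "i \<le> T" "x = v i" by auto
  have "card {s \<in> steps. {x, move x s} \<in> E} \<le> card {v (Suc i), v (i - 1)}"
  proof (rule card_inj_on_le)
    show "inj_on (move x) {s \<in> steps. {x, move x s} \<in> E}"
      by (rule inj_on_subset[OF inj_on_move]) blast
    show "move x ` {s \<in> steps. {x, move x s} \<in> E} \<subseteq> {v (Suc i), v (i - 1)}"
      using path_param_neighbours[OF assms i(1)] unfolding i(2) by blast
  qed simp
  also have "\<dots> \<le> 2" by (simp add: card_insert_if)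
  finally show ?thesis using True by simp
next
  case False
  have "{s \<in> steps. {x, move x s} \<in> E} = {}"
  proof (rule ccontr)
    assume "{s \<in> steps. {x, move x s} \<in> E} \<noteq> {}"
    then obtain s where s: "{x, move x s} \<in> E" by blast
    obtain v' i where "v' ` {..T} = v ` {..T}" "i < T" "x = v' i"
      by (rule path_param_orient[OF assms s]) blast
    then have "x \<in> v ` {..T}" by (metis atMost_iff imageI less_imp_le)
    then show False using False by contradiction
  qed
  then have "card {s \<in> steps. {x, move x s} \<in> E} = 0" by (simp only: card.empty)
  then show ?thesis by simp
qed

text \<open>Decomposition at the first step along an edge of \<open>E\<close>. Before it the walk
  has its ordinary weights. At that moment it stands on the path, where at most two such edges
  start; hence the factor 2. The rest is bounded by \<open>H\<close>, in which the start of the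
  crossed edge belongs to \<open>V\<close>, so that turning back is excluded.\<close>

lemma wsum_first_contact:
  assumes par: "path_param T v E" and VV: "VV = v ` {..T}"
    and F: "\<And>r y. 0 \<le> F r y" and Ab: "0 \<le> Ab"
    and H: "\<And>M v' i V. M < N \<Longrightarrow> path_param T v' E \<Longrightarrow> v' ` {..T} = VV \<Longrightarrow> i < T \<Longrightarrow> v' i \<in> V \<Longrightarrow>
      wsum E F M V (v' (Suc i)) \<le> Ab"
  shows "wsum E F N V x \<le> wsum {} F N V x + (\<Sum>t<N. (avg ^^ t) (\<lambda>y. 2 * Ab * indicat_real VV y) x)"
  using H
proof (induction N arbitrary: V x)
  case (Suc N)
  let ?g = "\<lambda>y. 2 * Ab * indicat_real VV y"
  let ?G = "\<lambda>y. \<Sum>t<N. (avg ^^ t) ?g y"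
  have IH: "wsum E F N V x \<le> wsum {} F N V x + ?G x" for V x
    by (rule Suc.IH) (use Suc.prems less_SucI in blast)
  have G: "0 \<le> ?G y" for y
    using Ab by (intro sum_nonneg avgn_nonneg) auto
  let ?S = "{s \<in> steps. {x, move x s} \<in> E}"
  have "wsum E F (Suc N) V x \<le> F (Suc N) x + (\<Sum>s\<in>steps. ((if move x s \<in> insert x V then 0
      else \<pi> s * wsum {} F N (insert x V) (move x s)) + \<pi> s * ?G (move x s))
      + (if s \<in> ?S then Ab else 0))"
    unfolding wsum.simps
  proof (intro add_left_mono sum_mono)
    fix s assume s: "s \<in> steps"
    have p0: "0 < \<pi> s" by (rule pi_pos[OF s])
    have G': "0 \<le> \<pi> s * ?G (move x s)" using p0 G[of "move x s"] by simp
    have W: "0 \<le> \<pi> s * wsum {} F N (insert x V) (move x s)"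
      using p0 wsum_nonneg[OF F] by simp
    consider "move x s \<in> insert x V" | "move x s \<notin> insert x V" "s \<in> ?S" | "move x s \<notin> insert x V" "s \<notin> ?S"
      by blast
    then show "(if move x s \<in> insert x V then 0
      else (if {x, move x s} \<in> E then 1 else \<pi> s) * wsum E F N (insert x V) (move x s))
      \<le> ((if move x s \<in> insert x V then 0
      else \<pi> s * wsum {} F N (insert x V) (move x s)) + \<pi> s * ?G (move x s))
      + (if s \<in> ?S then Ab else 0)" (is "?l \<le> ?r")
    proof cases
      case 1
      then show ?thesis using G' Ab by simp
    next
      case 2
      then have e: "{x, move x s} \<in> E" by simp
      obtain v' i where v': "path_param T v' E" "v' ` {..T} = v ` {..T}" "i < T" "x = v' i"
        "move x s = v' (Suc i)"
        by (rule path_param_orient[OF par e])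
      have "wsum E F N (insert x V) (v' (Suc i)) \<le> Ab"
        using v' VV by (intro Suc.prems) auto
      then have "?l \<le> Ab" using 2 e v'(5) by simp
      then show ?thesis using 2 G' W by simp
    next
      case 3
      then have "?l = \<pi> s * wsum E F N (insert x V) (move x s)" using s by simp
      also have "\<dots> \<le> \<pi> s * (wsum {} F N (insert x V) (move x s) + ?G (move x s))"
        using p0 by (intro mult_left_mono IH) simp
      also have "\<dots> = ?r" using 3 by (auto simp: distrib_left)
      finally show ?thesis .
    qed
  qed
  also have "\<dots> = wsum {} F (Suc N) V x + avg ?G x + (\<Sum>s\<in>steps. if s \<in> ?S then Ab else 0)"
    unfolding wsum.simps empty_iff if_False sum.distrib avg_def by simp
  also have "(\<Sum>s\<in>steps. if s \<in> ?S then Ab else 0) = card ?S * Ab"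
  proof -
    have "(\<Sum>s\<in>steps. if s \<in> ?S then Ab else 0) = (\<Sum>s\<in>steps \<inter> ?S. Ab)"
      by (rule sum.inter_restrict[symmetric, OF finite_steps])
    also have "steps \<inter> ?S = ?S" by blast
    finally show ?thesis by (simp only: sum_constant)
  qed
  also have "\<dots> \<le> (2 * indicat_real VV x) * Ab"
    unfolding VV by (intro mult_right_mono card_path_steps par Ab)
  also have "\<dots> = ?g x" by simp
  also have "avg ?G x = (\<Sum>t<N. (avg ^^ Suc t) ?g x)"
    unfolding avg_sum by simp
  finally have "wsum E F (Suc N) V x \<le> wsum {} F (Suc N) V x + (\<Sum>t<N. (avg ^^ Suc t) ?g x) + ?g x"
    by (simp del: wsum.simps funpow.simps)
  moreover have "(\<Sum>t<Suc N. (avg ^^ t) ?g x) = ?g x + (\<Sum>t<N. (avg ^^ Suc t) ?g x)"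
    by (simp only: sum.lessThan_Suc_shift funpow.simps id_apply)
  ultimately show ?case by linarith
qed simp

end

section \<open>Walks of length of order \<open>L\<close> rarely hit a given point or path\<close>

locale short_walks = step_law +
  fixes L :: nat
  assumes L: "1 \<le> L" and L_eta: "10000 * (real L)\<^sup>2 * \<eta> \<le> 1"
begin

lemma L_le_square: "real L \<le> (real L)\<^sup>2"
  using L by (simp add: power2_eq_square)

lemma L_eta': "10000 * real L * \<eta> \<le> 1" "10000 * \<eta> \<le> 1"
proof -
  have "real L * \<eta> \<le> (real L)\<^sup>2 * \<eta>" using L_le_square eta_pos by (intro mult_right_mono) auto
  then show *: "10000 * real L * \<eta> \<le> 1" using L_eta by linarith
  have "1 * \<eta> \<le> real L * \<eta>" using L eta_pos by (intro mult_right_mono) auto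
  then show "10000 * \<eta> \<le> 1" using * by linarith
qed

text \<open>Times 1 and 2 give \<open>2 * \<eta>\<close>. All later times together give at most one
  more \<open>\<eta>\<close>, since \<open>L * \<eta>\<close> is small, and the bound loses its
  dependence on \<open>m\<close>.\<close>

lemma sum_avgn_point_mass_le:
  assumes "m \<le> L + 2"
  shows "(\<Sum>t = 1..m. (avg ^^ t) (point_mass y) x) \<le> 3 * \<eta>"
proof -
  have "3 * real m * \<eta>\<^sup>2 \<le> 3 * (3 * real L) * \<eta>\<^sup>2"
    using assms L by (intro mult_right_mono mult_left_mono) auto
  also have "\<dots> = (9 * real L * \<eta>) * \<eta>" by (simp add: power2_eq_square)
  also have "\<dots> \<le> 1 * \<eta>"
    using L_eta'(1) eta_pos by (intro mult_right_mono) auto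
  finally show ?thesis using sum_avgn_point_mass[of y x m] by simp
qed

lemma sum_avgn_le:
  assumes "m \<le> L + 2" "0 \<le> \<alpha>" "\<And>y. f y \<le> \<alpha> * point_mass y0 y + \<beta>"
  shows "(\<Sum>t = 1..m. (avg ^^ t) f x) \<le> \<alpha> * (3 * \<eta>) + real m * \<beta>"
proof -
  have "(\<Sum>t = 1..m. (avg ^^ t) f x) \<le> (\<Sum>t = 1..m. \<alpha> * (avg ^^ t) (point_mass y0) x + \<beta>)"
  proof (rule sum_mono)
    fix t
    have "(avg ^^ t) f x \<le> (avg ^^ t) (\<lambda>y. \<alpha> * point_mass y0 y + \<beta>) x"
      by (rule avgn_mono) (rule assms(3))
    also have "\<dots> = \<alpha> * (avg ^^ t) (point_mass y0) x + \<beta>"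
      by (simp add: avgn_add avgn_cmult avgn_const)
    finally show "(avg ^^ t) f x \<le> \<alpha> * (avg ^^ t) (point_mass y0) x + \<beta>" .
  qed
  also have "\<dots> = \<alpha> * (\<Sum>t = 1..m. (avg ^^ t) (point_mass y0) x) + real m * \<beta>"
    by (simp add: sum.distrib sum_distrib_left)
  also have "\<dots> \<le> \<alpha> * (3 * \<eta>) + real m * \<beta>"
    using assms(2) by (intro add_right_mono mult_left_mono sum_avgn_point_mass_le assms(1))
  finally show ?thesis .
qed

lemma indicator_eq_sum_point_mass: "finite A \<Longrightarrow> indicat_real A y = (\<Sum>a\<in>A. point_mass a y)"
  by (simp add: point_mass_def indicator_def)

lemma avgn_indicator: "finite A \<Longrightarrow> (avg ^^ t) (indicat_real A) x = (\<Sum>a\<in>A. (avg ^^ t) (point_mass a) x)"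
proof -
  assume A: "finite A"
  then have "indicat_real A = (\<lambda>y. \<Sum>a\<in>A. point_mass a y)"
    by (intro ext indicator_eq_sum_point_mass)
  then show ?thesis using avgn_sum[OF A, of t point_mass x] by simp
qed

lemma sum_avgn_indicator_le:
  assumes "m \<le> L + 2" "finite A" "card A \<le> L + 3"
  shows "(\<Sum>t = 1..m. (avg ^^ t) (indicat_real A) x) \<le> (real L + 3) * (3 * \<eta>)"
proof -
  have "(\<Sum>t = 1..m. (avg ^^ t) (indicat_real A) x)
      = (\<Sum>a\<in>A. \<Sum>t = 1..m. (avg ^^ t) (point_mass a) x)"
    unfolding avgn_indicator[OF assms(2)] by (rule sum.swap)
  also have "\<dots> \<le> (\<Sum>a\<in>A. 3 * \<eta>)"
    by (intro sum_mono sum_avgn_point_mass_le assms(1))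
  also have "\<dots> = real (card A) * (3 * \<eta>)" by simp
  also have "\<dots> \<le> (real L + 3) * (3 * \<eta>)"
    using assms(3) eta_pos by (intro mult_right_mono) auto
  finally show ?thesis .
qed

text \<open>A walk that has arrived on the fixed path through one of its edges cannot turn back, so it either
  runs on in the same direction, passing \<open>y0\<close> at most once, or leaves and has to hit the path again.
  This is why \<open>\<alpha>\<close> is not multiplied by a power of \<open>L\<close>.\<close>

lemma wsum_run_bound:
  fixes \<alpha> \<beta> :: real
  assumes T: "T \<le> L + 2"
    and F: "\<And>r y. 0 \<le> F r y" "\<And>r y. F r y \<le> \<alpha> * point_mass y0 y + \<beta>"
    and \<alpha>: "0 \<le> \<alpha>" and \<beta>: "0 \<le> \<beta>"
    and N: "N \<le> L + 2" and v: "path_param T v E" "i < T" "v i \<in> V"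
  shows "wsum E F N V (v (Suc i)) \<le> 4 * \<alpha> + 2 * (real L + 3)\<^sup>2 * \<beta>"
proof -
  define K where "K = real L + 3"
  \<comment> \<open>Chosen to satisfy the self-consistent inequality
    \<open>\<alpha> + K * c \<le> Ab\<close> proved as \<open>total\<close>: in \<open>K * c\<close>
    the coefficient of \<open>Ab\<close> is \<open>2 * K\<^sup>2 * R\<close>, at most 1/2.\<close>
  define Ab where "Ab = 4 * \<alpha> + 2 * K\<^sup>2 * \<beta>"
  define R where "R = 3 * \<eta>"
  \<comment> \<open>The cost charged to each point of a run for leaving it there: later passages
    through \<open>y0\<close>, all the \<open>\<beta>\<close> collected on the way, and renewed
    contacts, where the path has at most \<open>K\<close> points and each is visited at most
    \<open>R\<close> times on average.\<close>
  define c where "c = \<alpha> * R + K * \<beta> + 2 * Ab * (K * R)"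
  define VV where "VV = v ` {..T}"
  have K: "3 \<le> K" by (simp add: K_def)
  have R: "0 \<le> R" using eta_pos by (simp add: R_def)
  have Ab: "0 \<le> Ab" using \<alpha> \<beta> by (simp add: Ab_def)
  have c: "0 \<le> c" using \<alpha> \<beta> Ab K R by (simp add: c_def)
  have \<beta>_le_c: "\<beta> \<le> c"
  proof -
    have "1 * \<beta> \<le> K * \<beta>" using K \<beta> by (intro mult_right_mono) auto
    moreover have "0 \<le> \<alpha> * R" "0 \<le> 2 * Ab * (K * R)" using \<alpha> R Ab K by auto
    ultimately show ?thesis by (simp add: c_def)
  qed
  have KR: "4 * K\<^sup>2 * R \<le> 1"
  proof -
    have "K\<^sup>2 \<le> (4 * real L)\<^sup>2" using L by (intro power_mono) (auto simp: K_def)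
    then have "K\<^sup>2 * R \<le> (4 * real L)\<^sup>2 * R" using R by (rule mult_right_mono)
    then have "4 * K\<^sup>2 * R \<le> 192 * ((real L)\<^sup>2 * \<eta>)" by (simp add: R_def power_mult_distrib)
    then show ?thesis using L_eta by linarith
  qed
  have total: "\<alpha> + K * c \<le> Ab"
  proof -
    have "K * R \<le> K\<^sup>2 * R" using K R by (intro mult_right_mono) (auto simp: power2_eq_square)
    then have KR1: "K * R \<le> 1" using KR mult_nonneg_nonneg[of "K\<^sup>2" R] R by simp
    have "K * c = \<alpha> * (K * R) + K\<^sup>2 * \<beta> + Ab * (2 * K\<^sup>2 * R)"
      by (simp add: c_def power2_eq_square algebra_simps)
    also have "\<dots> \<le> \<alpha> * 1 + K\<^sup>2 * \<beta> + Ab * (1 / 2)"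
      using \<alpha> Ab KR KR1 by (intro add_mono mult_left_mono) auto
    finally show ?thesis by (simp add: Ab_def field_simps)
  qed
  have cardVV: "finite VV" "card VV \<le> L + 3"
    using card_image_le[of "{..T}" v] T by (auto simp: VV_def)
  \<comment> \<open>The indicator tells whether \<open>y0\<close> still lies ahead; passing
    \<open>y0\<close> consumes it, while \<open>c\<close> is charged at every step. Strong induction
    with arbitrary \<open>v\<close> is required because a renewed contact begins another run with a
    smaller budget, possibly in the opposite direction.\<close>
  have run: "wsum E F N V (v (Suc i)) \<le> \<alpha> * indicat_real (v ` {Suc i..T}) y0 + \<beta> + real N * c"
    if "path_param T v E" "v ` {..T} = VV" "i < T" "v i \<in> V" "N \<le> L + 2" for N V v i
    using that
  proof (induction N arbitrary: V v i rule: less_induct)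
    case (less N)
    let ?x = "v (Suc i)"
    have inj: "inj_on v {..T}" using less.prems by (simp add: path_param_def)
    have ge: "\<alpha> * point_mass y0 ?x \<le> \<alpha> * indicat_real (v ` {Suc i..T}) y0"
      using \<alpha> less.prems(3) by (intro mult_left_mono) (auto simp: point_mass_def indicator_def)
    show ?case
    proof (cases N)
      case 0
      then show ?thesis using F(2)[of 0 ?x] ge by simp
    next
      case (Suc n)
      let ?f = "\<lambda>y. \<alpha> * point_mass y0 y + \<beta>" and ?g = "\<lambda>y. 2 * Ab * indicat_real VV y"
      let ?B = "\<lambda>y. (\<Sum>t\<le>n. (avg ^^ t) ?f y) + (\<Sum>t<n. (avg ^^ t) ?g y)"
      have f0: "0 \<le> ?f y" for y using \<alpha> \<beta> by (simp add: point_mass_def)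
      have B: "0 \<le> ?B y" for y
        by (rule add_nonneg_nonneg; rule sum_nonneg; rule avgn_nonneg) (use f0 Ab in auto)
      have contact: "wsum E F n V y \<le> ?B y" for V y
      proof -
        have "wsum E F n V y \<le> wsum {} F n V y + (\<Sum>t<n. (avg ^^ t) ?g y)"
        proof (rule wsum_first_contact[OF less.prems(1) less.prems(2)[symmetric] F(1) Ab])
          fix M v' i V assume *: "M < n" "path_param T v' E" "v' ` {..T} = VV" "i < T" "v' i \<in> V"
          have "wsum E F M V (v' (Suc i)) \<le> \<alpha> * indicat_real (v' ` {Suc i..T}) y0 + \<beta> + real M * c"
            using * Suc less.prems(5) by (intro less.IH) auto
          also have "\<dots> \<le> \<alpha> * 1 + c + real M * c"
          proof (intro add_mono mult_left_mono \<alpha>)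
            show "\<beta> \<le> c" by (rule \<beta>_le_c)
          qed (auto simp: indicator_def)
          also have "\<dots> = \<alpha> + (real M + 1) * c" by (simp add: algebra_simps)
          also have "\<dots> \<le> \<alpha> + K * c"
            using * Suc less.prems(5) c by (intro add_left_mono mult_right_mono) (auto simp: K_def)
          finally show "wsum E F M V (v' (Suc i)) \<le> Ab" using total by simp
        qed
        also have "wsum {} F n V y \<le> (\<Sum>t\<le>n. (avg ^^ t) ?f y)"
          by (rule wsum_empty_le[OF F])
        finally show ?thesis by simp
      qed
      define a where "a = \<alpha> * indicat_real (v ` {Suc (Suc i)..T}) y0 + \<beta> + real n * c"
      \<comment> \<open>At the last point of the path the run has no continuation.\<close>
      define a' where "a' = (if Suc i < T then a else 0)"
      have a: "0 \<le> a" using \<alpha> \<beta> c by (simp add: a_def)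
      then have a': "0 \<le> a'" by (simp add: a'_def)
      let ?S = "{s \<in> steps. move ?x s = v (Suc (Suc i))}"
      have cardS: "card ?S \<le> 1"
      proof -
        have "card ?S \<le> card {v (Suc (Suc i))}"
          by (rule card_inj_on_le[of "move ?x"], rule inj_on_subset[OF inj_on_move]) auto
        then show ?thesis by simp
      qed
      have "wsum E F (Suc n) V ?x \<le> ?f ?x + (\<Sum>s\<in>steps. (if s \<in> ?S then a' else 0) + \<pi> s * ?B (move ?x s))"
        unfolding wsum.simps
      proof (intro add_mono sum_mono F(2))
        fix s assume s: "s \<in> steps"
        have p0: "0 < \<pi> s" by (rule pi_pos[OF s])
        then have pB: "0 \<le> \<pi> s * ?B (move ?x s)" using B[of "move ?x s"] by simp
        show "(if move ?x s \<in> insert ?x V then 0 else (if {?x, move ?x s} \<in> E then 1 else \<pi> s)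
            * wsum E F n (insert ?x V) (move ?x s))
          \<le> (if s \<in> ?S then a' else 0) + \<pi> s * ?B (move ?x s)" (is "?l \<le> ?r")
        proof (cases "move ?x s \<in> insert ?x V")
          case True
          then show ?thesis using pB a' by simp
        next
          case new: False
          show ?thesis
          proof (cases "{?x, move ?x s} \<in> E")
            case True
            have "Suc i < T \<and> move ?x s = v (Suc (Suc i)) \<or> 0 < Suc i \<and> move ?x s = v (Suc i - 1)"
              by (rule path_param_neighbours[OF less.prems(1) _ True]) (use less.prems(3) in simp)
            \<comment> \<open>The other neighbour on the path is \<open>v i\<close>, which lies in
              \<open>V\<close>.\<close>
            then have nxt: "Suc i < T" "move ?x s = v (Suc (Suc i))"
              using new less.prems(4) by auto
            have "wsum E F n (insert ?x V) (v (Suc (Suc i))) \<le> a"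
              unfolding a_def using nxt(1) Suc less.prems by (intro less.IH) auto
            then have "?l \<le> a" using new True nxt(2) by simp
            also have "a = a'" using nxt(1) by (simp add: a'_def)
            also have "s \<in> ?S" using s nxt(2) by simp
            then have "a' \<le> ?r" using pB by simp
            finally show ?thesis .
          next
            case False
            then have "?l = \<pi> s * wsum E F n (insert ?x V) (move ?x s)" using new by simp
            also have "\<dots> \<le> \<pi> s * ?B (move ?x s)"
              using p0 by (intro mult_left_mono contact) simp
            also have "\<dots> \<le> ?r" using a' by simp
            finally show ?thesis .
          qed
        qed
      qed
      also have "\<dots> = ?f ?x + card ?S * a' + avg ?B ?x"
      proof -
        have "(\<Sum>s\<in>steps. if s \<in> ?S then a' else 0) = (\<Sum>s\<in>steps \<inter> ?S. a')"
          by (rule sum.inter_restrict[symmetric, OF finite_steps])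
        also have "steps \<inter> ?S = ?S" by blast
        finally have "(\<Sum>s\<in>steps. if s \<in> ?S then a' else 0) = card ?S * a'" by (simp only: sum_constant)
        then show ?thesis by (simp only: sum.distrib avg_def)
      qed
      also have "card ?S * a' \<le> 1 * a'" using cardS a' by (intro mult_right_mono) simp_all
      also have "avg ?B ?x = (\<Sum>t\<le>n. (avg ^^ Suc t) ?f ?x) + (\<Sum>t<n. (avg ^^ Suc t) ?g ?x)"
        unfolding avg_add avg_sum by simp
      also have "(\<Sum>t\<le>n. (avg ^^ Suc t) ?f ?x) = (\<Sum>t = 1..Suc n. (avg ^^ t) ?f ?x)"
        by (rule sum.reindex_bij_witness[of _ "\<lambda>t. t - 1" Suc]) auto
      also have "(\<Sum>t<n. (avg ^^ Suc t) ?g ?x) = (\<Sum>t = 1..n. (avg ^^ t) ?g ?x)"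
        by (rule sum.reindex_bij_witness[of _ "\<lambda>t. t - 1" Suc]) auto
      also have "(\<Sum>t = 1..Suc n. (avg ^^ t) ?f ?x) \<le> \<alpha> * R + real (Suc n) * \<beta>"
        unfolding R_def using Suc less.prems(5) \<alpha> by (intro sum_avgn_le[where ?y0.0=y0]) auto
      also have "(\<Sum>t = 1..n. (avg ^^ t) ?g ?x) \<le> 2 * Ab * (K * R)"
      proof -
        have "(\<Sum>t = 1..n. (avg ^^ t) ?g ?x) = 2 * Ab * (\<Sum>t = 1..n. (avg ^^ t) (indicat_real VV) ?x)"
          by (simp add: avgn_cmult sum_distrib_left)
        also have "\<dots> \<le> 2 * Ab * (K * R)"
          unfolding K_def R_def using Suc less.prems(5) Ab cardVV
          by (intro mult_left_mono sum_avgn_indicator_le) auto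
        finally show ?thesis .
      qed
      finally have "wsum E F (Suc n) V ?x \<le> ?f ?x + a' + (\<alpha> * R + real (Suc n) * \<beta> + 2 * Ab * (K * R))"
        by simp
      moreover have "real (Suc n) * \<beta> + \<beta> \<le> K * \<beta>"
      proof -
        have "(real (Suc n) + 1) * \<beta> \<le> K * \<beta>"
          using Suc less.prems(5) \<beta> by (intro mult_right_mono) (auto simp: K_def)
        then show ?thesis by (simp add: distrib_right)
      qed
      moreover have "\<alpha> * point_mass y0 ?x + a'
          \<le> \<alpha> * indicat_real (v ` {Suc i..T}) y0 + \<beta> + real n * c"
      proof (cases "Suc i < T")
        case True
        have "{Suc i..T} = insert (Suc i) {Suc (Suc i)..T}" using True by auto
        then have "v ` {Suc i..T} = insert ?x (v ` {Suc (Suc i)..T})" by (simp only: image_insert)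
        moreover have "?x \<notin> v ` {Suc (Suc i)..T}"
        proof
          assume "?x \<in> v ` {Suc (Suc i)..T}"
          then obtain j where j: "Suc (Suc i) \<le> j" "j \<le> T" "v (Suc i) = v j" by auto
          from inj_onD[OF inj j(3)] True j show False by simp
        qed
        ultimately have "point_mass y0 ?x + indicat_real (v ` {Suc (Suc i)..T}) y0
            \<le> indicat_real (v ` {Suc i..T}) y0"
          by (auto simp: point_mass_def indicator_def)
        then have "\<alpha> * (point_mass y0 ?x + indicat_real (v ` {Suc (Suc i)..T}) y0)
            \<le> \<alpha> * indicat_real (v ` {Suc i..T}) y0"
          using \<alpha> by (rule mult_left_mono)
        then show ?thesis using True by (simp add: a'_def a_def distrib_left)
      next
        case False
        then show ?thesis using ge \<beta> c by (simp add: a'_def add_increasing2)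
      qed
      ultimately have "wsum E F (Suc n) V ?x
          \<le> \<alpha> * indicat_real (v ` {Suc i..T}) y0 + \<beta> + real n * c + c"
        unfolding c_def by linarith
      then show ?thesis by (simp add: Suc algebra_simps)
    qed
  qed
  have "wsum E F N V (v (Suc i)) \<le> \<alpha> * indicat_real (v ` {Suc i..T}) y0 + \<beta> + real N * c"
    using v N by (intro run) (auto simp: VV_def)
  also have "\<dots> \<le> \<alpha> * 1 + c + real N * c"
  proof (intro add_mono mult_left_mono \<alpha>)
    show "\<beta> \<le> c" by (rule \<beta>_le_c)
  qed (auto simp: indicator_def)
  also have "\<dots> = \<alpha> + (real N + 1) * c" by (simp add: algebra_simps)
  also have "\<dots> \<le> \<alpha> + K * c"
    using N c by (intro add_left_mono mult_right_mono) (auto simp: K_def)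
  finally show ?thesis using total by (simp add: Ab_def K_def)
qed


end

section \<open>Words and their shared edges\<close>

primrec walk_edges :: "pos \<Rightarrow> step list \<Rightarrow> pos set set" where
  "walk_edges x [] = {}"
| "walk_edges x (s # w) = insert {x, move x s} (walk_edges (move x s) w)"

primrec avoiding :: "pos \<Rightarrow> pos set \<Rightarrow> step list \<Rightarrow> bool" where
  "avoiding x V [] \<longleftrightarrow> x \<notin> V"
| "avoiding x V (s # w) \<longleftrightarrow> x \<notin> V \<and> avoiding (move x s) (insert x V) w"

lemma finite_walk_edges: "finite (walk_edges x w)"
  by (induction w arbitrary: x) auto

lemma avoiding_not_in: "avoiding x V w \<Longrightarrow> x \<notin> V"
  by (cases w) auto

lemma avoiding_edges: "avoiding x V w \<Longrightarrow> v \<in> V \<Longrightarrow> e \<in> walk_edges x w \<Longrightarrow> v \<notin> e"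
  by (induction w arbitrary: x V) (auto dest: avoiding_not_in)

text \<open>The start of the edge is never visited again, so no edge repeats. Therefore a product
  over the set of edges of a self-avoiding word factors step by step.\<close>

lemma avoiding_edge_fresh:
  "avoiding (move x s) (insert x V) w \<Longrightarrow> {x, move x s} \<notin> walk_edges (move x s) w"
  using avoiding_edges[of "move x s" "insert x V" w x "{x, move x s}"] by auto

lemma walk_edges_append:
  "walk_edges x (w @ w') = walk_edges x w \<union> walk_edges (foldl move x w) w'"
  by (induction w arbitrary: x) auto

lemma walk_edges_conv:
  "walk_edges x w = {{foldl move x (take i w), foldl move x (take (Suc i) w)} | i. i < length w}"
proof (induction w arbitrary: x)
  case (Cons s w)
  have "{{foldl move x (take i (s # w)), foldl move x (take (Suc i) (s # w))} | i. i < length (s # w)}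
    = insert {x, move x s} {{foldl move (move x s) (take i w), foldl move (move x s) (take (Suc i) w)} | i. i < length w}"
    (is "?A = ?B")
  proof (intro equalityI subsetI)
    fix e assume "e \<in> ?A"
    then obtain i where i: "i < length (s # w)"
      "e = {foldl move x (take i (s # w)), foldl move x (take (Suc i) (s # w))}" by blast
    then show "e \<in> ?B" by (cases i) auto
  next
    fix e assume "e \<in> ?B"
    then consider "e = {x, move x s}"
      | i where "i < length w" "e = {foldl move (move x s) (take i w), foldl move (move x s) (take (Suc i) w)}"
      by blast
    then show "e \<in> ?A"
    proof cases
      case 1
      then show ?thesis by (intro CollectI exI[of _ 0]) auto
    next
      case (2 i)
      then show ?thesis by (intro CollectI exI[of _ "Suc i"]) auto
    qed
  qed
  with Cons show ?case by simp
qed simp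

lemma avoiding_inj:
  "avoiding x V w \<Longrightarrow> inj_on (\<lambda>i. foldl move x (take i w)) {..length w} \<and>
    (\<lambda>i. foldl move x (take i w)) ` {..length w} \<inter> V = {}"
proof (induction w arbitrary: x V)
  case (Cons s w)
  let ?v = "\<lambda>i. foldl move x (take i (s # w))"
  let ?u = "\<lambda>i. foldl move (move x s) (take i w)"
  from Cons have IH: "inj_on ?u {..length w}" "?u ` {..length w} \<inter> insert x V = {}"
    by auto
  have v: "?v 0 = x" "?v (Suc i) = ?u i" for i by auto
  have set: "{..length (s # w)} = insert 0 (Suc ` {..length w})"
    by (auto simp: image_iff) (metis Suc_le_mono atMost_iff not0_implies_Suc)
  have "inj_on ?v (Suc ` {..length w})"
    using IH(1) unfolding inj_on_def by auto
  moreover have "?v ` (Suc ` {..length w}) = ?u ` {..length w}"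
    by (auto simp: image_image)
  ultimately show ?case
    unfolding set using IH(2) Cons.prems by (auto simp: inj_on_insert)
qed auto

lemma avoiding_path_param:
  "avoiding x {} w \<Longrightarrow> path_param (length w) (\<lambda>i. foldl move x (take i w)) (walk_edges x w)"
  using avoiding_inj[of x "{}" w] by (auto simp: path_param_def walk_edges_conv)

text \<open>The endpoints of a lattice edge differ in exactly one coordinate, so \<open>SOME\<close> is unambiguous there.\<close>

definition edge_weight :: "(nat \<Rightarrow> real) \<Rightarrow> pos set \<Rightarrow> real" where
  "edge_weight p e = p (SOME i. \<exists>a\<in>e. \<exists>b\<in>e. a i \<noteq> b i)"

definition shared_factor :: "(nat \<Rightarrow> real) \<Rightarrow> pos set set \<Rightarrow> pos set \<Rightarrow> real" where
  "shared_factor p E e = (if e \<in> E then 1 / edge_weight p e else 1)"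

lemma edge_weight_move:
  assumes "snd s \<noteq> 0"
  shows "edge_weight p {x, move x s} = p (fst s)"
proof -
  have "(SOME i. \<exists>a\<in>{x, move x s}. \<exists>b\<in>{x, move x s}. a i \<noteq> b i) = fst s"
    using assms by (intro some_equality) (auto simp: move_def split: if_splits)
  then show ?thesis by (simp add: edge_weight_def)
qed

context step_law begin

definition words :: "nat \<Rightarrow> step list set" where
  "words n = {w. set w \<subseteq> steps \<and> length w \<le> n}"

definition word_prob :: "step list \<Rightarrow> real" where
  "word_prob w = prod_list (map \<pi> w)"

lemma word_prob_simps: "word_prob [] = 1" "word_prob (s # w) = \<pi> s * word_prob w"
  by (simp_all add: word_prob_def)

lemma finite_words: "finite (words n)"
  unfolding words_def by (rule finite_lists_length_le[OF finite_steps])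

lemma word_prob_pos: "w \<in> words n \<Longrightarrow> 0 < word_prob w"
  by (induction w arbitrary: n) (force simp: word_prob_simps words_def pi_pos)+

lemma sum_words_0: "sum g (words 0) = g []"
  by (simp add: words_def Collect_conv_if cong: conj_cong)

lemma sum_words_Suc: "sum g (words (Suc n)) = g [] + (\<Sum>s\<in>steps. \<Sum>w\<in>words n. g (s # w))"
proof -
  have eq: "words (Suc n) = insert [] ((\<lambda>(s, w). s # w) ` (steps \<times> words n))"
  proof (intro equalityI subsetI)
    fix w assume w: "w \<in> words (Suc n)"
    then show "w \<in> insert [] ((\<lambda>(s, w). s # w) ` (steps \<times> words n))"
      by (cases w) (auto simp: words_def)
  qed (auto simp: words_def)
  have "sum g ((\<lambda>(s, w). s # w) ` (steps \<times> words n)) = (\<Sum>(s, w)\<in>steps \<times> words n. g (s # w))"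
    by (subst sum.reindex) (auto simp: inj_on_def o_def split_beta)
  also have "\<dots> = (\<Sum>s\<in>steps. \<Sum>w\<in>words n. g (s # w))"
    by (rule sum.cartesian_product[symmetric])
  finally show ?thesis
    unfolding eq using finite_steps finite_words by (subst sum.insert) auto
qed

text \<open>The exact quantity that \<open>wsum\<close> dominates. Handing the remaining budget to
  \<open>F\<close> allows a condition on the length of the word to be expressed through
  \<open>F\<close>.\<close>

definition shared_sum :: "pos set set \<Rightarrow> (nat \<Rightarrow> pos \<Rightarrow> real) \<Rightarrow> nat \<Rightarrow> pos set \<Rightarrow> pos \<Rightarrow> real" where
  "shared_sum E F N V x = (\<Sum>w\<in>words N. if avoiding x V w then word_prob w *
     (\<Prod>e\<in>walk_edges x w. shared_factor p E e) * F (N - length w) (foldl move x w) else 0)"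

lemma shared_sum_0: "x \<notin> V \<Longrightarrow> shared_sum E F 0 V x = F 0 x"
  by (simp add: shared_sum_def sum_words_0 word_prob_simps)

lemma shared_sum_Suc:
  assumes "x \<notin> V"
  shows "shared_sum E F (Suc N) V x = F (Suc N) x + (\<Sum>s\<in>steps. if move x s \<in> insert x V then 0
     else \<pi> s * shared_factor p E {x, move x s} * shared_sum E F N (insert x V) (move x s))"
proof -
  have "(\<Sum>w\<in>words N. if avoiding x V (s # w) then word_prob (s # w) *
     (\<Prod>e\<in>walk_edges x (s # w). shared_factor p E e) * F (Suc N - length (s # w)) (foldl move x (s # w)) else 0)
     = (if move x s \<in> insert x V then 0
     else \<pi> s * shared_factor p E {x, move x s} * shared_sum E F N (insert x V) (move x s))" for s
  proof (cases "move x s \<in> insert x V")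
    case True
    then have "\<not> avoiding x V (s # w)" for w using avoiding_not_in[of "move x s" "insert x V" w] by auto
    then show ?thesis using True by (simp del: avoiding.simps)
  next
    case False
    have "(if avoiding x V (s # w) then word_prob (s # w) *
     (\<Prod>e\<in>walk_edges x (s # w). shared_factor p E e) * F (Suc N - length (s # w)) (foldl move x (s # w)) else 0)
     = \<pi> s * shared_factor p E {x, move x s} * (if avoiding (move x s) (insert x V) w then word_prob w *
     (\<Prod>e\<in>walk_edges (move x s) w. shared_factor p E e) * F (N - length w) (foldl move (move x s) w) else 0)" for w
    proof (cases "avoiding (move x s) (insert x V) w")
      case True
      then have "(\<Prod>e\<in>walk_edges x (s # w). shared_factor p E e)
        = shared_factor p E {x, move x s} * (\<Prod>e\<in>walk_edges (move x s) w. shared_factor p E e)"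
        using avoiding_edge_fresh[OF True] finite_walk_edges by simp
      then show ?thesis using True assms by (simp add: word_prob_simps)
    qed simp
    then show ?thesis using False by (simp only: shared_sum_def sum_distrib_left if_False)
  qed
  then show ?thesis
    using assms unfolding shared_sum_def[of E F "Suc N"] sum_words_Suc by (simp add: word_prob_simps)
qed

text \<open>On a shared edge the parameter cancels and \<open>1 / (2 * sum p J)\<close> remains.
  Here the threshold 1/2 makes following the fixed path free of charge.\<close>

lemma shared_factor_step:
  assumes "s \<in> steps"
  shows "0 < \<pi> s * shared_factor p E {x, move x s}"
    "\<pi> s * shared_factor p E {x, move x s} \<le> (if {x, move x s} \<in> E then 1 else \<pi> s)"
proof -
  have ew: "edge_weight p {x, move x s} = p (fst s)"
    by (rule edge_weight_move[OF snd_step_neq[OF assms]])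
  have ps: "0 < p (fst s)" using assms by (auto simp: steps_def p_pos)
  show "0 < \<pi> s * shared_factor p E {x, move x s}"
    using pi_pos[OF assms] ps by (simp add: shared_factor_def ew)
  have "p (fst s) / (2 * sum p J) * (1 / p (fst s)) = 1 / (2 * sum p J)"
    using ps by simp
  also have "\<dots> \<le> 1" using mass_ge by simp
  finally have le: "p (fst s) / (2 * sum p J) * (1 / p (fst s)) \<le> 1" .
  show "\<pi> s * shared_factor p E {x, move x s} \<le> (if {x, move x s} \<in> E then 1 else \<pi> s)"
  proof (cases "{x, move x s} \<in> E")
    case True
    then show ?thesis using le unfolding shared_factor_def ew \<pi>_def by (simp only: if_True)
  qed (simp add: shared_factor_def)
qed

lemma shared_sum_le_wsum:
  assumes F: "\<And>r y. 0 \<le> F r y" and "x \<notin> V"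
  shows "shared_sum E F N V x \<le> wsum E F N V x"
  using assms(2)
proof (induction N arbitrary: V x)
  case (Suc N)
  show ?case
    unfolding shared_sum_Suc[OF Suc.prems] wsum.simps
  proof (intro add_left_mono sum_mono)
    fix s assume s: "s \<in> steps"
    show "(if move x s \<in> insert x V then 0
        else \<pi> s * shared_factor p E {x, move x s} * shared_sum E F N (insert x V) (move x s))
      \<le> (if move x s \<in> insert x V then 0
        else (if {x, move x s} \<in> E then 1 else \<pi> s) * wsum E F N (insert x V) (move x s))"
    proof (cases "move x s \<in> insert x V")
      case False
      have "\<pi> s * shared_factor p E {x, move x s} * shared_sum E F N (insert x V) (move x s)
        \<le> \<pi> s * shared_factor p E {x, move x s} * wsum E F N (insert x V) (move x s)"
        using False shared_factor_step(1)[OF s] by (intro mult_left_mono Suc.IH) (auto intro: less_imp_le)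
      also have "\<dots> \<le> (if {x, move x s} \<in> E then 1 else \<pi> s) * wsum E F N (insert x V) (move x s)"
        by (intro mult_right_mono shared_factor_step(2) s wsum_nonneg F)
      finally show ?thesis using False by simp
    qed simp
  qed
qed (simp add: shared_sum_0)

lemma shared_sum_empty_eq_wsum:
  assumes "x \<notin> V"
  shows "shared_sum {} F N V x = wsum {} F N V x"
  using assms
proof (induction N arbitrary: V x)
  case (Suc N)
  show ?case
    unfolding shared_sum_Suc[OF Suc.prems] wsum.simps
    by (intro arg_cong2[of _ _ _ _ "(+)"] sum.cong refl) (simp add: shared_factor_def Suc.IH)
qed (simp add: shared_sum_0)

end

section \<open>Lower bound for the total weight of self-avoiding words\<close>

context short_walks begin

text \<open>A union bound: a free walk is lost only when it enters \<open>V\<close> or its own past.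
  Each point joins the forbidden set when it is left, and from then on its expected number of visits
  is at most \<open>3 * \<eta>\<close>; this happens at most \<open>N\<close> times.\<close>

lemma wsum_ge:
  fixes c :: "nat \<Rightarrow> real"
  assumes c: "\<And>r. 0 \<le> c r" and "N \<le> L + 2" "finite V" "x \<notin> V"
  shows "wsum {} (\<lambda>r y. c r) N V x
    \<ge> (\<Sum>r\<le>N. c r) * (1 - (\<Sum>t = 1..N. (avg ^^ t) (indicat_real V) x) - real N * (3 * \<eta>))"
  using assms(2-)
proof (induction N arbitrary: V x)
  case (Suc N)
  define C where "C = (\<Sum>r\<le>N. c r)"
  have C: "0 \<le> C" unfolding C_def by (intro sum_nonneg c)
  let ?W = "insert x V"
  let ?B = "\<lambda>W y. 1 - (\<Sum>t = 1..N. (avg ^^ t) (indicat_real W) y) - real N * (3 * \<eta>)"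
  have ind: "indicat_real ?W y = indicat_real V y + point_mass x y" for y
    using Suc.prems by (auto simp: indicator_def point_mass_def)
  \<comment> \<open>If the new point is forbidden, the indicator, which is the time 0 term of the
    expected visits, cancels the 1 and makes the left side nonpositive.\<close>
  have *: "C * (?B ?W (move x s) - indicat_real ?W (move x s))
      \<le> (if move x s \<in> ?W then 0 else wsum {} (\<lambda>r y. c r) N ?W (move x s))" for s
  proof (cases "move x s \<in> ?W")
    case True
    have "0 \<le> (\<Sum>t = 1..N. (avg ^^ t) (indicat_real ?W) (move x s))"
      by (intro sum_nonneg avgn_nonneg) simp
    moreover have "indicat_real ?W (move x s) = 1" using True by simp
    moreover have "0 \<le> real N * (3 * \<eta>)" using eta_pos by simp
    ultimately have "?B ?W (move x s) - indicat_real ?W (move x s) \<le> 0" by linarith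
    then show ?thesis using C True by (simp add: mult_nonneg_nonpos)
  next
    case False
    have "C * ?B ?W (move x s) \<le> wsum {} (\<lambda>r y. c r) N ?W (move x s)"
      unfolding C_def using Suc.prems False by (intro Suc.IH) auto
    then show ?thesis using False by simp
  qed
  define Q where "Q = 1 - (\<Sum>t = 1..Suc N. (avg ^^ t) (indicat_real V) x) - real (Suc N) * (3 * \<eta>)"
  have "Q \<le> avg (\<lambda>y. ?B ?W y - indicat_real ?W y) x"
  proof -
    have "avg (\<lambda>y. (?B ?W y - indicat_real ?W y) + ((\<Sum>t\<le>N. (avg ^^ t) (indicat_real ?W) y) + real N * (3 * \<eta>))) x
       = avg (\<lambda>y. 1) x"
    proof -
      have "(\<Sum>t\<le>N. (avg ^^ t) (indicat_real ?W) y) = indicat_real ?W y + (\<Sum>t = 1..N. (avg ^^ t) (indicat_real ?W) y)" for y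
        by (simp add: atMost_atLeast0 sum.atLeast_Suc_atMost)
      then show ?thesis by simp
    qed
    then have eq: "avg (\<lambda>y. ?B ?W y - indicat_real ?W y) x + ((\<Sum>t\<le>N. (avg ^^ Suc t) (indicat_real ?W) x) + real N * (3 * \<eta>)) = 1"
      unfolding avg_add avg_sum avg_const by simp
    have "(\<Sum>t\<le>N. (avg ^^ Suc t) (indicat_real ?W) x) = (\<Sum>t = 1..Suc N. (avg ^^ t) (indicat_real ?W) x)"
      by (rule sum.reindex_bij_witness[of _ "\<lambda>t. t - 1" Suc]) auto
    also have "\<dots> = (\<Sum>t = 1..Suc N. (avg ^^ t) (indicat_real V) x) + (\<Sum>t = 1..Suc N. (avg ^^ t) (point_mass x) x)"
      unfolding sum.distrib[symmetric] avgn_add[symmetric] ind[abs_def] ..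
    also have "(\<Sum>t = 1..Suc N. (avg ^^ t) (point_mass x) x) \<le> 3 * \<eta>"
      using Suc.prems by (intro sum_avgn_point_mass_le) auto
    finally show ?thesis using eq by (simp add: Q_def algebra_simps)
  qed
  then have "C * Q \<le> C * avg (\<lambda>y. ?B ?W y - indicat_real ?W y) x"
    using C by (rule mult_left_mono)
  also have "\<dots> = avg (\<lambda>y. C * (?B ?W y - indicat_real ?W y)) x"
    by (rule avg_cmult[symmetric])
  also have "\<dots> \<le> (\<Sum>s\<in>steps. \<pi> s * (if move x s \<in> ?W then 0 else wsum {} (\<lambda>r y. c r) N ?W (move x s)))"
    unfolding avg_def[of "\<lambda>y. C * (?B ?W y - indicat_real ?W y)"]
    by (intro sum_mono mult_left_mono * less_imp_le pi_pos)
  also have "\<dots> = (\<Sum>s\<in>steps. if move x s \<in> ?W then 0 else (if {x, move x s} \<in> {} then 1 else \<pi> s) * wsum {} (\<lambda>r y. c r) N ?W (move x s))"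
    by (intro sum.cong refl) simp
  finally have 1: "C * Q \<le> \<dots>" .
  have "Q \<le> 1"
  proof -
    have "0 \<le> (\<Sum>t = 1..Suc N. (avg ^^ t) (indicat_real V) x)"
      by (intro sum_nonneg avgn_nonneg) simp
    moreover have "0 \<le> real (Suc N) * (3 * \<eta>)" using eta_pos by simp
    ultimately show ?thesis unfolding Q_def by linarith
  qed
  then have "c (Suc N) * Q \<le> c (Suc N)" using c[of "Suc N"] by (simp add: mult_left_le)
  with 1 have "(C + c (Suc N)) * Q \<le> wsum {} (\<lambda>r y. c r) (Suc N) V x"
    unfolding wsum.simps distrib_right by linarith
  then show ?case by (simp only: C_def Q_def sum.atMost_Suc)
qed simp

text \<open>The normalising constant of a section. A remaining budget below \<open>L\<close> out of
  \<open>L + 2\<close> means a length of at least 3, so there are \<open>L\<close> admissible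
  lengths; from three steps on, a given point is hit with probability of order
  \<open>\<eta>\<^sup>2\<close>.\<close>

definition section_total :: "pos \<Rightarrow> real" where
  "section_total x = wsum {} (\<lambda>r y. if r < L then 1 else 0) (L + 2) {} x"

lemma section_total_ge: "real L / 2 \<le> section_total x"
proof -
  have "(\<Sum>r\<le>L + 2. if r < L then 1 else 0::real) = real L"
  proof -
    have "(\<Sum>r\<le>L + 2. if r < L then 1 else 0::real) = (\<Sum>r\<in>{..L + 2} \<inter> {..<L}. 1)"
      by (subst sum.inter_restrict) auto
    also have "{..L + 2} \<inter> {..<L} = {..<L}" by auto
    finally show ?thesis by simp
  qed
  moreover have "indicat_real {} = (\<lambda>_::pos. 0)" by auto
  then have "(\<Sum>t = 1..L + 2. (avg ^^ t) (indicat_real {}) x) = 0"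
    by (simp only: avgn_const sum.neutral_const)
  ultimately have "section_total x \<ge> real L * (1 - real (L + 2) * (3 * \<eta>))"
    using wsum_ge[of "\<lambda>r. if r < L then 1 else 0" "L + 2" "{}" x]
    unfolding section_total_def by (simp del: wsum.simps sum.atMost_Suc)
  moreover have "real (L + 2) * (3 * \<eta>) \<le> 1 / 2"
  proof -
    have "real (L + 2) * (3 * \<eta>) \<le> (3 * real L) * (3 * \<eta>)"
      using L eta_pos by (intro mult_right_mono) auto
    also have "\<dots> = 9 * (real L * \<eta>)" by simp
    also have "\<dots> \<le> 1 / 2" using L_eta'(1) by simp
    finally show ?thesis .
  qed
  then have "real L * (1 / 2) \<le> real L * (1 - real (L + 2) * (3 * \<eta>))"
    by (intro mult_left_mono) auto
  ultimately show ?thesis by simp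
qed

lemma section_total_pos: "0 < section_total x"
  using section_total_ge[of x] L by simp

end

section \<open>Layered paths\<close>

text \<open>The law of the number of ones among \<open>g\<close> fair bits. Its argument is an
  integer because it is applied to differences of bit counts.\<close>

definition binomial_weight :: "nat \<Rightarrow> int \<Rightarrow> real" where
  "binomial_weight g j = (if j \<ge> 0 then real (g choose nat j) / 2 ^ g else 0)"

lemma binomial_weight_nonneg: "0 \<le> binomial_weight g j"
  by (simp add: binomial_weight_def)

lemma binomial_weight_0: "binomial_weight 0 j = (if j = 0 then 1 else 0)"
  by (auto simp: binomial_weight_def binomial_eq_0)

lemma binomial_weight_Suc:
  "binomial_weight (Suc g) j = (binomial_weight g j + binomial_weight g (j - 1)) / 2"
proof -
  consider "j < 0" | "j = 0" | "j > 0" by linarith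
  then show ?thesis
  proof cases
    case 3
    then obtain k where k: "j = int (Suc k)" by (metis gr0_implies_Suc zero_less_imp_eq_int of_nat_0_less_iff)
    then have "nat j = Suc k" "nat (j - 1) = k" by auto
    then show ?thesis using 3 by (simp add: binomial_weight_def field_simps)
  qed (auto simp: binomial_weight_def)
qed

lemma binomial_weight_sq_le: "(binomial_weight g j)\<^sup>2 \<le> 1 / (real g + 1)"
  using binomial_sq_le[of g "nat j"] by (auto simp: binomial_weight_def)

text \<open>Treating the weights in pairs avoids square roots: the product is at most the mean of
  the squares.\<close>

lemma binomial_weight_mult_le: "binomial_weight g i * binomial_weight g j \<le> 1 / (real g + 1)"
  using binomial_weight_sq_le[of g i] binomial_weight_sq_le[of g j]
    sum_squares_bound[of "binomial_weight g i" "binomial_weight g j"] by simp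

type_synonym cell = "bool \<times> bool \<times> bool \<times> bool"

text \<open>By \<open>rho_L\<close> a shared \<open>D\<close>-step, which contributes up to
  \<open>1 / (16 * \<rho>)\<close>, costs at most \<open>L / 128\<close>, to be set against the
  normalisation \<open>2 / L\<close> of a section. By \<open>L_kappa\<close> an accidental agreement
  of the \<open>D\<close>-parts, of probability at most \<open>\<kappa>\<close>, is affordable even
  when it is charged with the crude energy bound \<open>896 * L\<close>.\<close>

locale layer_law = short_walks +
  fixes D :: "nat set" and cl :: "nat \<Rightarrow> cell" and \<rho> \<kappa> :: real
  assumes finite_D: "finite D" and D_J: "D \<inter> J = {}" and D_pos: "\<And>a. a \<in> D \<Longrightarrow> 0 < p a"
    and rho_pos: "0 < \<rho>" and cell_ge: "\<And>c. \<rho> \<le> sum p {a \<in> D. cl a = c}"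
    and rho_L: "8 \<le> \<rho> * real L"
    and le_kappa: "\<And>a. a \<in> D \<Longrightarrow> p a / (16 * \<rho>) \<le> \<kappa>" and L_kappa: "896 * real L * \<kappa> \<le> 1"
begin

text \<open>All 16 cells are equally likely, whatever the parameters, so the bits of the cell are
  fair and independent. Inside a cell the law is proportional to \<open>p\<close>, which makes
  \<open>lam a / p a\<close> constant there.\<close>

definition lam :: "nat \<Rightarrow> real" where
  "lam a = p a / (16 * sum p {b \<in> D. cl b = cl a})"

lemma cell_pos: "0 < sum p {a \<in> D. cl a = c}"
  using cell_ge[of c] rho_pos by linarith

lemma lam_pos: "a \<in> D \<Longrightarrow> 0 < lam a"
  using cell_pos by (simp add: lam_def D_pos)

lemma lam_le: "a \<in> D \<Longrightarrow> lam a \<le> \<kappa>"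
proof -
  assume a: "a \<in> D"
  have "lam a \<le> p a / (16 * \<rho>)"
    unfolding lam_def using D_pos[OF a] cell_ge rho_pos by (intro divide_left_mono) (auto intro!: mult_pos_pos cell_pos)
  then show ?thesis using le_kappa[OF a] by simp
qed

lemma lam_div_le: "a \<in> D \<Longrightarrow> lam a * (1 / p a) \<le> 1 / (16 * \<rho>)"
proof -
  assume a: "a \<in> D"
  have "lam a * (1 / p a) = 1 / (16 * sum p {b \<in> D. cl b = cl a})"
    using D_pos[OF a] by (simp add: lam_def)
  also have "\<dots> \<le> 1 / (16 * \<rho>)"
    using cell_ge rho_pos by (intro divide_left_mono) (auto intro!: mult_pos_pos cell_pos)
  finally show ?thesis .
qed

lemma sum_lam_cl: "(\<Sum>a\<in>D. lam a * g (cl a)) = (\<Sum>c\<in>UNIV. g c / 16)"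
proof -
  have "(\<Sum>a\<in>D. lam a * g (cl a)) = (\<Sum>c\<in>UNIV. \<Sum>a\<in>{a \<in> D. cl a = c}. lam a * g (cl a))"
    by (rule sum.group[symmetric]) (auto simp: finite_D)
  also have "\<dots> = (\<Sum>c\<in>UNIV. g c / 16)"
  proof (rule sum.cong[OF refl])
    fix c
    have "(\<Sum>a\<in>{a \<in> D. cl a = c}. lam a * g (cl a))
      = (\<Sum>a\<in>{a \<in> D. cl a = c}. p a * (g c / (16 * sum p {a \<in> D. cl a = c})))"
      by (rule sum.cong[OF refl]) (auto simp: lam_def)
    also have "\<dots> = sum p {a \<in> D. cl a = c} * (g c / (16 * sum p {a \<in> D. cl a = c}))"
      by (rule sum_distrib_right[symmetric])
    also have "\<dots> = g c / 16" using cell_pos[of c] by simp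
    finally show "(\<Sum>a\<in>{a \<in> D. cl a = c}. lam a * g (cl a)) = g c / 16" .
  qed
  finally show ?thesis .
qed

lemma sum_lam: "(\<Sum>a\<in>D. lam a) = 1"
proof -
  have "card (UNIV :: cell set) = 16" by (simp add: card_prod)
  then show ?thesis using sum_lam_cl[of "\<lambda>_. 1"] by simp
qed

lemma D_nonempty: "D \<noteq> {}"
  using sum_lam by auto

lemma kappa_pos: "0 < \<kappa>"
proof -
  obtain a where "a \<in> D" using D_nonempty by auto
  then show ?thesis using lam_pos lam_le by (metis less_le_trans)
qed

definition section_prob :: "pos \<Rightarrow> step list \<Rightarrow> real" where
  "section_prob u w = (if avoiding u {} w \<and> 3 \<le> length w then word_prob w / section_total u else 0)"

lemma section_prob_nonneg: "w \<in> words n \<Longrightarrow> 0 \<le> section_prob u w"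
  using section_total_pos[of u] word_prob_pos[of w n] by (simp add: section_prob_def)

lemma sum_section_shared:
  "(\<Sum>w\<in>words (L + 2). section_prob u w * (\<Prod>e\<in>walk_edges u w. shared_factor p E e) * f (foldl move u w))
    = shared_sum E (\<lambda>r y. if r < L then f y else 0) (L + 2) {} u / section_total u"
  unfolding shared_sum_def sum_divide_distrib
proof (rule sum.cong[OF refl])
  fix w assume "w \<in> words (L + 2)"
  then have "L + 2 - length w < L \<longleftrightarrow> 3 \<le> length w" by (auto simp: words_def)
  then show "section_prob u w * (\<Prod>e\<in>walk_edges u w. shared_factor p E e) * f (foldl move u w) =
    (if avoiding u {} w then word_prob w * (\<Prod>e\<in>walk_edges u w. shared_factor p E e) *
      (if L + 2 - length w < L then f (foldl move u w) else 0) else 0) / section_total u"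
    by (simp add: section_prob_def)
qed

lemma sum_section_wsum:
  "(\<Sum>w\<in>words (L + 2). section_prob u w * f (foldl move u w))
    = wsum {} (\<lambda>r y. if r < L then f y else 0) (L + 2) {} u / section_total u"
  using sum_section_shared[of u "{}" f] by (simp add: shared_sum_empty_eq_wsum shared_factor_def del: wsum.simps)

lemma sum_section: "(\<Sum>w\<in>words (L + 2). section_prob u w) = 1"
  using sum_section_wsum[of u "\<lambda>_. 1"] section_total_pos[of u] by (simp add: section_total_def del: wsum.simps)

definition layer_avg :: "(pos \<Rightarrow> real) \<Rightarrow> pos \<Rightarrow> real" where
  "layer_avg h u = (\<Sum>w\<in>words (L + 2). section_prob u w * (\<Sum>a\<in>D. lam a * h (move (foldl move u w) (a, 1))))"

lemma layer_avg_mono: "(\<And>y. f y \<le> g y) \<Longrightarrow> layer_avg f u \<le> layer_avg g u"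
  unfolding layer_avg_def
  by (intro sum_mono mult_left_mono) (auto intro: less_imp_le lam_pos section_prob_nonneg)

lemma layer_avg_const: "layer_avg (\<lambda>_. c) u = c"
  by (simp only: layer_avg_def sum_distrib_right[symmetric] sum_lam sum_section mult_1_left)

lemma layer_avg_add: "layer_avg (\<lambda>y. f y + g y) u = layer_avg f u + layer_avg g u"
  by (simp add: layer_avg_def distrib_left sum.distrib)

lemma layer_avg_cmult: "layer_avg (\<lambda>y. c * f y) u = c * layer_avg f u"
  by (simp add: layer_avg_def sum_distrib_left mult_ac)

text \<open>The cell of a \<open>D\<close>-step consists of four independent fair bits, so after \<open>g\<close> layers the numbers
  of steps having a given bit are four independent binomial variables.\<close>

definition bit_count :: "(cell \<Rightarrow> bool) \<Rightarrow> pos \<Rightarrow> int" where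
  "bit_count b u = (\<Sum>a\<in>D. if b (cl a) then u a else 0)"

abbreviation (input) "bit1 \<equiv> (\<lambda>c::cell. fst c)"
abbreviation (input) "bit2 \<equiv> (\<lambda>c::cell. fst (snd c))"
abbreviation (input) "bit3 \<equiv> (\<lambda>c::cell. fst (snd (snd c)))"
abbreviation (input) "bit4 \<equiv> (\<lambda>c::cell. snd (snd (snd c)))"

text \<open>The probability that \<open>g\<close> layers started at \<open>u\<close> end with the
  four bit counts of \<open>z\<close>. It dominates the probability that the
  \<open>D\<close>-coordinates agree and depends only on the bits.\<close>

definition hit :: "nat \<Rightarrow> pos \<Rightarrow> pos \<Rightarrow> real" where
  "hit g z u = binomial_weight g (bit_count bit1 z - bit_count bit1 u) *
    binomial_weight g (bit_count bit2 z - bit_count bit2 u) *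
    (binomial_weight g (bit_count bit3 z - bit_count bit3 u) *
    binomial_weight g (bit_count bit4 z - bit_count bit4 u))"

lemma hit_nonneg: "0 \<le> hit g z u"
  by (simp add: hit_def binomial_weight_nonneg)

lemma hit_le: "hit g z u \<le> (1 / (real g + 1)) * (1 / (real g + 1))"
  unfolding hit_def
  by (intro mult_mono binomial_weight_mult_le) (auto simp: binomial_weight_nonneg)

lemma bit_count_D_step:
  assumes "a \<in> D"
  shows "bit_count b (move u (a, 1)) = bit_count b u + (if b (cl a) then 1 else 0)"
proof -
  have "bit_count b (move u (a, 1)) = (\<Sum>i\<in>D. (if b (cl i) then u i else 0) + (if i = a then (if b (cl a) then 1 else 0) else 0))"
    unfolding bit_count_def by (rule sum.cong) (auto simp: move_def)
  also have "\<dots> = bit_count b u + (if b (cl a) then 1 else 0)"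
    unfolding sum.distrib bit_count_def using assms finite_D by simp
  finally show ?thesis .
qed

lemma step_D: "s \<in> steps \<Longrightarrow> i \<in> D \<Longrightarrow> move u s i = u i"
  using D_J by (auto simp: move_def steps_def)

lemma bit_count_step: "s \<in> steps \<Longrightarrow> bit_count b (move u s) = bit_count b u"
  unfolding bit_count_def by (intro sum.cong refl) (simp add: step_D)

lemma bit_count_word: "set w \<subseteq> steps \<Longrightarrow> bit_count b (foldl move u w) = bit_count b u"
  by (induction w arbitrary: u) (auto simp: bit_count_step)

text \<open>The four bits of a uniform cell are independent, so the average over the cells splits
  into four instances of \<open>binomial_weight_Suc\<close>.\<close>

lemma sum_lam_hit: "(\<Sum>a\<in>D. lam a * hit g z (move u (a, 1))) = hit (Suc g) z u"
proof -
  let ?d = "\<lambda>b. bit_count b z - bit_count b u"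
  let ?h = "\<lambda>c::cell. binomial_weight g (?d bit1 - (if bit1 c then 1 else 0)) *
    binomial_weight g (?d bit2 - (if bit2 c then 1 else 0)) *
    (binomial_weight g (?d bit3 - (if bit3 c then 1 else 0)) *
    binomial_weight g (?d bit4 - (if bit4 c then 1 else 0)))"
  have "(\<Sum>a\<in>D. lam a * hit g z (move u (a, 1))) = (\<Sum>a\<in>D. lam a * ?h (cl a))"
    by (intro sum.cong refl) (simp add: hit_def bit_count_D_step algebra_simps)
  also have "\<dots> = (\<Sum>c\<in>UNIV. ?h c / 16)" by (rule sum_lam_cl)
  also have "\<dots> = hit (Suc g) z u"
    by (simp add: hit_def binomial_weight_Suc UNIV_Times_UNIV[symmetric] sum.cartesian_product'
        UNIV_bool field_simps del: UNIV_Times_UNIV)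
  finally show ?thesis .
qed

lemma layer_avg_hit: "layer_avg (hit g z) u = hit (Suc g) z u"
proof -
  have "layer_avg (hit g z) u = (\<Sum>w\<in>words (L + 2). section_prob u w * hit (Suc g) z u)"
    unfolding layer_avg_def
  proof (rule sum.cong[OF refl])
    fix w assume "w \<in> words (L + 2)"
    then have "set w \<subseteq> steps" by (simp add: words_def)
    then have "hit (Suc g) z (foldl move u w) = hit (Suc g) z u"
      by (simp add: hit_def bit_count_word)
    then show "section_prob u w * (\<Sum>a\<in>D. lam a * hit g z (move (foldl move u w) (a, 1)))
      = section_prob u w * hit (Suc g) z u" by (simp add: sum_lam_hit)
  qed
  then show ?thesis by (simp only: sum_distrib_right[symmetric] sum_section mult_1_left)
qed

end

section \<open>The energy of a layered path\<close>

type_synonym layer = "step list \<times> nat"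

definition layer_end :: "pos \<Rightarrow> layer \<Rightarrow> pos" where
  "layer_end x l = move (foldl move x (fst l)) (snd l, 1)"

definition walk_points :: "pos \<Rightarrow> step list \<Rightarrow> pos set" where
  "walk_points x w = (\<lambda>i. foldl move x (take i w)) ` {..length w}"

context step_law begin

lemma avgn_zero:
  assumes "\<And>y s. s \<in> steps \<Longrightarrow> P y \<Longrightarrow> P (move y s)" "\<And>y. P y \<Longrightarrow> f y = 0" "P x"
  shows "(avg ^^ t) f x = 0"
  using assms(3) by (induction t arbitrary: x) (auto simp: avg_def assms intro!: sum.neutral)

lemma move_commute: "fst s \<noteq> a \<Longrightarrow> move (move x s) (a, c) = move (move x (a, c)) s"
  by (auto simp: move_def fun_eq_iff)

text \<open>The walk and a \<open>D\<close>-step change different coordinates. The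
  \<open>D\<close>-step can therefore be taken first, after which the walks of two consecutive
  layers join into one longer walk.\<close>

lemma avgn_shift:
  assumes "a \<notin> J"
  shows "(avg ^^ t) (\<lambda>y. f (move y (a, 1))) x = (avg ^^ t) f (move x (a, 1))"
proof (induction t arbitrary: x)
  case (Suc t)
  have "fst s \<noteq> a" if "s \<in> steps" for s using that assms by (auto simp: steps_def)
  then have "move (move x s) (a, 1) = move (move x (a, 1)) s" if "s \<in> steps" for s
    using that by (intro move_commute)
  moreover have "(avg ^^ t) (\<lambda>y. f (move y (a, 1))) = (\<lambda>y. (avg ^^ t) f (move y (a, 1)))"
    by (intro ext Suc)
  ultimately show ?case
    by (simp add: avg_def[of "\<lambda>y. (avg ^^ t) f (move y (a, 1))"] avg_def[of "(avg ^^ t) f"])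
qed simp

lemma word_points:
  assumes "set w \<subseteq> steps" "y \<in> walk_points x w" "i \<notin> J"
  shows "y i = x i"
proof -
  have "foldl move x w i = x i" if "set w \<subseteq> steps" for w
    using that
  proof (induction w arbitrary: x)
    case (Cons s w)
    then have "move x s i = x i" using assms(3) by (auto simp: move_def steps_def)
    with Cons show ?case by simp
  qed simp
  moreover obtain j where "y = foldl move x (take j w)" using assms(2) by (auto simp: walk_points_def)
  moreover have "set (take j w) \<subseteq> steps" using assms(1) set_take_subset[of j w] by blast
  ultimately show ?thesis by simp
qed

end

context layer_law begin

text \<open>The second moment sum for a fixed path from \<open>x\<close> and a random one from
  \<open>u\<close>; \<open>sum_path_prob_shared\<close> identifies it with the sum over whole paths.
  The recursion by layers is possible because different levels share no edge.\<close>

primrec energy :: "layer list \<Rightarrow> pos \<Rightarrow> pos \<Rightarrow> real" where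
  "energy [] x u = 1"
| "energy (l # \<gamma>) x u = (\<Sum>w\<in>words (L + 2). \<Sum>a\<in>D. section_prob u w * lam a *
     (\<Prod>e\<in>walk_edges u w. shared_factor p (walk_edges x (fst l)) e) *
     (if foldl move u w = foldl move x (fst l) \<and> a = snd l then 1 / p a else 1) *
     energy \<gamma> (layer_end x l) (layer_end u (w, a)))"

primrec admissible :: "pos \<Rightarrow> layer list \<Rightarrow> bool" where
  "admissible x [] \<longleftrightarrow> True"
| "admissible x (l # \<gamma>) \<longleftrightarrow> fst l \<in> words (L + 2) \<and> avoiding x {} (fst l) \<and> snd l \<in> D \<and>
     admissible (layer_end x l) \<gamma>"

text \<open>Time 0 is included, so a start on the path counts as a contact.\<close>

definition visits :: "pos set \<Rightarrow> pos \<Rightarrow> real" where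
  "visits A u = (\<Sum>t\<le>L + 2. (avg ^^ t) (indicat_real A) u)"

lemma visits_nonneg: "0 \<le> visits A u"
  unfolding visits_def by (intro sum_nonneg avgn_nonneg) simp

lemma finite_walk_points: "finite (walk_points x w)" "card (walk_points x w) \<le> Suc (length w)"
  using card_image_le[of "{..length w}" "\<lambda>i. foldl move x (take i w)"] by (auto simp: walk_points_def)

lemma visits_zero:
  assumes "set w \<subseteq> steps" "\<exists>i\<in>D. u i \<noteq> x i"
  shows "visits (walk_points x w) u = 0"
  unfolding visits_def
proof (rule sum.neutral, rule ballI, rule avgn_zero[where P="\<lambda>y. \<exists>i\<in>D. y i \<noteq> x i"])
  fix y assume "\<exists>i\<in>D. y i \<noteq> x i"
  then show "indicat_real (walk_points x w) y = 0"
    using word_points[OF assms(1), of y x] D_J by (auto simp: indicator_def)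
qed (use assms(2) in \<open>auto simp: step_D\<close>)

lemma bit_count_points:
  assumes "set w \<subseteq> steps" "y \<in> walk_points x w"
  shows "bit_count b y = bit_count b x"
  unfolding bit_count_def using word_points[OF assms] D_J by (intro sum.cong) auto

lemma section_avg_le:
  assumes "\<And>y. 0 \<le> f y"
  shows "(\<Sum>w\<in>words (L + 2). section_prob u w * f (foldl move u w))
    \<le> (\<Sum>t = 3..L + 2. (avg ^^ t) f u) * (2 / real L)"
proof -
  let ?F = "\<lambda>r y. if r < L then f y else 0"
  have "wsum {} ?F (L + 2) {} u \<le> (\<Sum>t\<le>L + 2. (avg ^^ t) (?F (L + 2 - t)) u)"
    using assms by (intro wsum_empty_le_budget) auto
  also have "\<dots> = (\<Sum>t\<in>{..L + 2}. if t \<in> {3..L + 2} then (avg ^^ t) f u else 0)"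
  proof (rule sum.cong[OF refl])
    fix t assume "t \<in> {..L + 2}"
    then have iff: "L + 2 - t < L \<longleftrightarrow> t \<in> {3..L + 2}" by auto
    show "(avg ^^ t) (?F (L + 2 - t)) u = (if t \<in> {3..L + 2} then (avg ^^ t) f u else 0)"
      unfolding iff by (cases "t \<in> {3..L + 2}") (simp_all only: if_True if_False avgn_const)
  qed
  also have "\<dots> = (\<Sum>t\<in>{..L + 2} \<inter> {3..L + 2}. (avg ^^ t) f u)"
    by (rule sum.inter_restrict[symmetric]) simp
  also have "{..L + 2} \<inter> {3..L + 2} = {3..L + 2}" by auto
  finally have le: "wsum {} ?F (L + 2) {} u \<le> (\<Sum>t = 3..L + 2. (avg ^^ t) f u)" .
  have "wsum {} ?F (L + 2) {} u * (1 / section_total u) \<le> (\<Sum>t = 3..L + 2. (avg ^^ t) f u) * (2 / real L)"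
  proof (rule mult_mono[OF le])
    show "1 / section_total u \<le> 2 / real L"
      using section_total_ge[of u] section_total_pos[of u] L by (simp add: field_simps)
    show "0 \<le> (\<Sum>t = 3..L + 2. (avg ^^ t) f u)" by (intro sum_nonneg avgn_nonneg assms)
  qed (use section_total_pos[of u] in simp)
  then show ?thesis by (simp only: sum_section_wsum times_divide_eq_right mult_1_right)
qed

text \<open>The section makes at least three steps before the next walk begins, so each pair of a
  later time and a point of the path contributes at most \<open>3 * \<eta>\<^sup>2\<close>, and
  there are at most \<open>(L + 3)\<^sup>2\<close> pairs. The \<open>L\<close> lengths with weight
  \<open>2 / L\<close> contribute a factor 2, and 2 * 3 * 16 = 96. A visit requires equal bit counts
  after the \<open>D\<close>-step, whence \<open>hit\<close>.\<close>

lemma layer_avg_visits_le: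
  assumes w: "w \<in> words (L + 2)"
  shows "layer_avg (visits (walk_points x w)) u \<le> 96 * (real L)\<^sup>2 * \<eta>\<^sup>2 * hit 1 x u"
proof -
  let ?A = "walk_points x w"
  have wJ: "set w \<subseteq> steps" and len: "length w \<le> L + 2" using w by (auto simp: words_def)
  have K: "(real L + 3)\<^sup>2 \<le> 16 * (real L)\<^sup>2"
  proof -
    have "(real L + 3)\<^sup>2 \<le> (4 * real L)\<^sup>2" using L by (intro power_mono) auto
    then show ?thesis by (simp add: power_mult_distrib)
  qed
  have bound: "(avg ^^ t) (visits ?A) y \<le> (real L + 3)\<^sup>2 * (3 * \<eta>\<^sup>2)" if "3 \<le> t" for t y
  proof -
    have "(avg ^^ t) (visits ?A) y = (\<Sum>r\<le>L + 2. (avg ^^ (t + r)) (indicat_real ?A) y)"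
      unfolding visits_def by (subst avgn_sum) (auto simp: funpow_add)
    also have "\<dots> \<le> (\<Sum>r\<le>L + 2. (real L + 3) * (3 * \<eta>\<^sup>2))"
    proof (rule sum_mono)
      fix r
      have "(avg ^^ (t + r)) (indicat_real ?A) y \<le> (\<Sum>a\<in>?A. 3 * \<eta>\<^sup>2)"
        unfolding avgn_indicator[OF finite_walk_points(1)]
        using that by (intro sum_mono avgn_point_mass_eta_sq) simp
      also have "\<dots> = real (card ?A) * (3 * \<eta>\<^sup>2)" by simp
      also have "\<dots> \<le> (real L + 3) * (3 * \<eta>\<^sup>2)"
        using finite_walk_points(2)[of x w] len by (intro mult_right_mono) auto
      finally show "(avg ^^ (t + r)) (indicat_real ?A) y \<le> (real L + 3) * (3 * \<eta>\<^sup>2)" .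
    qed
    also have "\<dots> = (real L + 3)\<^sup>2 * (3 * \<eta>\<^sup>2)" by (simp add: power2_eq_square algebra_simps)
    finally show ?thesis .
  qed
  have each: "(\<Sum>v\<in>words (L + 2). section_prob u v * visits ?A (move (foldl move u v) (a, 1)))
      \<le> 96 * (real L)\<^sup>2 * \<eta>\<^sup>2 * hit 0 x (move u (a, 1))" (is "?s \<le> _") if a: "a \<in> D" for a
  proof -
    let ?u = "move u (a, 1)"
    have aJ: "a \<notin> J" using a D_J by auto
    have "?s \<le> (\<Sum>t = 3..L + 2. (avg ^^ t) (\<lambda>y. visits ?A (move y (a, 1))) u) * (2 / real L)"
      by (rule section_avg_le) (rule visits_nonneg)
    also have "\<dots> = (\<Sum>t = 3..L + 2. (avg ^^ t) (visits ?A) ?u) * (2 / real L)"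
      by (simp only: avgn_shift[OF aJ])
    also have "\<dots> \<le> 96 * (real L)\<^sup>2 * \<eta>\<^sup>2 * hit 0 x ?u"
    \<comment> \<open>In the first case \<open>hit 0\<close> equals 1. In the second the walk can
      never reach the path, because it preserves every bit count.\<close>
    proof (cases "\<forall>b. bit_count b ?u = bit_count b x")
      case True
      have "(\<Sum>t = 3..L + 2. (avg ^^ t) (visits ?A) ?u) \<le> (\<Sum>t = 3..L + 2. (real L + 3)\<^sup>2 * (3 * \<eta>\<^sup>2))"
        by (intro sum_mono bound) auto
      also have "\<dots> = real L * ((real L + 3)\<^sup>2 * (3 * \<eta>\<^sup>2))" by simp
      finally have "(\<Sum>t = 3..L + 2. (avg ^^ t) (visits ?A) ?u) * (2 / real L)
        \<le> real L * ((real L + 3)\<^sup>2 * (3 * \<eta>\<^sup>2)) * (2 / real L)"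
        using L by (intro mult_right_mono) auto
      also have "\<dots> = (real L + 3)\<^sup>2 * (6 * \<eta>\<^sup>2)" using L by simp
      also have "\<dots> \<le> 16 * (real L)\<^sup>2 * (6 * \<eta>\<^sup>2)"
        using K by (intro mult_right_mono) auto
      finally show ?thesis using True by (simp add: hit_def binomial_weight_0)
    next
      case False
      then obtain b where b: "bit_count b ?u \<noteq> bit_count b x" by auto
      have "(avg ^^ t) (visits ?A) ?u = 0" for t
      proof (rule avgn_zero[where P="\<lambda>y. bit_count b y \<noteq> bit_count b x", OF _ _ b])
        fix y assume y: "bit_count b y \<noteq> bit_count b x"
        show "visits ?A y = 0"
          unfolding visits_def
        proof (rule sum.neutral, rule ballI, rule avgn_zero[where P="\<lambda>y. bit_count b y \<noteq> bit_count b x", OF _ _ y])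
          fix y assume "bit_count b y \<noteq> bit_count b x"
          then show "indicat_real ?A y = 0"
            using bit_count_points[OF wJ, of y x b] by (auto simp: indicator_def)
        qed (simp add: bit_count_step)
      qed (simp add: bit_count_step)
      then show ?thesis by (simp add: hit_nonneg)
    qed
    finally show ?thesis .
  qed
  have "layer_avg (visits ?A) u
      = (\<Sum>a\<in>D. lam a * (\<Sum>v\<in>words (L + 2). section_prob u v * visits ?A (move (foldl move u v) (a, 1))))"
    unfolding layer_avg_def sum_distrib_left by (subst sum.swap) (simp only: mult.left_commute)
  also have "\<dots> \<le> (\<Sum>a\<in>D. lam a * (96 * (real L)\<^sup>2 * \<eta>\<^sup>2 * hit 0 x (move u (a, 1))))"
    by (intro sum_mono mult_left_mono each) (auto intro: less_imp_le lam_pos)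
  also have "\<dots> = 96 * (real L)\<^sup>2 * \<eta>\<^sup>2 * (\<Sum>a\<in>D. lam a * hit 0 x (move u (a, 1)))"
    unfolding sum_distrib_left by (intro sum.cong refl) (simp only: mult_ac)
  also have "\<dots> = 96 * (real L)\<^sup>2 * \<eta>\<^sup>2 * hit 1 x u" by (simp add: sum_lam_hit)
  finally show ?thesis .
qed

lemma energy_nonneg: "0 \<le> energy \<gamma> x u"
proof (induction \<gamma> arbitrary: x u)
  case (Cons l \<gamma>)
  have "0 \<le> section_prob u w * lam a *
     (\<Prod>e\<in>walk_edges u w. shared_factor p (walk_edges x (fst l)) e) *
     (if foldl move u w = foldl move x (fst l) \<and> a = snd l then 1 / p a else 1) *
     energy \<gamma> (layer_end x l) (layer_end u (w, a))" if "w \<in> words (L + 2)" "a \<in> D" for w a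
  proof -
    have "0 \<le> (\<Prod>e\<in>walk_edges u w. shared_factor p (walk_edges x (fst l)) e)"
    proof (rule prod_nonneg)
      fix e assume "e \<in> walk_edges u w"
      moreover have "set w \<subseteq> steps" using that by (simp add: words_def)
      ultimately have "\<exists>s\<in>steps. \<exists>y. e = {y, move y s}"
        by (induction w arbitrary: u) auto
      then obtain s y where s: "s \<in> steps" "e = {y, move y s}" by blast
      then show "0 \<le> shared_factor p (walk_edges x (fst l)) e"
        using shared_factor_step(1)[OF s(1)] pi_pos[OF s(1)] by (metis less_imp_le zero_less_mult_pos)
    qed
    then show ?thesis using that section_prob_nonneg[OF that(1)] lam_pos[OF that(2)] D_pos[OF that(2)] Cons
      by (intro mult_nonneg_nonneg) (auto intro: less_imp_le)
  qed
  then show ?case by (auto intro!: sum_nonneg)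
qed simp

text \<open>What follows a section depends only on its endpoint \<open>y\<close>, so one layer of
  the energy becomes a shared sum with this terminal function.\<close>

definition exit_value :: "layer list \<Rightarrow> pos \<Rightarrow> layer \<Rightarrow> pos \<Rightarrow> real" where
  "exit_value \<gamma> x l y = (\<Sum>a\<in>D. lam a * (if y = foldl move x (fst l) \<and> a = snd l then 1 / p a else 1) *
     energy \<gamma> (layer_end x l) (move y (a, 1)))"

lemma exit_value_nonneg: "0 \<le> exit_value \<gamma> x l y"
  unfolding exit_value_def
  by (intro sum_nonneg mult_nonneg_nonneg) (auto intro: energy_nonneg less_imp_le lam_pos D_pos)

lemma energy_Cons_eq:
  "energy (l # \<gamma>) x u = shared_sum (walk_edges x (fst l))
     (\<lambda>r y. if r < L then exit_value \<gamma> x l y else 0) (L + 2) {} u / section_total u"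
  unfolding sum_section_shared[symmetric] energy.simps
  by (intro sum.cong refl) (simp add: exit_value_def sum_distrib_left layer_end_def mult_ac)

text \<open>Either the random section uses no edge of the fixed one, or it is charged at its first
  contact with the bound for a run. \<open>\<alpha>\<close> and \<open>\<beta>\<close> stay free
  because the crude and the sharp estimate insert different values.\<close>

lemma energy_first_contact:
  assumes w: "w \<in> words (L + 2)" "avoiding x {} w"
    and f: "\<And>y. exit_value \<gamma> x (w, a) y \<le> \<alpha> * point_mass (foldl move x w) y + \<beta>"
    and \<alpha>: "0 \<le> \<alpha>" and \<beta>: "0 \<le> \<beta>"
  defines "Ab \<equiv> 4 * \<alpha> + 2 * (real L + 3)\<^sup>2 * \<beta>"
  shows "energy ((w, a) # \<gamma>) x u
    \<le> wsum {} (\<lambda>r y. if r < L then exit_value \<gamma> x (w, a) y else 0) (L + 2) {} u / section_total u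
      + (\<Sum>t<L + 2. (avg ^^ t) (indicat_real (walk_points x w)) u) * (2 * Ab / section_total u)"
proof -
  let ?E = "walk_edges x w" and ?T = "length w"
  let ?F = "\<lambda>r y. if r < L then exit_value \<gamma> x (w, a) y else 0"
  have T: "?T \<le> L + 2" using w by (simp add: words_def)
  have Ab: "0 \<le> Ab" using \<alpha> \<beta> by (simp add: Ab_def)
  have F: "0 \<le> ?F r y" for r y by (simp add: exit_value_nonneg)
  have F': "?F r y \<le> \<alpha> * point_mass (foldl move x w) y + \<beta>" for r y
    using f[of y] \<alpha> \<beta> by (simp add: point_mass_def)
  have "shared_sum ?E ?F (L + 2) {} u \<le> wsum ?E ?F (L + 2) {} u"
    by (rule shared_sum_le_wsum[OF F]) simp
  also have "\<dots> \<le> wsum {} ?F (L + 2) {} u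
      + (\<Sum>t<L + 2. (avg ^^ t) (\<lambda>y. 2 * Ab * indicat_real (walk_points x w) y) u)"
  proof (rule wsum_first_contact[OF avoiding_path_param[OF w(2)] _ F Ab])
    fix M v' i V
    assume "M < L + 2" "path_param ?T v' ?E" "i < ?T" "v' i \<in> V"
    then show "wsum ?E ?F M V (v' (Suc i)) \<le> Ab"
      unfolding Ab_def by (intro wsum_run_bound[OF T F F' \<alpha> \<beta>]) auto
  qed (simp add: walk_points_def)
  also have "(\<Sum>t<L + 2. (avg ^^ t) (\<lambda>y. 2 * Ab * indicat_real (walk_points x w) y) u)
      = (\<Sum>t<L + 2. (avg ^^ t) (indicat_real (walk_points x w)) u) * (2 * Ab)"
    by (simp only: avgn_cmult sum_distrib_left[symmetric] mult.commute)
  finally have "shared_sum ?E ?F (L + 2) {} u / section_total u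
      \<le> (wsum {} ?F (L + 2) {} u + (\<Sum>t<L + 2. (avg ^^ t) (indicat_real (walk_points x w)) u) * (2 * Ab)) / section_total u"
    using section_total_pos[of u] by (intro divide_right_mono) auto
  then show ?thesis unfolding energy_Cons_eq fst_conv by (simp only: add_divide_distrib times_divide_eq_right)
qed

end

section \<open>Crude and sharp bounds on the energy\<close>

context layer_law begin

lemma D_step_unique:
  assumes "a \<in> D" "b \<in> D" "\<forall>i\<in>D. move y (a, 1) i = z i" "\<forall>i\<in>D. move y (b, 1) i = z i"
  shows "a = b"
proof (rule ccontr)
  assume "a \<noteq> b"
  then have "move y (b, 1) a = y a" by (simp add: move_def)
  moreover have "move y (a, 1) a = y a + 1" by (simp add: move_def)
  ultimately show False using assms by fastforce
qed

text \<open>There are three kinds of \<open>D\<close>-steps: the shared one, with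
  \<open>lam a / p a\<close> at most \<open>1 / (16 * \<rho>)\<close>; the at most one step that
  makes all \<open>D\<close>-coordinates agree, of probability at most \<open>\<kappa>\<close>; and
  the others, after which \<open>U\<close> applies.\<close>

lemma exit_value_le:
  assumes a: "a \<in> D" and G: "\<And>u. energy \<gamma> (layer_end x (w, a)) u \<le> G"
    and U: "\<And>u. \<exists>i\<in>D. u i \<noteq> layer_end x (w, a) i \<Longrightarrow> energy \<gamma> (layer_end x (w, a)) u \<le> U"
    and U0: "0 \<le> U"
  shows "exit_value \<gamma> x (w, a) y \<le> G / (16 * \<rho>) * point_mass (foldl move x w) y + (\<kappa> * G + U)"
proof -
  let ?z = "layer_end x (w, a)"
  let ?e = "\<lambda>b. energy \<gamma> ?z (move y (b, 1))"
  have G0: "0 \<le> G" using G energy_nonneg order_trans by blast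
  define S where "S = {b \<in> D. \<forall>i\<in>D. move y (b, 1) i = ?z i}"
  have cardS: "card S \<le> 1"
  proof (cases "S = {}")
    case False
    then obtain b where b: "b \<in> S" by auto
    then have "S \<subseteq> {b}" using D_step_unique unfolding S_def by blast
    then show ?thesis using card_mono[of "{b}" S] by simp
  qed simp
  have "exit_value \<gamma> x (w, a) y
      \<le> (\<Sum>b\<in>D. (if b = a then G / (16 * \<rho>) * point_mass (foldl move x w) y else 0)
        + ((if b \<in> S then \<kappa> * G else 0) + lam b * U))"
    unfolding exit_value_def fst_conv snd_conv
  proof (rule sum_mono)
    fix b assume b: "b \<in> D"
    have l0: "0 < lam b" by (rule lam_pos[OF b])
    have pm: "0 \<le> G / (16 * \<rho>) * point_mass (foldl move x w) y"
      using G0 rho_pos by (simp add: point_mass_def)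
    have kG: "0 \<le> \<kappa> * G" using G0 kappa_pos by simp
    show "lam b * (if y = foldl move x w \<and> b = a then 1 / p b else 1) * ?e b
      \<le> (if b = a then G / (16 * \<rho>) * point_mass (foldl move x w) y else 0)
        + ((if b \<in> S then \<kappa> * G else 0) + lam b * U)"
    proof (cases "y = foldl move x w \<and> b = a")
      case True
      have "lam b * (1 / p b) * ?e b \<le> 1 / (16 * \<rho>) * G"
        using lam_div_le[OF b] G energy_nonneg rho_pos by (intro mult_mono) auto
      moreover have "0 \<le> lam b * U" using l0 U0 by simp
      ultimately show ?thesis using True kG by (simp add: point_mass_def)
    next
      case False
      have "lam b * ?e b \<le> (if b \<in> S then \<kappa> * G else 0) + lam b * U"
      proof (cases "b \<in> S")
        case True
        have "lam b * ?e b \<le> \<kappa> * G"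
          using lam_le[OF b] G energy_nonneg l0 kappa_pos by (intro mult_mono) auto
        moreover have "0 \<le> lam b * U" using l0 U0 by simp
        ultimately show ?thesis using True by simp
      next
        case False
        then have "?e b \<le> U" using b unfolding S_def by (intro U) auto
        then show ?thesis using False l0 by simp
      qed
      moreover have "0 \<le> (if b = a then G / (16 * \<rho>) * point_mass (foldl move x w) y else 0)"
        using pm by simp
      moreover have "(if y = foldl move x w \<and> b = a then 1 / p b else 1) = 1"
        using False by (simp only: if_False)
      ultimately show ?thesis by simp
    qed
  qed
  also have "\<dots> = G / (16 * \<rho>) * point_mass (foldl move x w) y + (card S * (\<kappa> * G) + U)"
  proof -
    have "(\<Sum>b\<in>D. if b \<in> S then \<kappa> * G else 0) = (\<Sum>b\<in>D \<inter> S. \<kappa> * G)"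
      by (rule sum.inter_restrict[symmetric, OF finite_D])
    also have "D \<inter> S = S" by (auto simp: S_def)
    finally have "(\<Sum>b\<in>D. if b \<in> S then \<kappa> * G else 0) = card S * (\<kappa> * G)" by simp
    moreover have "(\<Sum>b\<in>D. lam b * U) = U"
      by (simp only: sum_distrib_right[symmetric] sum_lam mult_1_left)
    ultimately show ?thesis using a finite_D by (simp add: sum.distrib)
  qed
  also have "card S * (\<kappa> * G) \<le> 1 * (\<kappa> * G)"
    using cardS G0 kappa_pos by (intro mult_right_mono) auto
  finally show ?thesis by simp
qed

lemma inverse_section_total: "1 / section_total u \<le> 2 / real L" "0 < 1 / section_total u"
  using section_total_ge[of u] section_total_pos[of u] L by (simp_all add: field_simps)

lemma L3_sq: "(real L + 3)\<^sup>2 \<le> 16 * (real L)\<^sup>2"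
proof -
  have "(real L + 3)\<^sup>2 \<le> (4 * real L)\<^sup>2" using L by (intro power_mono) auto
  then show ?thesis by (simp add: power_mult_distrib)
qed

lemma rho_frac: "1 / (16 * \<rho>) \<le> real L / 128"
  using rho_L rho_pos by (simp add: field_simps)

text \<open>The crude bound reproduces itself. Apart from the small term
  \<open>\<kappa> * G\<close>, the bound \<open>G\<close> enters through \<open>\<alpha>\<close>, at
  most \<open>G * L / 128\<close>; the coefficients of \<open>\<alpha>\<close> add up to 12, and the
  normalisation \<open>2 / L\<close> turns this into at most 3/16 of \<open>G\<close>. The remaining
  terms are of order \<open>L\<close>. Since 896 = 7 * 128, \<open>\<alpha>\<close> is at most
  \<open>7 * L\<^sup>2\<close>.\<close>

lemma energy_le_rough:
  assumes w: "w \<in> words (L + 2)" "avoiding x {} w" and a: "a \<in> D"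
    and G: "\<And>u. energy \<gamma> (layer_end x (w, a)) u \<le> 896 * real L"
    and U: "\<And>u. \<exists>i\<in>D. u i \<noteq> layer_end x (w, a) i \<Longrightarrow> energy \<gamma> (layer_end x (w, a)) u \<le> 2"
  shows "energy ((w, a) # \<gamma>) x u \<le> 896 * real L"
proof -
  define G where "G = 896 * real L"
  define \<alpha> where "\<alpha> = G / (16 * \<rho>)"
  define \<beta> where "\<beta> = \<kappa> * G + 2"
  define Ab where "Ab = 4 * \<alpha> + 2 * (real L + 3)\<^sup>2 * \<beta>"
  let ?A = "walk_points x w"
  let ?f = "exit_value \<gamma> x (w, a)"
  have G0: "0 \<le> G" by (simp add: G_def)
  have \<alpha>: "0 \<le> \<alpha>" using G0 rho_pos by (simp add: \<alpha>_def)
  have \<beta>: "0 \<le> \<beta>" using G0 kappa_pos by (simp add: \<beta>_def)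
  have Ab0: "0 \<le> Ab" using \<alpha> \<beta> by (simp add: Ab_def)
  have Ab_eq: "Ab = 4 * \<alpha> + 2 * ((real L + 3)\<^sup>2 * \<beta>)" by (simp add: Ab_def)
  have \<beta>3: "\<beta> \<le> 3" using L_kappa by (simp add: \<beta>_def G_def mult_ac)
  have \<alpha>L: "\<alpha> \<le> 7 * (real L)\<^sup>2"
  proof -
    have "\<alpha> = G * (1 / (16 * \<rho>))" by (simp add: \<alpha>_def)
    also have "\<dots> \<le> G * (real L / 128)" using G0 rho_frac by (rule mult_left_mono[rotated])
    finally show ?thesis by (simp add: G_def power2_eq_square)
  qed
  have f: "?f y \<le> \<alpha> * point_mass (foldl move x w) y + \<beta>" for y
    unfolding \<alpha>_def \<beta>_def using G U by (intro exit_value_le[OF a]) (auto simp: G_def)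
  have len: "length w \<le> L + 2" using w by (simp add: words_def)
  have eta1: "3 * \<eta> \<le> 1 / 1000" using L_eta' by simp
  have Leta: "(real L + 3) * (3 * \<eta>) \<le> 1 / 100"
  proof -
    have "(real L + 3) * (3 * \<eta>) \<le> (4 * real L) * (3 * \<eta>)"
      using L eta_pos by (intro mult_right_mono) auto
    also have "\<dots> = 12 * (real L * \<eta>)" by simp
    also have "\<dots> \<le> 1 / 100" using L_eta'(1) by simp
    finally show ?thesis .
  qed
  have free: "wsum {} (\<lambda>r y. if r < L then ?f y else 0) (L + 2) {} u \<le> 2 * \<alpha> + (real L + 3) * \<beta>"
  proof -
    have "wsum {} (\<lambda>r y. if r < L then ?f y else 0) (L + 2) {} u
        \<le> (\<Sum>t\<le>L + 2. (avg ^^ t) (\<lambda>y. \<alpha> * point_mass (foldl move x w) y + \<beta>) u)"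
    proof (rule wsum_empty_le)
      fix r y
      show "(if r < L then ?f y else 0) \<le> \<alpha> * point_mass (foldl move x w) y + \<beta>"
        using f[of y] \<alpha> \<beta> by (simp add: point_mass_def)
    qed (simp add: exit_value_nonneg)
    also have "\<dots> = (\<alpha> * point_mass (foldl move x w) u + \<beta>)
        + (\<Sum>t = 1..L + 2. (avg ^^ t) (\<lambda>y. \<alpha> * point_mass (foldl move x w) y + \<beta>) u)"
      unfolding atMost_atLeast0 by (subst sum.atLeast_Suc_atMost) simp_all
    also have "(\<Sum>t = 1..L + 2. (avg ^^ t) (\<lambda>y. \<alpha> * point_mass (foldl move x w) y + \<beta>) u)
        \<le> \<alpha> * (3 * \<eta>) + real (L + 2) * \<beta>"
      by (rule sum_avgn_le) (auto simp: \<alpha>)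
    also have "\<alpha> * (3 * \<eta>) \<le> \<alpha> * 1" using \<alpha> eta1 by (intro mult_left_mono) auto
    also have "\<alpha> * point_mass (foldl move x w) u \<le> \<alpha> * 1"
      using \<alpha> by (intro mult_left_mono) (auto simp: point_mass_def)
    finally show ?thesis by (simp add: algebra_simps)
  qed
  have vis: "(\<Sum>t<L + 2. (avg ^^ t) (indicat_real ?A) u) \<le> 5 / 4"
  proof -
    have "(\<Sum>t<L + 2. (avg ^^ t) (indicat_real ?A) u) = (\<Sum>t\<le>L + 1. (avg ^^ t) (indicat_real ?A) u)"
      by (rule sum.cong) auto
    also have "\<dots> = indicat_real ?A u + (\<Sum>t = 1..L + 1. (avg ^^ t) (indicat_real ?A) u)"
      unfolding atMost_atLeast0 by (subst sum.atLeast_Suc_atMost) simp_all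
    also have "(\<Sum>t = 1..L + 1. (avg ^^ t) (indicat_real ?A) u) \<le> (real L + 3) * (3 * \<eta>)"
      using finite_walk_points[of x w] len by (intro sum_avgn_indicator_le) auto
    also have "indicat_real ?A u \<le> 1" by (simp add: indicator_def)
    finally show ?thesis using Leta by linarith
  qed
  have "energy ((w, a) # \<gamma>) x u
    \<le> wsum {} (\<lambda>r y. if r < L then ?f y else 0) (L + 2) {} u * (1 / section_total u)
      + (\<Sum>t<L + 2. (avg ^^ t) (indicat_real ?A) u) * (2 * Ab) * (1 / section_total u)"
    using energy_first_contact[OF w f \<alpha> \<beta>, of u] by (simp add: Ab_def del: wsum.simps)
  also have "\<dots> \<le> (2 * \<alpha> + (real L + 3) * \<beta>) * (1 / section_total u) + 5 / 4 * (2 * Ab) * (1 / section_total u)"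
    using free vis Ab0 inverse_section_total(2)[of u] by (intro add_mono mult_right_mono) auto
  also have "\<dots> = ((2 * \<alpha> + (real L + 3) * \<beta>) + 5 / 4 * (2 * Ab)) * (1 / section_total u)"
    by (simp only: distrib_right)
  also have "\<dots> \<le> ((2 * \<alpha> + (real L + 3) * \<beta>) + 5 / 4 * (2 * Ab)) * (2 / real L)"
    using inverse_section_total(1)[of u] \<alpha> \<beta> Ab0 by (intro mult_left_mono) auto
  also have "\<dots> \<le> (376 * (real L)\<^sup>2) * (2 / real L)"
  proof (rule mult_right_mono)
    have "(real L + 3) * \<beta> \<le> (4 * real L) * 3" using L \<beta> \<beta>3 by (intro mult_mono) auto
    moreover have "(real L + 3)\<^sup>2 * \<beta> \<le> (16 * (real L)\<^sup>2) * 3" using L3_sq \<beta> \<beta>3 by (intro mult_mono) auto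
    ultimately show "(2 * \<alpha> + (real L + 3) * \<beta>) + 5 / 4 * (2 * Ab) \<le> 376 * (real L)\<^sup>2"
      using \<alpha>L L_le_square Ab_eq by linarith
  qed simp
  also have "\<dots> \<le> 896 * real L" using L by (simp add: power2_eq_square)
  finally show ?thesis .
qed

text \<open>Without any contact the layer acts as the plain average; every other contribution
  carries the factor \<open>visits\<close>. Since that factor will be small, the crude bound
  suffices for all that follows a contact.\<close>

lemma energy_layer_step:
  assumes w: "w \<in> words (L + 2)" "avoiding x {} w" and a: "a \<in> D"
    and G: "\<And>u. energy \<gamma> (layer_end x (w, a)) u \<le> 896 * real L"
  shows "energy ((w, a) # \<gamma>) x u \<le> layer_avg (energy \<gamma> (layer_end x (w, a))) u
    + 131 * real L * (896 * real L) * visits (walk_points x w) u"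
proof -
  define G where "G = 896 * real L"
  define \<alpha> where "\<alpha> = G / (16 * \<rho>)"
  define Ab where "Ab = 4 * \<alpha> + 2 * (real L + 3)\<^sup>2 * G"
  let ?A = "walk_points x w" and ?yend = "foldl move x w"
  let ?e = "energy \<gamma> (layer_end x (w, a))"
  let ?f = "exit_value \<gamma> x (w, a)"
  let ?free = "\<lambda>y. \<Sum>b\<in>D. lam b * ?e (move y (b, 1))"
  have G0: "0 \<le> G" by (simp add: G_def)
  have \<alpha>: "0 \<le> \<alpha>" using G0 rho_pos by (simp add: \<alpha>_def)
  have Ab0: "0 \<le> Ab" using \<alpha> G0 by (simp add: Ab_def)
  have eG: "?e y \<le> G" for y using G by (simp add: G_def)
  have \<alpha>L: "\<alpha> \<le> G * (real L / 128)"
  proof -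
    have "\<alpha> = G * (1 / (16 * \<rho>))" by (simp add: \<alpha>_def)
    also have "\<dots> \<le> G * (real L / 128)" using G0 rho_frac by (rule mult_left_mono[rotated])
    finally show ?thesis .
  qed
  have f: "?f y \<le> ?free y + \<alpha> * point_mass ?yend y" for y
  proof -
    have each: "lam b * (if y = ?yend \<and> b = a then 1 / p b else 1) * ?e (move y (b, 1))
        \<le> lam b * ?e (move y (b, 1)) + (if b = a then \<alpha> * point_mass ?yend y else 0)"
      if b: "b \<in> D" for b
      proof (cases "y = ?yend \<and> b = a")
        case True
        have "lam b * (1 / p b) * ?e (move y (b, 1)) \<le> 1 / (16 * \<rho>) * G"
          using lam_div_le[OF b] eG energy_nonneg rho_pos by (intro mult_mono) auto
        moreover have "0 \<le> lam b * ?e (move y (b, 1))"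
          using lam_pos[OF b] energy_nonneg by (simp add: less_imp_le)
        ultimately show ?thesis using True by (simp add: point_mass_def \<alpha>_def)
      next
        case False
        then have "(if y = ?yend \<and> b = a then 1 / p b else 1) = 1" by (simp only: if_False)
        moreover have "0 \<le> (if b = a then \<alpha> * point_mass ?yend y else 0)"
          using \<alpha> by (simp add: point_mass_def)
        ultimately show ?thesis by simp
      qed
    have "?f y \<le> (\<Sum>b\<in>D. lam b * ?e (move y (b, 1)) + (if b = a then \<alpha> * point_mass ?yend y else 0))"
      unfolding exit_value_def fst_conv snd_conv by (rule sum_mono) (rule each)
    also have "\<dots> = ?free y + \<alpha> * point_mass ?yend y"
      using a finite_D by (simp add: sum.distrib)
    finally show ?thesis .
  qed
  have f0: "?free y \<le> G" for y
  proof -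
    have "?free y \<le> (\<Sum>b\<in>D. lam b * G)"
      by (intro sum_mono mult_left_mono eG) (auto intro: less_imp_le lam_pos)
    then show ?thesis by (simp only: sum_distrib_right[symmetric] sum_lam mult_1_left)
  qed
  have f': "?f y \<le> \<alpha> * point_mass ?yend y + G" for y
    using f[of y] f0[of y] by linarith
  \<comment> \<open>Sections may share their \<open>D\<close>-step after meeting only at the common
    endpoint; this too is counted as a visit.\<close>
  have y0: "?yend \<in> ?A"
    unfolding walk_points_def by (rule image_eqI[of _ _ "length w"]) auto
  have "wsum {} (\<lambda>r y. if r < L then ?f y else 0) (L + 2) {} u / section_total u
      = (\<Sum>v\<in>words (L + 2). section_prob u v * ?f (foldl move u v))"
    by (rule sum_section_wsum[symmetric])
  also have "\<dots> \<le> (\<Sum>v\<in>words (L + 2). section_prob u v * (?free (foldl move u v) + \<alpha> * point_mass ?yend (foldl move u v)))"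
    by (intro sum_mono mult_left_mono f section_prob_nonneg)
  also have "\<dots> = layer_avg ?e u + \<alpha> * (\<Sum>v\<in>words (L + 2). section_prob u v * point_mass ?yend (foldl move u v))"
    by (simp only: distrib_left sum.distrib layer_avg_def sum_distrib_left mult.left_commute)
  also have "(\<Sum>v\<in>words (L + 2). section_prob u v * point_mass ?yend (foldl move u v)) \<le> visits ?A u * (2 / real L)"
  proof -
    have "(\<Sum>v\<in>words (L + 2). section_prob u v * point_mass ?yend (foldl move u v))
      \<le> (\<Sum>t = 3..L + 2. (avg ^^ t) (point_mass ?yend) u) * (2 / real L)"
      by (rule section_avg_le) (simp add: point_mass_def)
    moreover have "(\<Sum>t = 3..L + 2. (avg ^^ t) (point_mass ?yend) u) \<le> visits ?A u"
    proof -
      have "(\<Sum>t = 3..L + 2. (avg ^^ t) (point_mass ?yend) u) \<le> (\<Sum>t = 3..L + 2. (avg ^^ t) (indicat_real ?A) u)"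
        using y0 by (intro sum_mono avgn_mono) (auto simp: point_mass_def indicator_def)
      also have "\<dots> \<le> visits ?A u"
        unfolding visits_def by (intro sum_mono2 avgn_nonneg) auto
      finally show ?thesis .
    qed
    then have "(\<Sum>t = 3..L + 2. (avg ^^ t) (point_mass ?yend) u) * (2 / real L) \<le> visits ?A u * (2 / real L)"
      by (rule mult_right_mono) simp
    ultimately show ?thesis by (rule order_trans)
  qed
  finally have free: "wsum {} (\<lambda>r y. if r < L then ?f y else 0) (L + 2) {} u / section_total u
      \<le> layer_avg ?e u + \<alpha> * (visits ?A u * (2 / real L))"
    using \<alpha> by (simp add: mult_left_mono)
  have vis: "(\<Sum>t<L + 2. (avg ^^ t) (indicat_real ?A) u) \<le> visits ?A u"
    unfolding visits_def by (intro sum_mono2 avgn_nonneg) auto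
  have "energy ((w, a) # \<gamma>) x u \<le> layer_avg ?e u + \<alpha> * (visits ?A u * (2 / real L))
      + (\<Sum>t<L + 2. (avg ^^ t) (indicat_real ?A) u) * (2 * Ab / section_total u)"
    using energy_first_contact[OF w f' \<alpha> G0, of u] free unfolding Ab_def by linarith
  also have "(\<Sum>t<L + 2. (avg ^^ t) (indicat_real ?A) u) * (2 * Ab / section_total u)
      \<le> visits ?A u * (2 * Ab * (2 / real L))"
  proof (rule mult_mono[OF vis])
    have "2 * Ab * (1 / section_total u) \<le> 2 * Ab * (2 / real L)"
      using Ab0 inverse_section_total(1)[of u] by (intro mult_left_mono) auto
    then show "2 * Ab / section_total u \<le> 2 * Ab * (2 / real L)" by simp
    show "0 \<le> 2 * Ab / section_total u" using Ab0 section_total_pos[of u] by simp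
  qed (rule visits_nonneg)
  finally have "energy ((w, a) # \<gamma>) x u \<le> layer_avg ?e u + ((\<alpha> + 2 * Ab) * (2 / real L)) * visits ?A u"
    by (simp add: algebra_simps)
  also have "((\<alpha> + 2 * Ab) * (2 / real L)) * visits ?A u \<le> (131 * real L * G) * visits ?A u"
  proof (rule mult_right_mono)
    have "(real L + 3)\<^sup>2 * G \<le> 16 * (real L)\<^sup>2 * G" using L3_sq G0 by (rule mult_right_mono)
    then have "(real L + 3)\<^sup>2 * G \<le> 16 * ((real L)\<^sup>2 * G)" by (simp only: mult.assoc)
    moreover have "real L * G \<le> (real L)\<^sup>2 * G" using L_le_square G0 by (rule mult_right_mono)
    moreover have "Ab = 4 * \<alpha> + 2 * ((real L + 3)\<^sup>2 * G)" by (simp add: Ab_def)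
    moreover have "128 * \<alpha> \<le> real L * G" using \<alpha>L by (simp add: mult.commute)
    moreover have "0 \<le> (real L)\<^sup>2 * G" using G0 by simp
    ultimately have "\<alpha> + 2 * Ab \<le> 65 * ((real L)\<^sup>2 * G)" by linarith
    then have "(\<alpha> + 2 * Ab) * (2 / real L) \<le> 65 * ((real L)\<^sup>2 * G) * (2 / real L)"
      by (intro mult_right_mono) auto
    also have "\<dots> = 130 * real L * G" using L by (simp add: power2_eq_square)
    also have "\<dots> \<le> 131 * real L * G" using G0 by (intro mult_right_mono) auto
    finally show "(\<alpha> + 2 * Ab) * (2 / real L) \<le> 131 * real L * G" .
  qed (rule visits_nonneg)
  finally show ?thesis by (simp add: G_def)
qed

primrec hit_sum :: "layer list \<Rightarrow> nat \<Rightarrow> pos \<Rightarrow> pos \<Rightarrow> real" where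
  "hit_sum [] g x u = 0"
| "hit_sum (l # \<gamma>) g x u = hit g x u + hit_sum \<gamma> (Suc g) (layer_end x l) u"

text \<open>Four bits give the exponent 2, and \<open>1 / (g + 1)\<^sup>2\<close> is at most
  \<open>1 / g - 1 / (g + 1)\<close>, so the sum telescopes to a bound independent of the number of
  layers.\<close>

lemma hit_sum_le: "1 \<le> g \<Longrightarrow> hit_sum \<gamma> g x u \<le> 1 / real g"
proof (induction \<gamma> arbitrary: g x)
  case (Cons l \<gamma>)
  have g: "0 < real g" using Cons.prems by simp
  have "hit_sum (l # \<gamma>) g x u \<le> (1 / (real g + 1)) * (1 / (real g + 1)) + 1 / (real g + 1)"
    using hit_le[of g x u] Cons.IH[of "Suc g" "layer_end x l"] by (simp add: add.commute)
  also have "\<dots> \<le> (1 / real g) * (1 / (real g + 1)) + 1 / (real g + 1)"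
    using g by (intro add_right_mono mult_right_mono) (auto simp: field_simps)
  also have "\<dots> = 1 / real g"
  proof -
    have "(1 / real g) * (1 / (real g + 1)) + 1 / (real g + 1) = (1 / real g) * ((1 + real g) / (real g + 1))"
      using g by (simp add: add_divide_distrib distrib_left)
    then show ?thesis using g by (simp add: add.commute)
  qed
  finally show ?case .
qed simp

lemma layer_avg_hit_sum: "layer_avg (hit_sum \<gamma> g x) u = hit_sum \<gamma> (Suc g) x u"
proof (induction \<gamma> arbitrary: g x)
  case Nil
  then show ?case using layer_avg_const[of 0 u] by (simp del: wsum.simps)
next
  case (Cons l \<gamma>)
  have "hit_sum (l # \<gamma>) g x = (\<lambda>u. hit g x u + hit_sum \<gamma> (Suc g) (layer_end x l) u)" by (rule ext) simp
  then show ?case by (simp add: layer_avg_add layer_avg_hit Cons)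
qed

text \<open>A bound for the expected contacts with all layers of the fixed path. Contacts in the
  current layer are counted exactly as \<open>visits\<close>; later layers enter through their bit
  counts and the factor from \<open>layer_avg_visits_le\<close>.\<close>

definition contact_potential :: "layer list \<Rightarrow> pos \<Rightarrow> pos \<Rightarrow> real" where
  "contact_potential \<gamma> x u = (case \<gamma> of [] \<Rightarrow> 0 | l # \<gamma>' \<Rightarrow>
     visits (walk_points x (fst l)) u + 96 * (real L)\<^sup>2 * \<eta>\<^sup>2 * hit_sum \<gamma>' 1 (layer_end x l) u)"

lemma layer_avg_contact_potential:
  assumes "admissible x \<gamma>"
  shows "layer_avg (contact_potential \<gamma> x) u \<le> 96 * (real L)\<^sup>2 * \<eta>\<^sup>2 * hit_sum \<gamma> 1 x u"
proof (cases \<gamma>)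
  case Nil
  then have "contact_potential \<gamma> x = (\<lambda>_. 0)" by (auto simp: contact_potential_def)
  then show ?thesis using Nil by (simp add: layer_avg_const)
next
  case (Cons l \<gamma>')
  then have "contact_potential \<gamma> x = (\<lambda>u. visits (walk_points x (fst l)) u
      + 96 * (real L)\<^sup>2 * \<eta>\<^sup>2 * hit_sum \<gamma>' 1 (layer_end x l) u)"
    by (auto simp: contact_potential_def)
  then have "layer_avg (contact_potential \<gamma> x) u = layer_avg (visits (walk_points x (fst l))) u
      + 96 * (real L)\<^sup>2 * \<eta>\<^sup>2 * hit_sum \<gamma>' 2 (layer_end x l) u"
    by (simp only: layer_avg_add layer_avg_cmult layer_avg_hit_sum) (simp add: numeral_2_eq_2)
  also have "\<dots> \<le> 96 * (real L)\<^sup>2 * \<eta>\<^sup>2 * hit 1 x u + 96 * (real L)\<^sup>2 * \<eta>\<^sup>2 * hit_sum \<gamma>' 2 (layer_end x l) u"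
    using assms Cons by (intro add_right_mono layer_avg_visits_le) auto
  also have "\<dots> = 96 * (real L)\<^sup>2 * \<eta>\<^sup>2 * hit_sum \<gamma> 1 x u"
    by (simp add: Cons distrib_left numeral_2_eq_2)
  finally show ?thesis .
qed

lemma energy_le:
  assumes "admissible x \<gamma>"
  shows "energy \<gamma> x u \<le> 896 * real L"
proof -
  let ?c = "131 * real L * (896 * real L)"
  \<comment> \<open>Each bound feeds the other: the sharp one gives the value 2 for starts with
    different \<open>D\<close>-coordinates, which the crude one needs, and the crude one sets the
    price of a contact in the sharp one.\<close>
  have "(\<forall>u. energy \<gamma> x u \<le> 896 * real L) \<and> (\<forall>u. energy \<gamma> x u \<le> 1 + ?c * contact_potential \<gamma> x u)"
    using assms
  proof (induction \<gamma> arbitrary: x)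
    case Nil
    then show ?case using L by (simp add: contact_potential_def)
  next
    case (Cons l \<gamma>)
    obtain w a where l: "l = (w, a)" by (cases l)
    from Cons.prems have w: "w \<in> words (L + 2)" "avoiding x {} w" and a: "a \<in> D"
      and adm: "admissible (layer_end x (w, a)) \<gamma>" by (auto simp: l)
    let ?z = "layer_end x (w, a)"
    have G: "energy \<gamma> ?z u \<le> 896 * real L" and P: "energy \<gamma> ?z u \<le> 1 + ?c * contact_potential \<gamma> ?z u" for u
      using Cons.IH[OF adm] by auto
    have U: "energy \<gamma> ?z u \<le> 2" if "\<exists>i\<in>D. u i \<noteq> ?z i" for u
    proof -
      have "contact_potential \<gamma> ?z u \<le> 96 * (real L)\<^sup>2 * \<eta>\<^sup>2"
      proof (cases \<gamma>)
        case (Cons l' \<gamma>')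
        then have "set (fst l') \<subseteq> steps" using adm by (simp add: words_def)
        then have "contact_potential \<gamma> ?z u = 96 * (real L)\<^sup>2 * \<eta>\<^sup>2 * hit_sum \<gamma>' 1 (layer_end ?z l') u"
          using visits_zero[OF _ that] by (simp add: contact_potential_def Cons)
        also have "\<dots> \<le> 96 * (real L)\<^sup>2 * \<eta>\<^sup>2 * 1"
          using hit_sum_le[of 1 \<gamma>' "layer_end ?z l'" u] by (intro mult_left_mono) auto
        finally show ?thesis by simp
      qed (simp add: contact_potential_def)
      then have "?c * contact_potential \<gamma> ?z u \<le> ?c * (96 * (real L)\<^sup>2 * \<eta>\<^sup>2)"
        by (intro mult_left_mono) auto
      \<comment> \<open>The constant is 131 * 896 * 96. The price of a contact is of order L^2 and
        its expected number is of order \<open>L\<^sup>2 * \<eta>\<^sup>2\<close>; the product is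
        governed by the square of \<open>L\<^sup>2 * \<eta>\<close>.\<close>
      also have "\<dots> = 11268096 * ((real L)\<^sup>2 * \<eta>)\<^sup>2" by (simp add: power2_eq_square)
      also have "\<dots> \<le> 11268096 * (1 / 10000)\<^sup>2"
        using L_eta eta_pos by (intro mult_left_mono power_mono) auto
      also have "\<dots> \<le> 1" by (simp add: power2_eq_square)
      finally show ?thesis using P[of u] by simp
    qed
    have "energy (l # \<gamma>) x u \<le> 896 * real L" for u
      unfolding l by (rule energy_le_rough[OF w a G U])
    moreover have "energy (l # \<gamma>) x u \<le> 1 + ?c * contact_potential (l # \<gamma>) x u" for u
    proof -
      have "energy (l # \<gamma>) x u \<le> layer_avg (energy \<gamma> ?z) u + ?c * visits (walk_points x w) u"
        unfolding l by (rule energy_layer_step[OF w a G])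
      also have "layer_avg (energy \<gamma> ?z) u \<le> layer_avg (\<lambda>u. 1 + ?c * contact_potential \<gamma> ?z u) u"
        by (rule layer_avg_mono) (rule P)
      also have "\<dots> = 1 + ?c * layer_avg (contact_potential \<gamma> ?z) u"
        by (simp only: layer_avg_add layer_avg_const layer_avg_cmult)
      also have "?c * layer_avg (contact_potential \<gamma> ?z) u
          \<le> ?c * (96 * (real L)\<^sup>2 * \<eta>\<^sup>2 * hit_sum \<gamma> 1 ?z u)"
        by (intro mult_left_mono layer_avg_contact_potential adm) auto
      finally show ?thesis by (simp add: contact_potential_def l distrib_left)
    qed
    ultimately show ?case by blast
  qed
  then show ?thesis by blast
qed

end

section \<open>Layered paths in the lattice\<close>

definition path_word :: "layer list \<Rightarrow> step list" where
  "path_word \<gamma> = concat (map (\<lambda>l. fst l @ [(snd l, 1)]) \<gamma>)"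

lemma path_word_simps: "path_word [] = []" "path_word (l # \<gamma>) = fst l @ (snd l, 1) # path_word \<gamma>"
  by (simp_all add: path_word_def)

abbreviation path_edges :: "pos \<Rightarrow> layer list \<Rightarrow> pos set set" where
  "path_edges x \<gamma> \<equiv> walk_edges x (path_word \<gamma>)"

lemma path_edges_Cons:
  "path_edges x (l # \<gamma>) = walk_edges x (fst l) \<union> {{foldl move x (fst l), layer_end x l}} \<union> path_edges (layer_end x l) \<gamma>"
  by (simp add: path_word_simps walk_edges_append layer_end_def)

lemma prod_shared_factor_levels:
  assumes fin: "finite A'" "finite B'" "finite C'"
    and "A' \<inter> B' = {}" "A' \<inter> C' = {}" "B' \<inter> C' = {}"
    and "A' \<inter> B = {}" "A' \<inter> C = {}" "B' \<inter> A = {}" "B' \<inter> C = {}" "C' \<inter> A = {}" "C' \<inter> B = {}"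
  shows "(\<Prod>e\<in>A' \<union> B' \<union> C'. shared_factor p (A \<union> B \<union> C) e)
    = (\<Prod>e\<in>A'. shared_factor p A e) * (\<Prod>e\<in>B'. shared_factor p B e) * (\<Prod>e\<in>C'. shared_factor p C e)"
proof -
  have "(\<Prod>e\<in>A' \<union> B' \<union> C'. shared_factor p (A \<union> B \<union> C) e)
    = (\<Prod>e\<in>A'. shared_factor p (A \<union> B \<union> C) e) * (\<Prod>e\<in>B'. shared_factor p (A \<union> B \<union> C) e)
      * (\<Prod>e\<in>C'. shared_factor p (A \<union> B \<union> C) e)"
    using prod.union_disjoint[of "A' \<union> B'" C' "shared_factor p (A \<union> B \<union> C)"]
      prod.union_disjoint[of A' B' "shared_factor p (A \<union> B \<union> C)"] assms(1-6)
    by (simp add: Int_Un_distrib2)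
  moreover have "(\<Prod>e\<in>A'. shared_factor p (A \<union> B \<union> C) e) = (\<Prod>e\<in>A'. shared_factor p A e)"
    using assms(7,8) by (intro prod.cong refl) (auto simp: shared_factor_def)
  moreover have "(\<Prod>e\<in>B'. shared_factor p (A \<union> B \<union> C) e) = (\<Prod>e\<in>B'. shared_factor p B e)"
    using assms(9,10) by (intro prod.cong refl) (auto simp: shared_factor_def)
  moreover have "(\<Prod>e\<in>C'. shared_factor p (A \<union> B \<union> C) e) = (\<Prod>e\<in>C'. shared_factor p C e)"
    using assms(11,12) by (intro prod.cong refl) (auto simp: shared_factor_def)
  ultimately show ?thesis by simp
qed

lemma move_lattice:
  assumes "x \<in> lattice d" "fst s \<in> {1..d}"
  shows "move x s \<in> lattice d"
  using assms by (auto simp: lattice_def move_def)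

lemma move_axis_edge:
  assumes "x \<in> lattice d" "snd s = 1 \<or> snd s = -1"
  shows "{x, move x s} \<in> axis_edges d (fst s)"
proof -
  have "move x s = (\<lambda>j. x j + canonical_vec (fst s) j) \<or> move x s = (\<lambda>j. x j - canonical_vec (fst s) j)"
    using assms(2) by (auto simp: move_def canonical_vec_def fun_eq_iff)
  then show ?thesis using assms(1) unfolding axis_edges_def by blast
qed

lemma walk_edges_lattice:
  assumes "x \<in> lattice d" "set w \<subseteq> {1..d} \<times> {1, -1}" "e \<in> walk_edges x w"
  shows "\<exists>s\<in>set w. e \<in> lattice_edges d \<and> edge_param d p e = p (fst s) \<and> edge_weight p e = p (fst s)"
  using assms
proof (induction w arbitrary: x)
  case (Cons s w)
  from Cons.prems have s: "fst s \<in> {1..d}" "snd s = 1 \<or> snd s = -1" by auto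
  show ?case
  proof (cases "e = {x, move x s}")
    case True
    have ax: "e \<in> axis_edges d (fst s)"
      unfolding True by (rule move_axis_edge[OF Cons.prems(1) s(2)])
    then have "e \<in> lattice_edges d" using s(1) by (auto simp: lattice_edges_def)
    moreover have "edge_param d p e = p (fst s)" by (rule edge_param_eq[OF s(1) ax])
    moreover have "edge_weight p e = p (fst s)" unfolding True using s(2) by (intro edge_weight_move) auto
    ultimately show ?thesis by auto
  next
    case False
    then have "\<exists>s\<in>set w. e \<in> lattice_edges d \<and> edge_param d p e = p (fst s) \<and> edge_weight p e = p (fst s)"
      using Cons.prems s by (intro Cons.IH[of "move x s"] move_lattice) auto
    then show ?thesis by auto
  qed
qed simp

lemma foldl_move_lattice:
  "x \<in> lattice d \<Longrightarrow> set w \<subseteq> {1..d} \<times> {1, -1} \<Longrightarrow> foldl move x w \<in> lattice d"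
proof (induction w arbitrary: x)
  case (Cons s w)
  then have "move x s \<in> lattice d" by (intro move_lattice) auto
  with Cons show ?case by auto
qed simp

lemma open_walk_connected:
  assumes "\<And>e. e \<in> walk_edges x w \<Longrightarrow> e \<in> lattice_edges d \<and> \<omega> e"
  shows "connected_by d \<omega> x (foldl move x w)"
  unfolding connected_by_def
proof (intro exI conjI ballI)
  let ?v = "\<lambda>i. foldl move x (take i w)"
  show "?v 0 = x" "?v (length w) = foldl move x w" by auto
  fix j assume j: "j \<in> {1..length w}"
  then have "{?v (j - 1), ?v j} \<in> walk_edges x w"
    unfolding walk_edges_conv by (intro CollectI exI[of _ "j - 1"]) auto
  with assms show "{?v (j - 1), ?v j} \<in> lattice_edges d" "\<omega> {?v (j - 1), ?v j}" by auto
qed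

context layer_law begin

definition layers :: "layer set" where
  "layers = words (L + 2) \<times> D"

definition paths :: "nat \<Rightarrow> layer list set" where
  "paths n = {\<gamma>. set \<gamma> \<subseteq> layers \<and> length \<gamma> = n}"

primrec path_prob :: "pos \<Rightarrow> layer list \<Rightarrow> real" where
  "path_prob u [] = 1"
| "path_prob u (l # \<gamma>) = section_prob u (fst l) * lam (snd l) * path_prob (layer_end u l) \<gamma>"

text \<open>The sum of all \<open>D\<close>-coordinates: constant on a section and raised by one by
  each \<open>D\<close>-step, so it tells the layers apart.\<close>

abbreviation height :: "pos \<Rightarrow> int" where
  "height \<equiv> bit_count (\<lambda>_. True)"

lemma finite_layers: "finite layers"
  by (simp add: layers_def finite_words finite_D)

lemma finite_paths: "finite (paths n)"
  unfolding paths_def by (rule finite_lists_length_eq[OF finite_layers])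

lemma sum_layers: "(\<Sum>l\<in>layers. g l) = (\<Sum>w\<in>words (L + 2). \<Sum>a\<in>D. g (w, a))"
  unfolding layers_def by (rule sum.cartesian_product')

lemma paths_0: "paths 0 = {[]}"
  by (auto simp: paths_def)

lemma sum_paths_Suc: "(\<Sum>\<gamma>\<in>paths (Suc n). g \<gamma>) = (\<Sum>l\<in>layers. \<Sum>\<gamma>\<in>paths n. g (l # \<gamma>))"
proof -
  have "paths (Suc n) = (\<lambda>(l, \<gamma>). l # \<gamma>) ` (layers \<times> paths n)"
    by (force simp: paths_def length_Suc_conv)
  then have "(\<Sum>\<gamma>\<in>paths (Suc n). g \<gamma>) = (\<Sum>(l, \<gamma>)\<in>layers \<times> paths n. g (l # \<gamma>))"
    by (simp add: sum.reindex inj_on_def split_beta)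
  then show ?thesis by (simp add: sum.cartesian_product)
qed

lemma sum_path_prob: "(\<Sum>\<gamma>\<in>paths n. path_prob u \<gamma>) = 1"
proof (induction n arbitrary: u)
  case (Suc n)
  have "(\<Sum>\<gamma>\<in>paths (Suc n). path_prob u \<gamma>) = (\<Sum>w\<in>words (L + 2). \<Sum>a\<in>D. section_prob u w * lam a)"
    unfolding sum_paths_Suc sum_layers path_prob.simps fst_conv snd_conv
    by (simp only: sum_distrib_left[symmetric] Suc mult_1_right)
  also have "\<dots> = 1"
    by (simp only: sum_distrib_left[symmetric] sum_lam mult_1_right sum_section)
  finally show ?case .
qed (simp add: paths_0)

lemma path_prob_nonneg: "set \<gamma> \<subseteq> layers \<Longrightarrow> 0 \<le> path_prob u \<gamma>"
proof (induction \<gamma> arbitrary: u)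
  case (Cons l \<gamma>)
  then have "fst l \<in> words (L + 2)" "snd l \<in> D" by (auto simp: layers_def)
  with Cons section_prob_nonneg[of "fst l" "L + 2" u] lam_pos[of "snd l"] show ?case by simp
qed simp

lemma path_prob_admissible: "set \<gamma> \<subseteq> layers \<Longrightarrow> path_prob u \<gamma> \<noteq> 0 \<Longrightarrow> admissible u \<gamma>"
proof (induction \<gamma> arbitrary: u)
  case (Cons l \<gamma>)
  then have "fst l \<in> words (L + 2)" "snd l \<in> D" by (auto simp: layers_def)
  with Cons show ?case by (auto simp: section_prob_def split: if_splits)
qed simp

lemma height_layer_end: "l \<in> layers \<Longrightarrow> height (layer_end u l) = height u + 1"
  by (auto simp: layer_end_def layers_def words_def bit_count_D_step bit_count_word)

lemma walk_edges_height:
  "set w \<subseteq> steps \<Longrightarrow> e \<in> walk_edges u w \<Longrightarrow> e \<noteq> {} \<and> (\<forall>y\<in>e. height y = height u)"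
  by (induction w arbitrary: u) (auto simp: bit_count_step)

lemma path_edges_height:
  "set \<gamma> \<subseteq> layers \<Longrightarrow> e \<in> path_edges u \<gamma> \<Longrightarrow> e \<noteq> {} \<and> (\<forall>y\<in>e. height u \<le> height y)"
proof (induction \<gamma> arbitrary: u)
  case (Cons l \<gamma>)
  from Cons.prems have l: "l \<in> layers" "set (fst l) \<subseteq> steps" by (auto simp: layers_def words_def)
  have le: "height (layer_end u l) = height u + 1" by (rule height_layer_end[OF l(1)])
  consider "e \<in> walk_edges u (fst l)" | "e = {foldl move u (fst l), layer_end u l}"
    | "e \<in> path_edges (layer_end u l) \<gamma>"
    using Cons.prems(2) unfolding path_edges_Cons by blast
  then show ?case
  proof cases
    case 1
    then show ?thesis using walk_edges_height[OF l(2)] by auto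
  next
    case 2
    then show ?thesis using le bit_count_word[OF l(2)] by auto
  next
    case 3
    then show ?thesis using Cons.IH[of "layer_end u l"] Cons.prems(1) le by fastforce
  qed
qed (simp add: path_word_simps)

text \<open>Heights separate three kinds of edges: those of the section stay at the initial height,
  the \<open>D\<close>-step joins it to the next height, and all later edges lie at that height or
  above. So only edges of the same kind can be shared.\<close>

lemma shared_product_Cons:
  assumes l: "l \<in> layers" and l': "l' \<in> layers" and \<gamma>: "set \<gamma> \<subseteq> layers" and \<gamma>': "set \<gamma>' \<subseteq> layers"
    and h: "height x = height u"
  shows "(\<Prod>e\<in>path_edges u (l' # \<gamma>'). shared_factor p (path_edges x (l # \<gamma>)) e)
    = (\<Prod>e\<in>walk_edges u (fst l'). shared_factor p (walk_edges x (fst l)) e) *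
      (if foldl move u (fst l') = foldl move x (fst l) \<and> snd l' = snd l then 1 / p (snd l') else 1) *
      (\<Prod>e\<in>path_edges (layer_end u l') \<gamma>'. shared_factor p (path_edges (layer_end x l) \<gamma>) e)"
proof -
  let ?b = "{foldl move x (fst l), layer_end x l}" and ?c = "{foldl move u (fst l'), layer_end u l'}"
  have s: "set (fst l) \<subseteq> steps" "set (fst l') \<subseteq> steps" using l l' by (auto simp: layers_def words_def)
  have hA: "e \<noteq> {} \<and> (\<forall>y\<in>e. height y = height u)" if "e \<in> walk_edges x (fst l) \<or> e \<in> walk_edges u (fst l')" for e
    using that walk_edges_height[OF s(1), of e x] walk_edges_height[OF s(2), of e u] h by auto
  have hb: "height (foldl move x (fst l)) = height u" "height (foldl move u (fst l')) = height u"
    "height (layer_end x l) = height u + 1" "height (layer_end u l') = height u + 1"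
    using bit_count_word[OF s(1)] bit_count_word[OF s(2)] height_layer_end[OF l] height_layer_end[OF l'] h by auto
  have hC: "e \<noteq> {} \<and> (\<forall>y\<in>e. height u + 1 \<le> height y)"
    if "e \<in> path_edges (layer_end x l) \<gamma> \<or> e \<in> path_edges (layer_end u l') \<gamma>'" for e
    using that path_edges_height[OF \<gamma>, of e "layer_end x l"] path_edges_height[OF \<gamma>', of e "layer_end u l'"] hb by auto
  have AB: "e \<noteq> ?b" "e \<noteq> ?c" if "e \<in> walk_edges x (fst l) \<or> e \<in> walk_edges u (fst l')" for e
    using hA[OF that] hb by auto
  have CB: "e \<noteq> ?b" "e \<noteq> ?c" if "e \<in> path_edges (layer_end x l) \<gamma> \<or> e \<in> path_edges (layer_end u l') \<gamma>'" for e
    using hC[OF that] hb by auto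
  have AC: False if "e \<in> walk_edges x (fst l) \<or> e \<in> walk_edges u (fst l')"
    "e \<in> path_edges (layer_end x l) \<gamma> \<or> e \<in> path_edges (layer_end u l') \<gamma>'" for e
    using hA[OF that(1)] hC[OF that(2)] by fastforce
  have "(\<Prod>e\<in>path_edges u (l' # \<gamma>'). shared_factor p (path_edges x (l # \<gamma>)) e)
    = (\<Prod>e\<in>walk_edges u (fst l'). shared_factor p (walk_edges x (fst l)) e) *
      (\<Prod>e\<in>{?c}. shared_factor p {?b} e) *
      (\<Prod>e\<in>path_edges (layer_end u l') \<gamma>'. shared_factor p (path_edges (layer_end x l) \<gamma>) e)"
    unfolding path_edges_Cons
    by (intro prod_shared_factor_levels finite_walk_edges) (use AB CB AC in blast)+
  also have "(\<Prod>e\<in>{?c}. shared_factor p {?b} e)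
    = (if foldl move u (fst l') = foldl move x (fst l) \<and> snd l' = snd l then 1 / p (snd l') else 1)"
  proof -
    have ew: "edge_weight p ?c = p (snd l')"
      unfolding layer_end_def by (subst edge_weight_move) auto
    \<comment> \<open>The endpoints have different heights, so equal edges are also equally
      oriented.\<close>
    have iff: "?c = ?b \<longleftrightarrow> foldl move u (fst l') = foldl move x (fst l) \<and> snd l' = snd l"
    proof
      assume "?c = ?b"
      then have *: "foldl move u (fst l') = foldl move x (fst l)" "layer_end u l' = layer_end x l"
        using hb by (auto simp: doubleton_eq_iff)
      then have "(snd l', 1) = (snd l, 1::int)"
        by (intro move_inj[of _ "foldl move x (fst l)"]) (auto simp: layer_end_def)
      with * show "foldl move u (fst l') = foldl move x (fst l) \<and> snd l' = snd l" by simp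
    qed (simp add: layer_end_def)
    have "(\<Prod>e\<in>{?c}. shared_factor p {?b} e) = shared_factor p {?b} ?c" by simp
    then show ?thesis unfolding shared_factor_def singleton_iff iff ew .
  qed
  finally show ?thesis .
qed

lemma sum_path_prob_shared:
  assumes "set \<gamma> \<subseteq> layers" "height x = height u"
  shows "(\<Sum>\<gamma>'\<in>paths (length \<gamma>). path_prob u \<gamma>' * (\<Prod>e\<in>path_edges u \<gamma>'. shared_factor p (path_edges x \<gamma>) e))
    = energy \<gamma> x u"
  using assms
proof (induction \<gamma> arbitrary: x u)
  case Nil
  then show ?case by (simp add: paths_0 path_word_simps)
next
  case (Cons l \<gamma>)
  let ?s = "\<lambda>u l'. (\<Prod>e\<in>walk_edges u (fst l'). shared_factor p (walk_edges x (fst l)) e) *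
      (if foldl move u (fst l') = foldl move x (fst l) \<and> snd l' = snd l then 1 / p (snd l') else 1)"
  have l: "l \<in> layers" "set \<gamma> \<subseteq> layers" using Cons.prems by auto
  have "(\<Sum>\<gamma>'\<in>paths (length (l # \<gamma>)). path_prob u \<gamma>' * (\<Prod>e\<in>path_edges u \<gamma>'. shared_factor p (path_edges x (l # \<gamma>)) e))
    = (\<Sum>l'\<in>layers. \<Sum>\<gamma>'\<in>paths (length \<gamma>). section_prob u (fst l') * lam (snd l') * ?s u l' *
        (path_prob (layer_end u l') \<gamma>' * (\<Prod>e\<in>path_edges (layer_end u l') \<gamma>'. shared_factor p (path_edges (layer_end x l) \<gamma>) e)))"
    unfolding list.size add_0_right add_Suc_right sum_paths_Suc
  proof (intro sum.cong refl)
    fix l' \<gamma>' assume "l' \<in> layers" "\<gamma>' \<in> paths (length \<gamma>)"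
    then have "l' \<in> layers" "set \<gamma>' \<subseteq> layers" by (auto simp: paths_def)
    then show "path_prob u (l' # \<gamma>') * (\<Prod>e\<in>path_edges u (l' # \<gamma>'). shared_factor p (path_edges x (l # \<gamma>)) e)
      = section_prob u (fst l') * lam (snd l') * ?s u l' *
        (path_prob (layer_end u l') \<gamma>' * (\<Prod>e\<in>path_edges (layer_end u l') \<gamma>'. shared_factor p (path_edges (layer_end x l) \<gamma>) e))"
      using Cons.prems by (simp only: shared_product_Cons[OF l(1) _ l(2) _ Cons.prems(2)] path_prob.simps mult_ac)
  qed
  also have "\<dots> = (\<Sum>l'\<in>layers. section_prob u (fst l') * lam (snd l') * ?s u l' * energy \<gamma> (layer_end x l) (layer_end u l'))"
    unfolding sum_distrib_left[symmetric]
    by (intro sum.cong refl arg_cong2[of _ _ _ _ "(*)"] Cons.IH)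
      (auto simp: l height_layer_end Cons.prems(2))
  also have "\<dots> = energy (l # \<gamma>) x u"
    unfolding sum_layers energy.simps by (simp only: fst_conv snd_conv mult.assoc)
  finally show ?case .
qed

end

section \<open>Positive percolation probability\<close>

locale percolation_law = layer_law +
  fixes d :: nat
  assumes J_d: "J \<subseteq> {1..d}" and D_d: "D \<subseteq> {1..d}"
    and p_le: "\<And>i. i \<in> {1..d} \<Longrightarrow> p i \<le> 1"
begin

abbreviation origin :: pos where "origin \<equiv> \<lambda>_. 0"

abbreviation perc :: "((nat \<Rightarrow> int) set \<Rightarrow> bool) measure" where "perc \<equiv> percolation d p"

definition open_path :: "layer list \<Rightarrow> ((nat \<Rightarrow> int) set \<Rightarrow> bool) set" where
  "open_path \<gamma> = {\<omega> \<in> space perc. \<forall>e\<in>path_edges origin \<gamma>. \<omega> e}"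

definition reaches :: "nat \<Rightarrow> ((nat \<Rightarrow> int) set \<Rightarrow> bool) set" where
  "reaches n = {\<omega> \<in> space perc. \<exists>y\<in>lattice d. int n \<le> height y \<and> connected_by d \<omega> origin y}"

lemma path_word_subset: "set \<gamma> \<subseteq> layers \<Longrightarrow> set (path_word \<gamma>) \<subseteq> (J \<union> D) \<times> {1, -1}"
  by (induction \<gamma>) (fastforce simp: path_word_simps layers_def words_def steps_def)+

lemma path_word_subset': "set \<gamma> \<subseteq> layers \<Longrightarrow> set (path_word \<gamma>) \<subseteq> {1..d} \<times> {1, -1}"
  using path_word_subset[of \<gamma>] J_d D_d by auto

lemma origin_lattice: "origin \<in> lattice d"
  by (simp add: lattice_def)

lemma path_edges_props:
  assumes "set \<gamma> \<subseteq> layers" "e \<in> path_edges origin \<gamma>"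
  shows "e \<in> lattice_edges d" "edge_param d p e = edge_weight p e"
    "0 < edge_weight p e" "edge_weight p e \<le> 1"
proof -
  obtain s where s: "s \<in> set (path_word \<gamma>)" "e \<in> lattice_edges d" "edge_param d p e = p (fst s)"
    "edge_weight p e = p (fst s)"
    using walk_edges_lattice[OF origin_lattice path_word_subset'[OF assms(1)] assms(2)] by blast
  then show "e \<in> lattice_edges d" "edge_param d p e = edge_weight p e" by auto
  have "fst s \<in> J \<union> D" using s(1) path_word_subset[OF assms(1)] by auto
  then show "0 < edge_weight p e" "edge_weight p e \<le> 1"
    using s(4) p_pos D_pos p_le J_d D_d by auto
qed

lemma finite_path_edges: "finite (path_edges x \<gamma>)"
  by (rule finite_walk_edges)

lemma open_edges:
  assumes "F \<subseteq> path_edges origin \<gamma> \<union> path_edges origin \<gamma>'" "set \<gamma> \<subseteq> layers" "set \<gamma>' \<subseteq> layers"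
  shows "{\<omega> \<in> space perc. \<forall>e\<in>F. \<omega> e} \<in> sets perc"
    and "measure perc {\<omega> \<in> space perc. \<forall>e\<in>F. \<omega> e} = (\<Prod>e\<in>F. edge_weight p e)"
proof -
  have fin: "finite F" using assms(1) finite_path_edges by (meson finite_UnI finite_subset)
  have props: "e \<in> lattice_edges d \<and> edge_param d p e = edge_weight p e \<and>
      0 < edge_weight p e \<and> edge_weight p e \<le> 1" if "e \<in> F" for e
    using that assms path_edges_props[of \<gamma> e] path_edges_props[of \<gamma>' e] by blast
  have sub: "F \<subseteq> lattice_edges d" using props by blast
  have ep: "0 \<le> edge_param d p e \<and> edge_param d p e \<le> 1" if "e \<in> F" for e
    using props[OF that] by simp
  show "{\<omega> \<in> space perc. \<forall>e\<in>F. \<omega> e} \<in> sets perc"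
    by (rule measure_percolation_open(1)[OF fin sub ep])
  have "measure perc {\<omega> \<in> space perc. \<forall>e\<in>F. \<omega> e} = (\<Prod>e\<in>F. edge_param d p e)"
    by (rule measure_percolation_open(2)[OF fin sub ep])
  also have "\<dots> = (\<Prod>e\<in>F. edge_weight p e)"
    using props by (intro prod.cong) auto
  finally show "measure perc {\<omega> \<in> space perc. \<forall>e\<in>F. \<omega> e} = (\<Prod>e\<in>F. edge_weight p e)" .
qed

lemma measure_reaches_ge: "1 / (896 * real L) \<le> measure perc (\<Union>\<gamma>\<in>paths n. open_path \<gamma>)"
proof -
  interpret P: prob_space perc by (rule prob_space_percolation)
  define Q where "Q \<gamma> = (\<Prod>e\<in>path_edges origin \<gamma>. edge_weight p e)" for \<gamma>
  have sub: "set \<gamma> \<subseteq> layers" if "\<gamma> \<in> paths n" for \<gamma> using that by (simp add: paths_def)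
  have Q: "0 < Q \<gamma>" if "\<gamma> \<in> paths n" for \<gamma>
    unfolding Q_def using path_edges_props(3)[OF sub[OF that]] by (intro prod_pos) auto
  have ev: "open_path \<gamma> \<in> sets perc" and pr: "measure perc (open_path \<gamma>) = Q \<gamma>" if "\<gamma> \<in> paths n" for \<gamma>
    using open_edges[of "path_edges origin \<gamma>" \<gamma> \<gamma>] sub[OF that] by (auto simp: open_path_def Q_def)
  have pair: "measure perc (open_path \<gamma> \<inter> open_path \<gamma>')
      = Q \<gamma> * Q \<gamma>' * (\<Prod>e\<in>path_edges origin \<gamma>'. shared_factor p (path_edges origin \<gamma>) e)"
    if "\<gamma> \<in> paths n" "\<gamma>' \<in> paths n" for \<gamma> \<gamma>'
  proof -
    let ?E = "path_edges origin \<gamma>" and ?E' = "path_edges origin \<gamma>'"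
    have "open_path \<gamma> \<inter> open_path \<gamma>' = {\<omega> \<in> space perc. \<forall>e\<in>?E \<union> ?E'. \<omega> e}"
      by (auto simp: open_path_def)
    then have 1: "measure perc (open_path \<gamma> \<inter> open_path \<gamma>') = (\<Prod>e\<in>?E \<union> ?E'. edge_weight p e)"
      using open_edges(2)[of "?E \<union> ?E'" \<gamma> \<gamma>'] sub that by simp
    have 2: "(\<Prod>e\<in>?E \<union> ?E'. edge_weight p e) * (\<Prod>e\<in>?E \<inter> ?E'. edge_weight p e) = Q \<gamma> * Q \<gamma>'"
      unfolding Q_def by (rule prod.union_inter) (rule finite_path_edges)+
    have 3: "(\<Prod>e\<in>?E'. shared_factor p ?E e) = (\<Prod>e\<in>?E \<inter> ?E'. 1 / edge_weight p e)"
    proof -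
      have "(\<Prod>e\<in>?E'. shared_factor p ?E e) = (\<Prod>e\<in>?E' \<inter> ?E. 1 / edge_weight p e)"
        unfolding shared_factor_def
        by (rule prod.inter_restrict[symmetric]) (rule finite_path_edges)
      then show ?thesis by (simp only: Int_commute)
    qed
    have 4: "(\<Prod>e\<in>?E \<inter> ?E'. 1 / edge_weight p e) * (\<Prod>e\<in>?E \<inter> ?E'. edge_weight p e) = 1"
      unfolding prod.distrib[symmetric]
    proof (rule prod.neutral, rule ballI)
      fix e assume "e \<in> ?E \<inter> ?E'"
      then have "0 < edge_weight p e" using path_edges_props(3)[OF sub[OF that(1)]] by blast
      then show "1 / edge_weight p e * edge_weight p e = 1" by simp
    qed
    show ?thesis unfolding 1 2[symmetric] 3 mult.assoc using 4 by (simp only: mult.commute mult_1_left)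
  qed
  have "1 / (896 * real L) \<le> P.prob (\<Union>\<gamma>\<in>paths n. open_path \<gamma>)"
  \<comment> \<open>Dividing the path weight by the probability that the path is open makes the
    first moment 1 and turns the second moment into an average of energies.\<close>
  proof (rule P.second_moment_union[OF finite_paths ev, where c="\<lambda>\<gamma>. path_prob origin \<gamma> / Q \<gamma>"])
    have "(\<Sum>\<gamma>\<in>paths n. path_prob origin \<gamma> / Q \<gamma> * P.prob (open_path \<gamma>)) = (\<Sum>\<gamma>\<in>paths n. path_prob origin \<gamma>)"
    proof (rule sum.cong[OF refl])
      fix \<gamma> assume g: "\<gamma> \<in> paths n"
      show "path_prob origin \<gamma> / Q \<gamma> * P.prob (open_path \<gamma>) = path_prob origin \<gamma>"
        using Q[OF g] by (simp add: pr[OF g])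
    qed
    then show "(\<Sum>\<gamma>\<in>paths n. path_prob origin \<gamma> / Q \<gamma> * P.prob (open_path \<gamma>)) = 1"
      by (simp add: sum_path_prob)
    have "(\<Sum>\<gamma>\<in>paths n. \<Sum>\<gamma>'\<in>paths n. path_prob origin \<gamma> / Q \<gamma> * (path_prob origin \<gamma>' / Q \<gamma>') *
        P.prob (open_path \<gamma> \<inter> open_path \<gamma>'))
      = (\<Sum>\<gamma>\<in>paths n. path_prob origin \<gamma> * energy \<gamma> origin origin)"
    proof (rule sum.cong[OF refl])
      fix \<gamma> assume g: "\<gamma> \<in> paths n"
      have "(\<Sum>\<gamma>'\<in>paths n. path_prob origin \<gamma> / Q \<gamma> * (path_prob origin \<gamma>' / Q \<gamma>') *
          P.prob (open_path \<gamma> \<inter> open_path \<gamma>'))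
        = (\<Sum>\<gamma>'\<in>paths n. path_prob origin \<gamma> * (path_prob origin \<gamma>' *
          (\<Prod>e\<in>path_edges origin \<gamma>'. shared_factor p (path_edges origin \<gamma>) e)))"
      proof (rule sum.cong[OF refl])
        fix \<gamma>' assume g': "\<gamma>' \<in> paths n"
        show "path_prob origin \<gamma> / Q \<gamma> * (path_prob origin \<gamma>' / Q \<gamma>') * P.prob (open_path \<gamma> \<inter> open_path \<gamma>')
          = path_prob origin \<gamma> * (path_prob origin \<gamma>' *
          (\<Prod>e\<in>path_edges origin \<gamma>'. shared_factor p (path_edges origin \<gamma>) e))"
          unfolding pair[OF g g'] using Q[OF g] Q[OF g'] by simp
      qed
      also have "\<dots> = path_prob origin \<gamma> * energy \<gamma> origin origin"
        using sum_path_prob_shared[OF sub[OF g], of origin origin] g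
        by (simp add: sum_distrib_left[symmetric] paths_def)
      finally show "(\<Sum>\<gamma>'\<in>paths n. path_prob origin \<gamma> / Q \<gamma> * (path_prob origin \<gamma>' / Q \<gamma>') *
          P.prob (open_path \<gamma> \<inter> open_path \<gamma>')) = path_prob origin \<gamma> * energy \<gamma> origin origin" .
    qed
    also have "\<dots> \<le> (\<Sum>\<gamma>\<in>paths n. path_prob origin \<gamma> * (896 * real L))"
    proof (rule sum_mono)
      fix \<gamma> assume g: "\<gamma> \<in> paths n"
      show "path_prob origin \<gamma> * energy \<gamma> origin origin \<le> path_prob origin \<gamma> * (896 * real L)"
      \<comment> \<open>The energy bound requires self-avoiding sections, which every path of
        positive weight has.\<close>
      proof (cases "path_prob origin \<gamma> = 0")
        case False
        then show ?thesis
          using path_prob_admissible[OF sub[OF g]] path_prob_nonneg[OF sub[OF g]]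
          by (intro mult_left_mono energy_le) auto
      qed simp
    qed
    also have "\<dots> = 896 * real L"
      by (simp only: sum_distrib_right[symmetric] sum_path_prob mult_1_left)
    finally show "(\<Sum>\<gamma>\<in>paths n. \<Sum>\<gamma>'\<in>paths n. path_prob origin \<gamma> / Q \<gamma> * (path_prob origin \<gamma>' / Q \<gamma>') *
        P.prob (open_path \<gamma> \<inter> open_path \<gamma>')) \<le> 896 * real L" .
    show "0 < 896 * real L" using L by simp
  qed
  then show ?thesis .
qed

lemma height_path: "set \<gamma> \<subseteq> layers \<Longrightarrow> height (foldl move x (path_word \<gamma>)) = height x + int (length \<gamma>)"
proof (induction \<gamma> arbitrary: x)
  case (Cons l \<gamma>)
  then have "height (foldl move (layer_end x l) (path_word \<gamma>)) = height (layer_end x l) + int (length \<gamma>)"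
    by simp
  moreover have "height (layer_end x l) = height x + 1" using Cons.prems by (intro height_layer_end) simp
  ultimately show ?case by (simp add: path_word_simps layer_end_def)
qed (simp add: path_word_simps)

lemma open_path_reaches: "\<gamma> \<in> paths n \<Longrightarrow> open_path \<gamma> \<subseteq> reaches n"
proof
  fix \<omega> assume g: "\<gamma> \<in> paths n" and \<omega>: "\<omega> \<in> open_path \<gamma>"
  have sub: "set \<gamma> \<subseteq> layers" and len: "length \<gamma> = n" using g by (auto simp: paths_def)
  let ?y = "foldl move origin (path_word \<gamma>)"
  have "?y \<in> lattice d"
    by (rule foldl_move_lattice[OF origin_lattice path_word_subset'[OF sub]])
  moreover have "int n \<le> height ?y"
    using height_path[OF sub, of origin] len by (simp add: bit_count_def)
  moreover have "connected_by d \<omega> origin ?y"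
    using \<omega> path_edges_props(1)[OF sub] by (intro open_walk_connected) (auto simp: open_path_def)
  ultimately show "\<omega> \<in> reaches n"
    using \<omega> by (auto simp: reaches_def open_path_def)
qed

lemma sets_reaches: "reaches n \<in> sets perc"
proof -
  have "reaches n = {\<omega> \<in> space perc. \<exists>y\<in>{y \<in> lattice d. int n \<le> height y}. connected_by d \<omega> origin y}"
    by (auto simp: reaches_def)
  also have "\<dots> \<in> sets perc"
    by (intro sets.sets_Collect_countable_Ex' measurable_connected_by countable_subset[OF _ countable_lattice]) auto
  finally show ?thesis .
qed

lemma theta_pos: "0 < theta d p"
proof -
  interpret P: prob_space perc by (rule prob_space_percolation)
  let ?I = "{\<omega> \<in> space perc. infinite (origin_cluster d \<omega>)}"
  have ge: "1 / (896 * real L) \<le> measure perc (reaches n)" for n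
  proof -
    have "measure perc (\<Union>\<gamma>\<in>paths n. open_path \<gamma>) \<le> measure perc (reaches n)"
      by (rule P.finite_measure_mono) (use open_path_reaches sets_reaches in auto)
    then show ?thesis using measure_reaches_ge[of n] by simp
  qed
  \<comment> \<open>The lower bound does not depend on \<open>n\<close>, so it survives the
    decreasing limit. A cluster of unbounded height is infinite.\<close>
  have "decseq reaches"
    unfolding decseq_def by (force simp: reaches_def)
  then have "(\<lambda>n. measure perc (reaches n)) \<longlonglongrightarrow> measure perc (\<Inter>n. reaches n)"
    using sets_reaches by (intro P.finite_Lim_measure_decseq) auto
  then have "1 / (896 * real L) \<le> measure perc (\<Inter>n. reaches n)"
    by (rule LIMSEQ_le_const) (use ge in auto)
  also have "\<dots> \<le> measure perc ?I"
  proof (rule P.finite_measure_mono)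
    show "(\<Inter>n. reaches n) \<subseteq> ?I"
    proof
      fix \<omega> assume \<omega>: "\<omega> \<in> (\<Inter>n. reaches n)"
      have "infinite (origin_cluster d \<omega>)"
      proof
        assume fin: "finite (origin_cluster d \<omega>)"
        define m where "m = Max (height ` origin_cluster d \<omega>)"
        have "\<omega> \<in> reaches (nat m + 1)" using \<omega> by blast
        then obtain y where y: "y \<in> lattice d" "int (nat m + 1) \<le> height y" "connected_by d \<omega> origin y"
          by (auto simp: reaches_def)
        then have "height y \<in> height ` origin_cluster d \<omega>" by (auto simp: origin_cluster_def)
        then have "height y \<le> m" unfolding m_def using fin by (intro Max_ge) auto
        then show False using y(2) by linarith
      qed
      moreover have "\<omega> \<in> space perc" using \<omega> by (auto simp: reaches_def)
      ultimately show "\<omega> \<in> ?I" by simp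
    qed
  qed (rule measurable_infinite_cluster)
  finally have "1 / (896 * real L) \<le> theta d p" by (simp add: theta_def)
  moreover have "0 < 1 / (896 * real L)" using L by simp
  ultimately show ?thesis by linarith
qed

end

section \<open>Choice of the groups, of the walk length and of the constants\<close>

theorem theorem1:
  "\<exists>C::real. C > 0 \<and>
     (\<forall>(d::nat) (p::nat \<Rightarrow> real).
        2 \<le> d \<longrightarrow>
        (\<forall>i\<in>{1..d}. 0 \<le> p i \<and> p i < 1) \<longrightarrow>
        delta d p > 0 \<longrightarrow>
        Max (p ` {1..d}) \<le> C * (delta d p)\<^sup>2 \<longrightarrow>
        theta d p > 0)"
proof (intro exI[of _ "1 / 10 ^ 24 :: real"] conjI allI impI)
  show "(0::real) < 1 / 10 ^ 24" by simp
next
  fix d :: nat and p :: "nat \<Rightarrow> real"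
  assume d: "2 \<le> d" and p01: "\<forall>i\<in>{1..d}. 0 \<le> p i \<and> p i < 1" and \<delta>0: "delta d p > 0"
    and Max_le: "Max (p ` {1..d}) \<le> 1 / 10 ^ 24 * (delta d p)\<^sup>2"
  define \<delta> where "\<delta> = delta d p"
  define M where "M = Max (p ` {1..d})"
  \<comment> \<open>Sixteen groups of sum at most \<open>\<rho> + M \<le> 2 * \<rho>\<close> use at
    most half of the surplus \<delta>; the other half stays with \<open>J\<close>.\<close>
  define \<rho> where "\<rho> = \<delta> / 64"
  \<comment> \<open>Directions of parameter 0 are dropped because shared edges are weighted by
    \<open>1 / p\<close>.\<close>
  define I where "I = {i \<in> {1..d}. 0 < p i}"
  have \<delta>: "0 < \<delta>" using \<delta>0 by (simp add: \<delta>_def)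
  have M: "p i \<le> M" if "i \<in> {1..d}" for i unfolding M_def using that by (intro Max_ge) auto
  have one: "1 \<in> {1..d}" using d by simp
  have M0: "0 \<le> M" using M[OF one] p01 one by (meson order_trans)
  have M1: "M \<le> 1"
    unfolding M_def using p01 d by (subst Max_le_iff) (auto intro: less_imp_le)
  have M2: "M \<le> 1 / 10 ^ 24 * \<delta>\<^sup>2" using Max_le by (simp add: M_def \<delta>_def)
  \<comment> \<open>\<delta> can be large, since the dimension is arbitrary, and then the quadratic
    hypothesis says little. But \<open>M \<le> 1\<close> gives \<open>M\<^sup>2 \<le> M\<close>, so
    taking roots yields a linear bound.\<close>
  have Mlin: "M \<le> 1 / 10 ^ 12 * \<delta>"
  proof -
    have "M\<^sup>2 \<le> M * 1" unfolding power2_eq_square using M1 M0 by (rule mult_left_mono)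
    also have "M * 1 \<le> (1 / 10 ^ 12 * \<delta>)\<^sup>2" using M2 by (simp add: power_mult_distrib power_divide)
    finally show ?thesis using \<delta> by (simp add: power2_le_iff_abs_le)
  qed
  have M\<rho>: "M \<le> \<rho>" using Mlin \<delta> by (simp add: \<rho>_def)
  have sumI: "sum p I = 1 / 2 + \<delta>"
  proof -
    have "sum p I = sum p {1..d}"
      unfolding I_def using p01 by (intro sum.mono_neutral_left) (auto simp: less_le)
    then show ?thesis by (simp add: \<delta>_def delta_def)
  qed
  have finI: "finite I" by (simp add: I_def)
  have card: "card (UNIV :: cell set) = 16" by (simp add: card_prod)
  have "real (card (UNIV :: cell set)) * (\<rho> + M) \<le> sum p I"
    unfolding sumI card using M\<rho> \<delta> by (simp add: \<rho>_def)
  then obtain A :: "cell \<Rightarrow> nat set" where A: "\<forall>c\<in>UNIV. A c \<subseteq> I \<and> \<rho> \<le> sum p (A c) \<and> sum p (A c) \<le> \<rho> + M"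
    "disjoint_family_on A UNIV"
    using ex_disjoint_family_sum_between[of "UNIV :: cell set" I p M \<rho>] finI M0 \<delta> M
    by (auto simp: I_def \<rho>_def less_imp_le)
  have A_I: "A c \<subseteq> I" and A_ge: "\<rho> \<le> sum p (A c)" and A_le: "sum p (A c) \<le> \<rho> + M" for c
    using A(1) by blast+
  define D where "D = (\<Union>c. A c)"
  define J where "J = I - D"
  define cl where "cl a = (THE c. a \<in> A c)" for a
  have disj: "c = c'" if "a \<in> A c" "a \<in> A c'" for a c c'
    using that A(2) unfolding disjoint_family_on_def by blast
  have cl: "cl a = c" if "a \<in> A c" for a c
    unfolding cl_def by (rule the_equality, rule that, rule disj[OF _ that])
  have cells: "{a \<in> D. cl a = c} = A c" for c
    using cl unfolding D_def by blast
  have D_I: "D \<subseteq> I" using A_I unfolding D_def by blast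
  have finA: "finite (A c)" for c using A_I finI by (rule finite_subset)
  have "sum p D = (\<Sum>c\<in>UNIV. sum p (A c))"
    unfolding D_def using finA disj by (intro sum.UNION_disjoint) (simp, blast, blast)
  also have "\<dots> \<le> (\<Sum>c\<in>(UNIV :: cell set). \<rho> + M)" by (intro sum_mono A_le)
  also have "\<dots> = 16 * (\<rho> + M)" by (simp add: card)
  finally have sumD: "sum p D \<le> \<delta> / 2" using M\<rho> by (simp add: \<rho>_def)
  have sumJ: "1 / 2 + \<delta> / 2 \<le> sum p J"
    unfolding J_def using finI D_I sumD sumI by (subst sum_diff) auto
  \<comment> \<open>Since 512 = 8 * 64, this gives \<open>8 \<le> \<rho> * L\<close>.\<close>
  define L where "L = nat \<lceil>512 / \<delta>\<rceil>"
  have L_ge: "512 / \<delta> \<le> real L" unfolding L_def by linarith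
  have L_le: "real L \<le> 512 / \<delta> + 1" unfolding L_def using \<delta> by (simp add: of_nat_nat)
  have L1: "1 \<le> L" using L_ge \<delta> by (cases L) (auto simp: field_simps)
  have L\<delta>: "real L * \<delta> \<le> 512 + \<delta>" using L_le \<delta> by (simp add: field_simps)
  \<comment> \<open>The denominator is the lower bound for \<open>2 * sum p J\<close> from
    \<open>sumJ\<close>. It matters for large \<delta>, where \<open>L\<^sup>2 * M\<close> is only
    controlled by a multiple of \<open>1 + \<delta>\<close>.\<close>
  define \<eta> where "\<eta> = M / (1 + \<delta>)"
  define \<kappa> where "\<kappa> = M / (16 * \<rho>)"
  have L_M: "real L * M \<le> 1 / 10 ^ 9 * \<delta>"
  proof (cases "\<delta> \<le> 1")
    case True
    have "real L * M \<le> real L * (1 / 10 ^ 24 * \<delta>\<^sup>2)" using M2 by (intro mult_left_mono) auto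
    also have "\<dots> = 1 / 10 ^ 24 * ((real L * \<delta>) * \<delta>)" by (simp add: power2_eq_square)
    also have "\<dots> \<le> 1 / 10 ^ 24 * (513 * \<delta>)"
    proof (intro mult_left_mono mult_right_mono)
      show "real L * \<delta> \<le> 513" using L\<delta> True by linarith
    qed (use \<delta> in auto)
    finally show ?thesis using \<delta> by simp
  next
    case False
    have "real L * M \<le> real L * (1 / 10 ^ 12 * \<delta>)" using Mlin by (intro mult_left_mono) auto
    also have "\<dots> = 1 / 10 ^ 12 * (real L * \<delta>)" by simp
    also have "\<dots> \<le> 1 / 10 ^ 12 * (513 * \<delta>)"
    proof (rule mult_left_mono)
      show "real L * \<delta> \<le> 513 * \<delta>" using L\<delta> False by linarith
    qed simp
    finally show ?thesis using \<delta> by simp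
  qed
  have L2_M: "(real L)\<^sup>2 * M \<le> 1 / 10 ^ 6 * (1 + \<delta>)"
  proof -
    have "(real L)\<^sup>2 * M = real L * (real L * M)" by (simp add: power2_eq_square)
    also have "\<dots> \<le> real L * (1 / 10 ^ 9 * \<delta>)" using L_M by (intro mult_left_mono) auto
    also have "\<dots> = 1 / 10 ^ 9 * (real L * \<delta>)" by simp
    also have "\<dots> \<le> 1 / 10 ^ 9 * (512 + \<delta>)" using L\<delta> by (intro mult_left_mono) auto
    finally show ?thesis using \<delta> by simp
  qed
  interpret percolation_law p J \<eta> L D cl \<rho> \<kappa> d
  proof
    show "finite J" "finite D" using finI D_I finite_subset by (auto simp: J_def)
    show "0 < p i" if "i \<in> J" for i using that by (simp add: J_def I_def)
    show "1 \<le> 2 * sum p J" using sumJ \<delta> by simp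
    show "p i / (2 * sum p J) \<le> \<eta>" if "i \<in> J" for i
      unfolding \<eta>_def using that M[of i] M0 sumJ \<delta> by (intro frac_le) (auto simp: J_def I_def)
    show "1 \<le> L" by (rule L1)
    show "10000 * (real L)\<^sup>2 * \<eta> \<le> 1"
      using L2_M \<delta> by (simp add: \<eta>_def field_simps)
    show "D \<inter> J = {}" by (auto simp: J_def)
    show "0 < p a" if "a \<in> D" for a using that D_I by (auto simp: I_def)
    show "0 < \<rho>" using \<delta> by (simp add: \<rho>_def)
    show "\<rho> \<le> sum p {a \<in> D. cl a = c}" for c unfolding cells by (rule A_ge)
    show "8 \<le> \<rho> * real L" using L_ge \<delta> by (simp add: \<rho>_def field_simps)
    show "p a / (16 * \<rho>) \<le> \<kappa>" if "a \<in> D" for a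
      unfolding \<kappa>_def using that D_I M[of a] \<delta> by (intro divide_right_mono) (auto simp: I_def \<rho>_def)
    show "896 * real L * \<kappa> \<le> 1"
      using L_M \<delta> by (simp add: \<kappa>_def \<rho>_def field_simps)
    show "J \<subseteq> {1..d}" "D \<subseteq> {1..d}" using D_I by (auto simp: J_def I_def)
    show "p i \<le> 1" if "i \<in> {1..d}" for i using that p01 by (simp add: less_imp_le)
  qed
  show "theta d p > 0" by (rule theta_pos)
qed

end
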